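(* Let $X$ be any unconditional log-concave random vector in $\mathbb{R}^d$, let $a_1,\dots,a_d>0$, put $\Psi(y)=(1-e^{-a_iy_i})_{i=1}^d$ for $y\in\mathbb{R}_+^d$, and let $g:[0,1]^d\to\mathbb{R}$ be $L$-Lipschitz for Euclidean distance. Write $|X|=(|X_1|,\dots,|X_d|)$. Then, for every $t\in\mathbb{R}$, $$\log\mathbb{E}\exp\bigl\{t\bigl(g(\Psi(|X|))-\mathbb{E}g(\Psi(|X|))\bigr)\bigr\}\le C_TL^2t^2,\qquad C_T=C_{\rm clip}/4,$$ where $C_{\rm clip}$ is the universal constant of the clipping inequality recalled in the context. In particular the constant $C_T$ is independent of the coordinate parameters $a_i$.
   Context: A random vector $X$ in $\mathbb{R}^d$ is unconditional if $(\varepsilon_iX_i)_{i=1}^d$ has the same distribution as $X$ for every deterministic choice of signs $\varepsilon_i\in\{-1,1\}$. Log-concavity is meant in the measure sense: the law $\nu$ of $X$ satisfies $\nu(\theta A+(1-\theta)B)\ge\nu(A)^\theta\nu(B)^{1-\theta}$ for all nonempty compact $A,B$ and $\theta\in[0,1]$; laws supported on a proper subspace are allowed. Clipping inequality: put $\Delta(v)=v-1-\log v$ for $v>0$, $\Delta(0)=+\infty$, and $c_R(x)=\min(x/R,1)$ for $x\ge0$, $R>0$. $C_{\rm clip}<\infty$ is a universal constant (such a constant exists) such that for every $R>0$, every nonincreasing probability density $h$ on $\mathbb{R}_+=[0,\infty)$ and every nondecreasing locally absolutely continuous $T:\mathbb{R}_+\to\mathbb{R}_+$ with $T(0)=0$,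 $$\int_0^\infty|c_R(T(x))-c_R(x)|^2h(x)\,dx\le C_{\rm clip}\int_0^\infty\Delta(T'(x))h(x)\,dx.$$ *)

theory Defs
  imports "HOL-Probability.Probability"
begin

definition unconditional :: "'a measure \<Rightarrow> ('a \<Rightarrow> real ^ 'd) \<Rightarrow> bool" where
  "unconditional M X \<longleftrightarrow>
     (\<forall>e :: real ^ 'd. (\<forall>i. e $ i \<in> {-1, 1}) \<longrightarrow>
        distr M borel (\<lambda>\<omega>. \<chi> i. e $ i * X \<omega> $ i) = distr M borel X)"

text \<open>
  The library has \<open>0 powr 0 = 0\<close>. This is harmless here: it only concerns
  \<open>\<theta> \<in> {0, 1}\<close>, where the inequality is trivial under either convention for \<open>0\<^sup>0\<close>.
\<close>

definition log_concave_measure :: "(real ^ 'd) measure \<Rightarrow> bool" where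
  "log_concave_measure \<nu> \<longleftrightarrow>
     (\<forall>A B. \<forall>\<theta>\<in>{0..1}. compact A \<longrightarrow> compact B \<longrightarrow> A \<noteq> {} \<longrightarrow> B \<noteq> {} \<longrightarrow>
        measure \<nu> {\<theta> *\<^sub>R x + (1 - \<theta>) *\<^sub>R y | x y. x \<in> A \<and> y \<in> B}
          \<ge> measure \<nu> A powr \<theta> * measure \<nu> B powr (1 - \<theta>))"

text \<open>
  Absolute continuity on \<open>[a, b]\<close> in the usual epsilon-delta form, over finite families of
  non-overlapping subintervals \<open>[u k, v k]\<close>.
\<close>

definition abs_continuous_on_interval :: "real \<Rightarrow> real \<Rightarrow> (real \<Rightarrow> real) \<Rightarrow> bool" where
  "abs_continuous_on_interval a b f \<longleftrightarrow>
     (\<forall>\<epsilon>>0. \<exists>\<delta>>0. \<forall>n::nat. \<forall>u v :: nat \<Rightarrow> real.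
        (\<forall>k<n. a \<le> u k \<and> u k \<le> v k \<and> v k \<le> b) \<and>
        disjoint_family_on (\<lambda>k. {u k<..<v k}) {..<n} \<and>
        (\<Sum>k<n. v k - u k) < \<delta> \<longrightarrow>
        (\<Sum>k<n. \<bar>f (v k) - f (u k)\<bar>) < \<epsilon>)"

text \<open>
  \<open>v - 1 - ln v \<ge> 0\<close> for \<open>v > 0\<close>, so the truncation in \<^const>\<open>ennreal\<close> is not active. The value
  at \<open>v < 0\<close> is irrelevant: the function is only applied to derivatives of nondecreasing maps.
\<close>

definition clip_Delta :: "real \<Rightarrow> ennreal" where
  "clip_Delta v = (if v > 0 then ennreal (v - 1 - ln v) else \<infinity>)"

definition clip :: "real \<Rightarrow> real \<Rightarrow> real" where
  "clip R x = min (x / R) 1"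

definition nonincreasing_density :: "(real \<Rightarrow> real) \<Rightarrow> bool" where
  "nonincreasing_density h \<longleftrightarrow>
     (\<forall>x\<ge>0. 0 \<le> h x) \<and> antimono_on {0..} h \<and> (\<integral>\<^sup>+x\<in>{0..}. ennreal (h x) \<partial>lborel) = 1"

text \<open>
  \<open>C\<close> is an admissible universal constant in the clipping inequality. Both integrals are taken in
  \<open>[0, \<infinity>]\<close>, so an infinite right-hand side imposes no constraint. The map \<open>T\<close> is differentiable
  almost everywhere on \<open>[0, \<infinity>)\<close>; the junk value of \<^const>\<open>deriv\<close> on the exceptional null set
  does not influence the integral.
\<close>

definition clipping_constant :: "real \<Rightarrow> bool" where
  "clipping_constant C \<longleftrightarrow> 0 \<le> C \<and>
     (\<forall>R>0. \<forall>h T :: real \<Rightarrow> real.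
        nonincreasing_density h \<longrightarrow>
        mono_on {0..} T \<longrightarrow> (\<forall>x\<ge>0. 0 \<le> T x) \<longrightarrow> T 0 = 0 \<longrightarrow>
        (\<forall>b\<ge>0. abs_continuous_on_interval 0 b T) \<longrightarrow>
        (\<integral>\<^sup>+x\<in>{0..}. ennreal (\<bar>clip R (T x) - clip R x\<bar>\<^sup>2 * h x) \<partial>lborel)
          \<le> ennreal C * (\<integral>\<^sup>+x\<in>{0..}. clip_Delta (deriv T x) * ennreal (h x) \<partial>lborel))"

definition Psi :: "real ^ 'd \<Rightarrow> real ^ 'd \<Rightarrow> real ^ 'd" where
  "Psi a y = (\<chi> i. 1 - exp (- (a $ i * y $ i)))"

end

theory Submission
  imports Defs
begin

text \<open>
  The proof transports measures without optimal transport. For a density \<open>v\<close> on the orthant with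
  partial derivatives \<open>-r i\<close>, suppose a function \<open>w\<close> satisfies
  \<open>ln (w y) \<le> k x + ln (v x) - (\<Sum>i. r i x / v x * (y i - x i)) + (\<Sum>i. (\<psi> i (y i) - \<psi> i (x i))\<^sup>2 / C)\<close>
  for all \<open>x\<close>, \<open>y\<close>. Then \<open>ln \<integral>w \<le> ln \<integral>v + \<integral>k v / \<integral>v\<close>. In dimension one this is seen by moving \<open>v\<close> to \<open>w\<close>
  with the monotone map \<open>T\<close>: integration by parts turns the linear term into \<open>\<integral>(T' - 1) v\<close>, and the
  clipping inequality absorbs the quadratic one. No convexity enters the implication, which is why it
  passes from sections to marginals and extends to all dimensions by Fubini.

  For a log-concave \<open>v\<close> the tangent inequality for \<open>- ln v\<close> gives the hypothesis with \<open>w = v exp (t G)\<close> and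
  \<open>k = t G + C L\<^sup>2 t\<^sup>2 / 4\<close>. A general law \<open>\<nu>\<close> is smoothed by the kernel \<open>exp (- \<Sum>i. sqrt (1 + N\<^sup>2 u\<^sub>i\<^sup>2))\<close>, whose level sets
  are compact and convex: the layer-cake formula and the one-dimensional Prekopa--Leindler inequality
  turn log-concavity of \<open>\<nu>\<close> as a measure into log-concavity of the smoothed density. Letting \<open>N\<close> tend to
  infinity concludes.
\<close>

section \<open>One-dimensional monotone transport\<close>

text \<open>The constant does not see the \<open>a $ i\<close> because the profile 1 - exp (- a x)
  is the mean of min (x / R) 1 over a Gamma distributed R: Jensen's inequality hands the clipping
  inequality to the profile with the same constant. The factor 1/4 is what completing the square
  leaves in |t| L sqrt S \<le> C L^2 t^2 / 4 + S / C, where S / C is exactly the quadratic term that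
  the hypothesis on \<open>w\<close> tolerates. Unconditionality serves twice: it folds the law onto
  the orthant, and with log-concavity it makes the smoothed density nonincreasing in each
  coordinate. The latter is recorded as nonnegativity of \<open>r i\<close>, which survives
  integrating coordinates out, so that every one-dimensional marginal is nonincreasing, as the
  clipping inequality demands. The law may have no density and no prescribed decay. Hence the
  smoothing, and next to it a factor exp (- \<delta> (sum of the y i)): it is log-linear, so it
  keeps the tangent inequality, and it makes all integrals finite. The argument divides by C, while
  0 is a possible clipping constant; it therefore runs with C above \<open>C_clip\<close> and lets C
  decrease to it at the end.\<close>

lemma antiderivative_at_top:
  fixes f :: "real \<Rightarrow> real"
  assumes cont: "continuous_on UNIV f" and nonneg: "\<And>x. 0 \<le> f x"
    and fin: "(\<integral>\<^sup>+x\<in>{0..}. ennreal (f x) \<partial>lborel) = ennreal I" and I: "0 \<le> I"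
  obtains F where "F 0 = 0" "\<And>x. (F has_real_derivative f x) (at x)" "(F \<longlongrightarrow> I) at_top"
    "\<And>x. F x \<le> I"
proof -
  define F where "F = (\<lambda>x::real. LBINT y=0..x. f y)"
  have [measurable]: "f \<in> borel_measurable borel"
    using cont by (rule borel_measurable_continuous_onI)
  have F0: "F 0 = 0"
    by (simp add: F_def zero_ereal_def)
  have der: "(F has_real_derivative f x) (at x)" for x
  proof -
    have "((\<lambda>u. LBINT y=0..u. f y) has_vector_derivative f x) (at x within {-\<bar>x\<bar>-1..\<bar>x\<bar>+1})"
      using interval_integral_FTC2[of "-\<bar>x\<bar>-1" 0 "\<bar>x\<bar>+1" f x] continuous_on_subset[OF cont]
      by (auto simp: zero_ereal_def)
    moreover have "at x within {-\<bar>x\<bar>-1..\<bar>x\<bar>+1} = at x"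
      by (rule at_within_interior) auto
    ultimately show ?thesis
      by (simp add: F_def has_real_derivative_iff_has_vector_derivative)
  qed
  have mono: "mono F"
    by (rule monoI, rule DERIV_nonneg_imp_nondecreasing) (use der nonneg in blast)+
  have bound: "F x \<le> I" for x
  proof (cases "x \<ge> 0")
    case True
    have "ennreal (F x - F 0) = (\<integral>\<^sup>+y. ennreal (f y) * indicator {0..x} y \<partial>lborel)"
      by (rule nn_integral_FTC_Icc[symmetric]) (use der nonneg True in auto)
    also have "\<dots> \<le> (\<integral>\<^sup>+y\<in>{0..}. ennreal (f y) \<partial>lborel)"
      by (rule nn_integral_mono) (auto split: split_indicator)
    finally show ?thesis using fin I F0 by simp
  next
    case False
    then show ?thesis using monoD[OF mono, of x 0] F0 I by simp
  qed
  have "incseq (\<lambda>n. F (real n))"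
    using mono by (auto simp: incseq_def mono_def)
  then obtain l where l: "(\<lambda>n. F (real n)) \<longlonglongrightarrow> l"
    using incseq_convergent[of "\<lambda>n. F (real n)" I] bound by blast
  have lim: "(F \<longlongrightarrow> l) at_top"
    using mono l by (intro tendsto_at_topI_sequentially_real)
  have "0 \<le> l"
    using LIMSEQ_le_const[OF l, of 0] monoD[OF mono, of 0] F0 by fastforce
  have "(\<integral>\<^sup>+x\<in>{0..}. ennreal (f x) \<partial>lborel) = ennreal (l - F 0)"
    by (rule nn_integral_FTC_atLeast) (use der nonneg lim in auto)
  then have "l = I" using fin F0 I \<open>0 \<le> l\<close> by simp
  with lim show ?thesis using that F0 der bound by blast
qed

text \<open>Meant for the transport map, which is continuously differentiable and therefore
  Lipschitz on each \<open>{0..b}\<close>.\<close>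

lemma abs_continuous_on_interval_lipschitz:
  assumes lip: "\<And>x y. x \<in> {a..b} \<Longrightarrow> y \<in> {a..b} \<Longrightarrow> x \<le> y \<Longrightarrow> \<bar>f y - f x\<bar> \<le> B * (y - x)"
  shows "abs_continuous_on_interval a b f"
  unfolding abs_continuous_on_interval_def
proof (intro allI impI)
  fix \<epsilon> :: real assume "\<epsilon> > 0"
  define \<delta> where "\<delta> = \<epsilon> / (\<bar>B\<bar> + 1)"
  have "\<delta> > 0" using \<open>\<epsilon> > 0\<close> by (simp add: \<delta>_def)
  show "\<exists>\<delta>>0. \<forall>n::nat. \<forall>u v :: nat \<Rightarrow> real. (\<forall>k<n. a \<le> u k \<and> u k \<le> v k \<and> v k \<le> b) \<and>
        disjoint_family_on (\<lambda>k. {u k<..<v k}) {..<n} \<and> (\<Sum>k<n. v k - u k) < \<delta> \<longrightarrow>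
        (\<Sum>k<n. \<bar>f (v k) - f (u k)\<bar>) < \<epsilon>"
  proof (intro exI[of _ \<delta>] conjI allI impI \<open>\<delta> > 0\<close>; elim conjE)
    fix n :: nat and u v :: "nat \<Rightarrow> real"
    assume uv: "\<forall>k<n. a \<le> u k \<and> u k \<le> v k \<and> v k \<le> b" and s: "(\<Sum>k<n. v k - u k) < \<delta>"
    have "(\<Sum>k<n. \<bar>f (v k) - f (u k)\<bar>) \<le> (\<Sum>k<n. (\<bar>B\<bar> + 1) * (v k - u k))"
    proof (rule sum_mono)
      fix k assume "k \<in> {..<n}"
      with uv have k: "a \<le> u k" "u k \<le> v k" "v k \<le> b" by auto
      then have "\<bar>f (v k) - f (u k)\<bar> \<le> B * (v k - u k)" by (intro lip) auto
      also have "\<dots> \<le> (\<bar>B\<bar> + 1) * (v k - u k)" using k by (intro mult_right_mono) auto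
      finally show "\<bar>f (v k) - f (u k)\<bar> \<le> (\<bar>B\<bar> + 1) * (v k - u k)" .
    qed
    also have "\<dots> = (\<bar>B\<bar> + 1) * (\<Sum>k<n. v k - u k)" by (simp add: sum_distrib_left)
    also have "\<dots> < (\<bar>B\<bar> + 1) * \<delta>" using s by (intro mult_strict_left_mono) auto
    also have "\<dots> = \<epsilon>" unfolding \<delta>_def by (simp add: field_simps)
    finally show "(\<Sum>k<n. \<bar>f (v k) - f (u k)\<bar>) < \<epsilon>" .
  qed
qed

text \<open>The half-line is a measure space of its own, so that Lebesgue measure on the orthant is
  a product of copies of it and nonnegativity of coordinates is membership in the space.\<close>

definition HL :: "real measure" where "HL = restrict_space lborel {0..}"

lemma space_HL: "space HL = {0..}"
  by (simp add: HL_def space_restrict_space)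

lemma nn_integral_HL: "(\<integral>\<^sup>+x. f x \<partial>HL) = (\<integral>\<^sup>+x\<in>{0..}. f x \<partial>lborel)"
  by (simp add: HL_def nn_integral_restrict_space)

lemma measurable_HL: "f \<in> measurable borel N \<Longrightarrow> f \<in> measurable HL N"
  by (simp add: HL_def measurable_restrict_space1)

lemma sigma_finite_HL: "sigma_finite_measure HL"
  unfolding HL_def by (rule sigma_finite_measure_restrict_space) (auto simp: lborel.sigma_finite_measure_axioms)

text \<open>The clipping inequality with a general profile \<psi> in place of \<open>clip R\<close>.
  It is the only form in which the clipping hypothesis reaches the transport argument.\<close>

definition transport_cost :: "real \<Rightarrow> (real \<Rightarrow> real) \<Rightarrow> bool" where
  "transport_cost C \<psi> \<longleftrightarrow>
     (\<forall>h T. nonincreasing_density h \<longrightarrow>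
        mono_on {0..} T \<longrightarrow> (\<forall>x\<ge>0. 0 \<le> T x) \<longrightarrow> T 0 = 0 \<longrightarrow>
        (\<forall>b\<ge>0. abs_continuous_on_interval 0 b T) \<longrightarrow>
        (\<integral>\<^sup>+x. ennreal ((\<psi> (T x) - \<psi> x)\<^sup>2 * h x) \<partial>HL)
          \<le> ennreal C * (\<integral>\<^sup>+x. clip_Delta (deriv T x) * ennreal (h x) \<partial>HL))"

text \<open>
  The densities are extended evenly to the line, so that the map is a diffeomorphism near \<open>0\<close> as well.
\<close>

lemma monotone_transport:
  fixes v w :: "real \<Rightarrow> real"
  assumes v: "continuous_on UNIV v" "\<And>x. 0 < v x" and w: "continuous_on UNIV w" "\<And>x. 0 < w x"
    and Iv: "(\<integral>\<^sup>+x. ennreal (v x) \<partial>HL) = ennreal Zv" "0 < Zv"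
    and Iw: "(\<integral>\<^sup>+x. ennreal (w x) \<partial>HL) = ennreal Zw" "0 < Zw"
    and even: "\<And>x. v (- x) = v x" "\<And>x. w (- x) = w x"
  obtains T where "T 0 = 0" "mono T" "\<And>x. 0 \<le> x \<Longrightarrow> 0 \<le> T x"
    "\<And>x. (T has_real_derivative (Zw / Zv * v x / w (T x))) (at x)"
proof -
  obtain F where F: "F 0 = 0" "\<And>x. (F has_real_derivative v x) (at x)" "(F \<longlongrightarrow> Zv) at_top" "\<And>x. F x \<le> Zv"
    using antiderivative_at_top[OF v(1) less_imp_le[OF v(2)], of Zv] Iv unfolding nn_integral_HL by auto
  obtain G where G: "G 0 = 0" "\<And>x. (G has_real_derivative w x) (at x)" "(G \<longlongrightarrow> Zw) at_top" "\<And>x. G x \<le> Zw"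
    using antiderivative_at_top[OF w(1) less_imp_le[OF w(2)], of Zw] Iw unfolding nn_integral_HL by auto
  have odd: "H (- x) = - H x" if "H 0 = 0" "\<And>x. (H has_real_derivative u x) (at x)" "\<And>x. u (-x) = u x"
    for H u :: "real \<Rightarrow> real" and x
  proof -
    have "((\<lambda>x. H (-x) + H x) has_real_derivative 0) (at x)" for x
    proof -
      have "((\<lambda>x. H (-x) + H x) has_real_derivative (u (-x) * (-1) + u x)) (at x)"
        by (rule DERIV_add[OF DERIV_chain2 that(2)]) (auto intro!: that(2) derivative_eq_intros)
      then show ?thesis by (simp add: that(3))
    qed
    then have "H (-x) + H x = H (-0) + H 0" for x
      using DERIV_isconst_all[of "\<lambda>x. H (-x) + H x" x 0] by blast
    then show ?thesis using that(1) by (simp add: add_eq_0_iff2)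
  qed
  have Fstrict: "strict_mono F" and Gstrict: "strict_mono G"
    by (rule strict_monoI, rule DERIV_pos_imp_increasing; use F G v w in blast)+
  have contG: "isCont G x" for x using G(2) DERIV_isCont by blast
  have contF: "isCont F x" for x using F(2) DERIV_isCont by blast
  have Flt: "F x < Zv" for x
    using F(4)[of "x+1"] strict_monoD[OF Fstrict, of x "x+1"] by simp
  have Fodd: "F (-x) = - F x" and Godd: "G (-x) = - G x" for x
    using odd[OF F(1,2)] odd[OF G(1,2)] even by blast+
  have ex: "\<exists>t. G t = p" if "\<bar>p\<bar> < Zw" for p
  proof -
    have "eventually (\<lambda>x. \<bar>p\<bar> < G x) at_top" using G(3) that by (rule order_tendstoD)
    then obtain x where x: "\<bar>p\<bar> < G x" "x \<ge> 0"
      by (metis eventually_at_top_linorder linorder_le_cases order.trans)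
    have "\<exists>t\<ge>-x. t \<le> x \<and> G t = p"
      by (rule IVT) (use x contG Godd in auto)
    then show ?thesis by blast
  qed
  \<comment> \<open>\<open>T\<close> matches the masses of \<open>[0, y]\<close> and
    \<open>[0, T y]\<close> after rescaling by the totals. The value exists because |F| stays below
    \<open>Zv\<close> while \<open>G\<close> takes every value in (-Zw, Zw); it is unique because
    \<open>G\<close> is strictly increasing.\<close>
  define T where "T = (\<lambda>y. THE t. G t = Zw / Zv * F y)"
  have absF: "\<bar>F y\<bar> < Zv" for y
    using Flt[of y] Flt[of "-y"] Fodd by auto
  have GT: "G (T y) = Zw / Zv * F y" for y
  proof -
    have "\<bar>Zw / Zv * F y\<bar> < Zw"
      using absF[of y] Iv(2) Iw(2) by (simp add: abs_mult field_simps)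
    then obtain t where "G t = Zw / Zv * F y" using ex by blast
    then have "\<exists>!t. G t = Zw / Zv * F y" using Gstrict by (metis strict_mono_eq)
    then show ?thesis unfolding T_def by (rule theI')
  qed
  define g where "g = the_inv G"
  have gG: "g (G t) = t" for t
    unfolding g_def using the_inv_f_f[OF strict_mono_imp_inj_on[OF Gstrict]] .
  have Tg: "T = (\<lambda>y. g (Zw / Zv * F y))" using gG GT by metis
  have derT: "(T has_real_derivative (Zw / Zv * v x / w (T x))) (at x)" for x
  proof -
    have c: "isCont g (G (T x))"
      by (rule isCont_inverse_function[where d=1]) (use gG contG in auto)
    have "DERIV g (G (T x)) :> inverse (w (T x))"
    proof (rule DERIV_inverse_function[where a = "-Zw" and b = Zw])
      show "DERIV G (g (G (T x))) :> w (T x)" using G(2) gG by simp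
      show "w (T x) \<noteq> 0" using w(2)[of "T x"] by simp
      have "\<bar>Zw / Zv * F x\<bar> < Zw"
        using absF[of x] Iv(2) Iw(2) by (simp add: abs_mult field_simps)
      then show "- Zw < G (T x)" "G (T x) < Zw" unfolding GT by linarith+
      show "G (g y) = y" if "-Zw < y" "y < Zw" for y
      proof -
        have "\<bar>y\<bar> < Zw" using that by auto
        with ex obtain t where "G t = y" by blast
        then show ?thesis using gG by metis
      qed
    qed (rule c)
    then have "DERIV (\<lambda>y. g (Zw / Zv * F y)) x :> inverse (w (T x)) * (Zw / Zv * v x)"
      unfolding GT by (rule DERIV_chain2) (rule DERIV_cmult[OF F(2)])
    then show ?thesis unfolding Tg using Iv(2) w(2)[of "g (Zw / Zv * F x)"] by (simp add: field_simps)
  qed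
  have "T 0 = 0" using GT[of 0] F(1) gG[of 0] gG[of "T 0"] G(1) by simp
  moreover have "mono T"
  proof (rule monoI)
    fix x y :: real assume "x \<le> y"
    then show "T x \<le> T y"
    proof (rule DERIV_nonneg_imp_nondecreasing)
      fix z :: real show "\<exists>d. (T has_real_derivative d) (at z) \<and> 0 \<le> d"
        using derT[of z] v(2)[of z] w(2)[of "T z"] Iv(2) Iw(2) by (intro exI conjI) (auto simp: field_simps)
    qed
  qed
  ultimately show ?thesis using that derT by (metis monoD)
qed

section \<open>Integration on the half-line\<close>

lemma sets_HL: "sets HL = sets (restrict_space borel {0..})"
  unfolding HL_def by (rule sets_restrict_space_cong) simp

lemma AE_HL: "(\<And>x. 0 \<le> x \<Longrightarrow> P x) \<Longrightarrow> AE x in HL. P x"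
  by (rule AE_I2) (simp add: space_HL)

lemma emeasure_HL_unit: "emeasure HL {0..1} = 1"
  by (simp add: HL_def emeasure_restrict_space)

lemma nn_integral_exp_HL:
  assumes "0 < \<delta>"
  shows "(\<integral>\<^sup>+x. ennreal (exp (- (\<delta> * x))) \<partial>HL) = ennreal (1 / \<delta>)"
proof -
  have "(\<integral>\<^sup>+x\<in>{0..}. ennreal (exp (- (\<delta> * x))) \<partial>lborel) = ennreal (0 - (- exp (- (\<delta> * 0)) / \<delta>))"
  proof (rule nn_integral_FTC_atLeast)
    show "((\<lambda>x. - exp (- (\<delta> * x)) / \<delta>) has_real_derivative exp (- (\<delta> * x))) (at x)" for x
      using assms by (auto intro!: derivative_eq_intros)
    have "filterlim (\<lambda>x. \<delta> * x) at_top at_top"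
      using assms by (intro filterlim_tendsto_pos_mult_at_top[OF tendsto_const]) (auto simp: filterlim_ident)
    then have "((\<lambda>x. exp (- (\<delta> * x))) \<longlongrightarrow> 0) at_top"
      by (intro filterlim_compose[OF exp_at_bot]) (simp add: filterlim_uminus_at_top)
    from tendsto_divide[OF tendsto_minus[OF this] tendsto_const[of \<delta>]] assms
    show "((\<lambda>x. - exp (- (\<delta> * x)) / \<delta>) \<longlongrightarrow> 0) at_top" by simp
  qed auto
  then show ?thesis by (simp add: nn_integral_HL)
qed

lemma integrable_exp_HL: "0 < \<delta> \<Longrightarrow> integrable HL (\<lambda>x. exp (- (\<delta> * x)))"
  by (rule integrableI_bounded) (auto simp: nn_integral_exp_HL intro: measurable_HL)

lemma integrable_ident_exp_HL:
  assumes "0 < \<delta>" shows "integrable HL (\<lambda>x. x * exp (- (\<delta> * x)))"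
proof (rule Bochner_Integration.integrable_bound)
  show "integrable HL (\<lambda>x. 2 / \<delta> * exp (- (\<delta> / 2 * x)))"
    using integrable_exp_HL[of "\<delta> / 2"] assms by (intro integrable_mult_right) auto
  show "AE x in HL. norm (x * exp (- (\<delta> * x))) \<le> norm (2 / \<delta> * exp (- (\<delta> / 2 * x)))"
  proof (rule AE_I2)
    fix x assume "x \<in> space HL"
    then have x: "0 \<le> x" by (simp add: space_HL)
    have "\<delta> / 2 * x \<le> exp (\<delta> / 2 * x)" using exp_ge_add_one_self[of "\<delta> / 2 * x"] by linarith
    then have "x \<le> 2 / \<delta> * exp (\<delta> / 2 * x)" using assms by (simp add: field_simps)
    then have "x * exp (- (\<delta> * x)) \<le> 2 / \<delta> * exp (\<delta> / 2 * x) * exp (- (\<delta> * x))"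
      by (intro mult_right_mono) auto
    also have "\<dots> = 2 / \<delta> * exp (- (\<delta> / 2 * x))" by (simp add: exp_add[symmetric])
    finally show "norm (x * exp (- (\<delta> * x))) \<le> norm (2 / \<delta> * exp (- (\<delta> / 2 * x)))"
      using x assms by simp
  qed
qed (auto intro: measurable_HL)

text \<open>The second hypothesis is the Lipschitz property of \<open>ln v\<close>, written as a
  bound linear in \<open>v\<close> so that it survives integration over other coordinates.\<close>

lemma continuous_on_log_lipschitz:
  fixes v :: "real \<Rightarrow> real"
  assumes pos: "\<And>x. 0 \<le> x \<Longrightarrow> 0 < v x"
    and lip: "\<And>x y. 0 \<le> x \<Longrightarrow> 0 \<le> y \<Longrightarrow> v x \<le> exp (B * \<bar>x - y\<bar>) * v y"
  shows "continuous_on {0..} v"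
proof -
  have 1: "ln (v x) - ln (v y) \<le> B * \<bar>x - y\<bar>" if "0 \<le> x" "0 \<le> y" for x y
  proof -
    have "ln (v x) \<le> ln (exp (B * \<bar>x - y\<bar>) * v y)"
      using lip[OF that] pos[OF that(1)] pos[OF that(2)] by (subst ln_le_cancel_iff) auto
    then show ?thesis using pos[OF that(2)] by (simp add: ln_mult)
  qed
  have "0 \<le> B" using 1[of 0 1] 1[of 1 0] by simp
  have "B-lipschitz_on {0..} (\<lambda>x. ln (v x))"
  proof (rule lipschitz_onI)
    fix x y :: real assume "x \<in> {0..}" "y \<in> {0..}"
    then show "dist (ln (v x)) (ln (v y)) \<le> B * dist x y"
      using 1[of x y] 1[of y x] by (simp add: dist_real_def abs_le_iff abs_minus_commute)
  qed fact
  then have "continuous_on {0..} (\<lambda>x. exp (ln (v x)))"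
    by (intro continuous_on_exp lipschitz_on_continuous_on)
  then show ?thesis by (rule continuous_on_eq) (use pos in auto)
qed

text \<open>Here \<open>r\<close> stands for minus the derivative of \<open>v\<close>. Both sides
  equal the integral of \<open>r x * U' s\<close> over the pairs with 0 \<le> s \<le> x, so
  Tonelli's theorem replaces integration by parts: \<open>v\<close> is not differentiated and no
  boundary term appears.\<close>

lemma nn_integral_by_parts_HL:
  assumes r[measurable]: "r \<in> borel_measurable HL" and rnn: "\<And>x. 0 \<le> x \<Longrightarrow> 0 \<le> r x"
    and v: "\<And>x. 0 \<le> x \<Longrightarrow> ennreal (v x) = (\<integral>\<^sup>+s. ennreal (r s) * indicator {x..} s \<partial>HL)"
    and U: "\<And>x. (U has_real_derivative U' x) (at x)" "\<And>x. 0 \<le> U' x" "U 0 = 0"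
    and U'[measurable]: "U' \<in> borel_measurable borel"
  shows "(\<integral>\<^sup>+x. ennreal (r x * U x) \<partial>HL) = (\<integral>\<^sup>+x. ennreal (v x * U' x) \<partial>HL)"
proof -
  interpret pair_sigma_finite HL HL
    by (simp add: pair_sigma_finite_def sigma_finite_HL)
  have [measurable]: "U' \<in> borel_measurable HL" by (rule measurable_HL) measurable
  have [measurable]: "(\<lambda>x. x) \<in> borel_measurable HL" by (rule measurable_HL) measurable
  have "(\<integral>\<^sup>+x. ennreal (r x * U x) \<partial>HL)
      = (\<integral>\<^sup>+x. (\<integral>\<^sup>+s. ennreal (r x) * ennreal (U' s) * (if s \<le> x then 1 else 0) \<partial>HL) \<partial>HL)"
  proof (rule nn_integral_cong)
    fix x assume "x \<in> space HL"
    then have x: "0 \<le> x" by (simp add: space_HL)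
    have "ennreal (U x - U 0) = (\<integral>\<^sup>+s. ennreal (U' s) * indicator {0..x} s \<partial>lborel)"
      by (rule nn_integral_FTC_Icc[symmetric]) (use U x in auto)
    also have "\<dots> = (\<integral>\<^sup>+s. ennreal (U' s) * (if s \<le> x then 1 else 0) \<partial>HL)"
      unfolding nn_integral_HL by (rule nn_integral_cong) (auto split: split_indicator)
    finally have "ennreal (U x) = (\<integral>\<^sup>+s. ennreal (U' s) * (if s \<le> x then 1 else 0) \<partial>HL)"
      using U(3) by simp
    then have "ennreal (r x * U x) = ennreal (r x) * (\<integral>\<^sup>+s. ennreal (U' s) * (if s \<le> x then 1 else 0) \<partial>HL)"
      by (metis ennreal_mult' rnn x)
    also have "\<dots> = (\<integral>\<^sup>+s. ennreal (r x) * (ennreal (U' s) * (if s \<le> x then 1 else 0)) \<partial>HL)"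
      by (rule nn_integral_cmult[symmetric]) measurable
    finally show "ennreal (r x * U x) = (\<integral>\<^sup>+s. ennreal (r x) * ennreal (U' s) * (if s \<le> x then 1 else 0) \<partial>HL)"
      by (simp add: mult.assoc)
  qed
  also have "\<dots> = (\<integral>\<^sup>+s. (\<integral>\<^sup>+x. ennreal (r x) * ennreal (U' s) * (if s \<le> x then 1 else 0) \<partial>HL) \<partial>HL)"
    by (rule Fubini') measurable
  also have "\<dots> = (\<integral>\<^sup>+s. ennreal (v s * U' s) \<partial>HL)"
  proof (rule nn_integral_cong)
    fix s assume "s \<in> space HL"
    then have s: "0 \<le> s" by (simp add: space_HL)
    have "(\<integral>\<^sup>+x. ennreal (r x) * ennreal (U' s) * (if s \<le> x then 1 else 0) \<partial>HL)
        = (\<integral>\<^sup>+x. ennreal (U' s) * (ennreal (r x) * indicator {s..} x) \<partial>HL)"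
      by (rule nn_integral_cong) (auto split: split_indicator simp: mult_ac)
    also have "\<dots> = ennreal (U' s) * (\<integral>\<^sup>+x. ennreal (r x) * indicator {s..} x \<partial>HL)"
      by (rule nn_integral_cmult) measurable
    also have "\<dots> = ennreal (v s * U' s)"
      using v[OF s] U(2) by (metis ennreal_mult'' mult.commute)
    finally show "(\<integral>\<^sup>+x. ennreal (r x) * ennreal (U' s) * (if s \<le> x then 1 else 0) \<partial>HL) = ennreal (v s * U' s)" .
  qed
  finally show ?thesis .
qed

lemma integral_pos:
  fixes u :: "'a \<Rightarrow> real"
  assumes i: "integrable M u" and pos: "\<And>x. x \<in> space M \<Longrightarrow> 0 < u x" and M: "emeasure M (space M) \<noteq> 0"
  shows "0 < (\<integral>x. u x \<partial>M)"
proof -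
  have nn: "AE x in M. 0 \<le> u x" using pos by (auto intro!: AE_I2 less_imp_le)
  have "(\<integral>x. u x \<partial>M) \<noteq> 0"
  proof
    assume "(\<integral>x. u x \<partial>M) = 0"
    then have "AE x in M. u x = 0" using integral_nonneg_eq_0_iff_AE[OF i nn] by simp
    then have "AE x in M. False" using AE_space by eventually_elim (use pos in force)
    then have "space M \<in> null_sets M" by (simp add: AE_iff_null_sets)
    then show False using M by auto
  qed
  with integral_nonneg_AE[OF nn] show ?thesis by linarith
qed

text \<open>For the monotone map \<open>T\<close> from \<open>v\<close> to \<open>w\<close>, the
  equation ln T' = ln Zw - ln Zv + ln v - ln (w o T) holds. Insert it into \<open>main\<close> at
  the pair (x, T x), multiply by \<open>v\<close> and integrate. The squared displacement is bounded
  by C times the cost, and the cost is bounded by terms that contain the squared displacement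
  divided by C. The two cancel, and what remains is the bound on ln Zw - ln Zv. The decay and
  Lipschitz hypotheses make each integral finite, so that the cancellation is legitimate.\<close>

lemma transport_inequality_1d:
  fixes v w r k :: "real \<Rightarrow> real"
  assumes C: "0 < C" and tc: "transport_cost C \<psi>"
    and \<psi>[measurable]: "\<psi> \<in> borel_measurable borel" and \<psi>01: "\<And>x. 0 \<le> x \<Longrightarrow> \<psi> x \<in> {0..1}"
    and \<delta>: "0 < \<delta>"
    and v: "\<And>x. 0 \<le> x \<Longrightarrow> 0 < v x" "\<And>x. 0 \<le> x \<Longrightarrow> v x \<le> K * exp (- (\<delta> * x))"
      "\<And>x y. 0 \<le> x \<Longrightarrow> 0 \<le> y \<Longrightarrow> v x \<le> exp (B * \<bar>x - y\<bar>) * v y"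
    and w: "\<And>x. 0 \<le> x \<Longrightarrow> 0 < w x" "\<And>x. 0 \<le> x \<Longrightarrow> w x \<le> K * exp (- (\<delta> * x))"
      "\<And>x y. 0 \<le> x \<Longrightarrow> 0 \<le> y \<Longrightarrow> w x \<le> exp (B * \<bar>x - y\<bar>) * w y"
    and r[measurable]: "r \<in> borel_measurable HL" and r0: "\<And>x. 0 \<le> x \<Longrightarrow> 0 \<le> r x"
    and rB: "\<And>x. 0 \<le> x \<Longrightarrow> r x \<le> B * v x"
    and rv: "\<And>x. 0 \<le> x \<Longrightarrow> ennreal (v x) = (\<integral>\<^sup>+s. ennreal (r s) * indicator {x..} s \<partial>HL)"
    and k[measurable]: "k \<in> borel_measurable HL" and kD: "\<And>x. 0 \<le> x \<Longrightarrow> \<bar>k x\<bar> \<le> D"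
    and main: "\<And>x y. 0 \<le> x \<Longrightarrow> 0 \<le> y \<Longrightarrow>
      ln (w y) \<le> k x + ln (v x) - r x / v x * (y - x) + (\<psi> y - \<psi> x)\<^sup>2 / C"
  shows "ln (\<integral>x. w x \<partial>HL) \<le> ln (\<integral>x. v x \<partial>HL) + (\<integral>x. k x * v x \<partial>HL) / (\<integral>x. v x \<partial>HL)"
proof -
  define v0 w0 where "v0 = (\<lambda>x. v \<bar>x\<bar>)" and "w0 = (\<lambda>x. w \<bar>x\<bar>)"
  have cont: "continuous_on UNIV (\<lambda>x::real. u \<bar>x\<bar>)"
    if "\<And>x. 0 \<le> x \<Longrightarrow> 0 < u x" "\<And>x y. 0 \<le> x \<Longrightarrow> 0 \<le> y \<Longrightarrow> u x \<le> exp (B * \<bar>x - y\<bar>) * u y" for u :: "real \<Rightarrow> real"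
    by (rule continuous_on_compose2[OF continuous_on_log_lipschitz[OF that]]) (auto intro: continuous_intros)
  have cv: "continuous_on UNIV v0" and cw: "continuous_on UNIV w0"
    unfolding v0_def w0_def using cont v w by blast+
  have v0pos: "0 < v0 x" and w0pos: "0 < w0 x" for x
    using v(1) w(1) by (auto simp: v0_def w0_def)
  have [measurable]: "v0 \<in> borel_measurable borel" "w0 \<in> borel_measurable borel"
    using cv cw by (auto intro: borel_measurable_continuous_onI)
  have v0v: "v0 x = v x" and w0w: "w0 x = w x" if "0 \<le> x" for x
    using that by (auto simp: v0_def w0_def)
  have "v \<in> borel_measurable HL \<longleftrightarrow> v0 \<in> borel_measurable HL"
    and "w \<in> borel_measurable HL \<longleftrightarrow> w0 \<in> borel_measurable HL"
    by (rule measurable_cong; simp add: space_HL v0v w0w)+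
  then have [measurable]: "v \<in> borel_measurable HL" "w \<in> borel_measurable HL"
    by (simp_all add: measurable_HL)
  have [measurable]: "\<psi> \<in> borel_measurable HL" by (rule measurable_HL; measurable)
  have idm: "(\<lambda>x. x) \<in> borel_measurable HL" by (rule measurable_HL; measurable)
  have dom: "integrable HL u" "integrable HL (\<lambda>x. x * u x)" "0 < (\<integral>x. u x \<partial>HL)"
    if u: "\<And>x. 0 \<le> x \<Longrightarrow> 0 < u x" "\<And>x. 0 \<le> x \<Longrightarrow> u x \<le> K * exp (- (\<delta> * x))"
    and [measurable]: "u \<in> borel_measurable HL" for u
  proof -
    have K: "0 < K" using u[of 0] by simp
    show 1: "integrable HL u"
      by (rule Bochner_Integration.integrable_bound[OF integrable_mult_right[OF integrable_exp_HL[OF \<delta>], of K]])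
         (use u less_imp_le[OF u(1)] K in \<open>auto simp: space_HL intro!: AE_HL\<close>)
    note idm[measurable]
    show "integrable HL (\<lambda>x. x * u x)"
    proof (rule Bochner_Integration.integrable_bound[OF integrable_mult_right[OF integrable_ident_exp_HL[OF \<delta>], of K]])
      show "AE x in HL. norm (x * u x) \<le> norm (K * (x * exp (- (\<delta> * x))))"
      proof (rule AE_I2)
        fix x assume "x \<in> space HL"
        then have x: "0 \<le> x" by (simp add: space_HL)
        have "x * u x \<le> x * (K * exp (- (\<delta> * x)))" using x u by (intro mult_left_mono) auto
        then show "norm (x * u x) \<le> norm (K * (x * exp (- (\<delta> * x))))"
          using x u(1)[OF x] K by (simp add: mult_ac)
      qed
    qed measurable
    show "0 < (\<integral>x. u x \<partial>HL)"
    proof (rule integral_pos[OF 1])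
      show "emeasure HL (space HL) \<noteq> 0"
        using emeasure_space[of HL "{0..1}"] emeasure_HL_unit by (metis le_zero_eq zero_neq_one)
    qed (use u in \<open>auto simp: space_HL\<close>)
  qed
  define Zv Zw where "Zv = (\<integral>x. v x \<partial>HL)" and "Zw = (\<integral>x. w x \<partial>HL)"
  have iv: "integrable HL v" "integrable HL (\<lambda>x. x * v x)" "0 < Zv"
    unfolding Zv_def by (rule dom[of v]; use v in simp)+
  have iw: "integrable HL w" "integrable HL (\<lambda>x. x * w x)" "0 < Zw"
    unfolding Zw_def by (rule dom[of w]; use w in simp)+
  have nn: "(\<integral>\<^sup>+x. ennreal (u0 x) \<partial>HL) = ennreal (\<integral>x. u x \<partial>HL)"
    if "integrable HL u" "\<And>x. 0 \<le> x \<Longrightarrow> u0 x = u x" "\<And>x. 0 \<le> x \<Longrightarrow> 0 \<le> u x" for u u0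
  proof -
    have "(\<integral>\<^sup>+x. ennreal (u0 x) \<partial>HL) = (\<integral>\<^sup>+x. ennreal (u x) \<partial>HL)"
      using that(2) by (intro nn_integral_cong) (simp add: space_HL)
    also have "\<dots> = ennreal (\<integral>x. u x \<partial>HL)"
      using that(1) by (rule nn_integral_eq_integral) (rule AE_HL, rule that(3))
    finally show ?thesis .
  qed
  obtain T where T: "T 0 = 0" "mono T" "\<And>x. 0 \<le> x \<Longrightarrow> 0 \<le> T x"
    and derT: "\<And>x. (T has_real_derivative (Zw / Zv * v0 x / w0 (T x))) (at x)"
  proof (rule monotone_transport[of v0 w0 Zv Zw])
    show "(\<integral>\<^sup>+ x. ennreal (v0 x) \<partial>HL) = ennreal Zv" "(\<integral>\<^sup>+ x. ennreal (w0 x) \<partial>HL) = ennreal Zw"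
      unfolding Zv_def Zw_def using iv iw v w by (auto intro!: nn v0v w0w less_imp_le)
  qed (use cv cw v0pos w0pos iv iw in \<open>auto simp: v0_def w0_def\<close>)
  define T' where "T' = (\<lambda>x. Zw / Zv * v0 x / w0 (T x))"
  have der: "(T has_real_derivative T' x) (at x)" for x
    using derT by (simp add: T'_def)
  have contT: "continuous_on UNIV T"
    using der DERIV_isCont continuous_at_imp_continuous_on by blast
  have contT': "continuous_on UNIV T'"
    unfolding T'_def using w0pos by (intro continuous_intros cv continuous_on_compose2[OF cw contT]) (auto simp: less_le)
  have T'pos: "0 < T' x" for x
    using v0pos[of x] w0pos[of "T x"] iv(3) iw(3) by (simp add: T'_def)
  have [measurable]: "T \<in> borel_measurable borel" "T' \<in> borel_measurable borel"
    using contT contT' by (auto intro: borel_measurable_continuous_onI)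

  \<comment> \<open>Integrability of \<open>T * v\<close> by change of variables: on the half-line
    the derivative of \<open>P (T x)\<close> is a multiple of \<open>T x * v x\<close>, and
    \<open>P\<close> is bounded by the first moment of \<open>w\<close>. Since \<open>r\<close> is
    at most \<open>B * v\<close>, this also makes \<open>r * T\<close> integrable.\<close>
  obtain P where P: "P 0 = 0" "\<And>x. (P has_real_derivative \<bar>x\<bar> * w0 x) (at x)" "\<And>x. P x \<le> (\<integral>x. x * w x \<partial>HL)"
  proof (rule antiderivative_at_top[of "\<lambda>x. \<bar>x\<bar> * w0 x" "\<integral>x. x * w x \<partial>HL"])
    show "(\<integral>\<^sup>+ x\<in>{0..}. ennreal (\<bar>x\<bar> * w0 x) \<partial>lborel) = ennreal (\<integral>x. x * w x \<partial>HL)"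
      unfolding nn_integral_HL[symmetric] using w(1) by (intro nn iw) (auto simp: w0w less_imp_le)
    show "0 \<le> (\<integral>x. x * w x \<partial>HL)"
      using w(1) by (intro integral_nonneg_AE AE_HL) (auto simp: space_HL less_imp_le)
    show "continuous_on UNIV (\<lambda>x. \<bar>x\<bar> * w0 x)" by (intro continuous_intros cw)
    show "0 \<le> \<bar>x\<bar> * w0 x" for x using w0pos[of x] by simp
  qed auto
  have derPT: "((\<lambda>x. P (T x)) has_real_derivative (Zw / Zv * (\<bar>T x\<bar> * v0 x))) (at x)" for x
    using DERIV_chain2[OF P(2) der, of x] w0pos[of "T x"] by (simp add: T'_def field_simps)
  have "(\<integral>\<^sup>+x. ennreal (Zw / Zv * (\<bar>T x\<bar> * v0 x)) \<partial>HL) \<le> ennreal (\<integral>x. x * w x \<partial>HL)"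
  proof -
    let ?g = "\<lambda>x. Zw / Zv * (\<bar>T x\<bar> * v0 x)"
    have g0: "0 \<le> ?g x" for x using v0pos[of x] iv(3) iw(3) by (auto intro!: mult_nonneg_nonneg)
    have "(\<integral>\<^sup>+x\<in>{0..real n}. ennreal (?g x) \<partial>lborel) \<le> ennreal (\<integral>x. x * w x \<partial>HL)" for n
    proof -
      have "(\<integral>\<^sup>+x\<in>{0..real n}. ennreal (?g x) \<partial>lborel) = ennreal (P (T (real n)) - P (T 0))"
        by (rule nn_integral_FTC_Icc) (use derPT g0 in auto)
      then show ?thesis using P T(1) by (simp add: ennreal_leI)
    qed
    moreover have "(\<integral>\<^sup>+x\<in>{0..}. ennreal (?g x) \<partial>lborel) = (SUP n. (\<integral>\<^sup>+x\<in>{0..real n}. ennreal (?g x) \<partial>lborel))"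
    proof (subst nn_integral_monotone_convergence_SUP[symmetric])
      show "incseq (\<lambda>n x. ennreal (?g x) * indicator {0..real n} x)"
        by (auto simp: incseq_def le_fun_def split: split_indicator)
      show "(\<integral>\<^sup>+x\<in>{0..}. ennreal (?g x) \<partial>lborel) = (\<integral>\<^sup>+x. (SUP n. ennreal (?g x) * indicator {0..real n} x) \<partial>lborel)"
      proof (rule nn_integral_cong)
        fix x :: real
        have "ennreal (?g x) * indicator {0..} x \<le> (SUP n. ennreal (?g x) * indicator {0..real n} x)"
        proof -
          obtain n where "x \<le> real n" using real_arch_simple by blast
          then show ?thesis by (intro SUP_upper2[of n]) (auto split: split_indicator)
        qed
        moreover have "(SUP n. ennreal (?g x) * indicator {0..real n} x) \<le> ennreal (?g x) * indicator {0..} x"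
          by (rule SUP_least) (auto split: split_indicator)
        ultimately show "ennreal (?g x) * indicator {0..} x = (SUP n. ennreal (?g x) * indicator {0..real n} x)"
          by (rule antisym)
      qed
    qed measurable
    ultimately show ?thesis unfolding nn_integral_HL by (simp add: SUP_le_iff)
  qed
  then have "integrable HL (\<lambda>x. Zw / Zv * (\<bar>T x\<bar> * v0 x))"
    using v0pos iv(3) iw(3)
    by (intro integrableI_bounded) (auto intro: measurable_HL simp: abs_mult less_imp_le intro: le_less_trans)
  then have "integrable HL (\<lambda>x. Zv / Zw * (Zw / Zv * (\<bar>T x\<bar> * v0 x)))"
    by (rule integrable_mult_right)
  then have "integrable HL (\<lambda>x. \<bar>T x\<bar> * v0 x)" using iv(3) iw(3) by (simp add: field_simps)
  then have iTv: "integrable HL (\<lambda>x. T x * v x)"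
    by (rule Bochner_Integration.integrable_cong[THEN iffD1, rotated -1]) (auto simp: space_HL T(3) v0v)
  have [measurable]: "T \<in> borel_measurable HL" "T' \<in> borel_measurable HL"
    "(\<lambda>x. \<psi> (T x)) \<in> borel_measurable HL"
    by (rule measurable_HL; measurable)+
  have irT: "integrable HL (\<lambda>x. r x * T x)"
  proof (rule Bochner_Integration.integrable_bound[OF integrable_mult_right[OF iTv, of B]])
    show "AE x in HL. norm (r x * T x) \<le> norm (B * (T x * v x))"
    proof (rule AE_I2)
      fix x assume "x \<in> space HL"
      then have x: "0 \<le> x" by (simp add: space_HL)
      have "r x * T x \<le> B * v x * T x" using rB[OF x] T(3)[OF x] by (rule mult_right_mono)
      moreover have "0 \<le> r x * T x" using r0[OF x] T(3)[OF x] by simp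
      ultimately show "norm (r x * T x) \<le> norm (B * (T x * v x))" by (simp add: mult_ac)
    qed
  qed measurable
  have irx: "integrable HL (\<lambda>x. r x * x)"
  proof (rule Bochner_Integration.integrable_bound[OF integrable_mult_right[OF iv(2), of B]])
    show "AE x in HL. norm (r x * x) \<le> norm (B * (x * v x))"
    proof (rule AE_I2)
      fix x assume "x \<in> space HL"
      then have x: "0 \<le> x" by (simp add: space_HL)
      have "r x * x \<le> B * v x * x" using rB[OF x] x by (rule mult_right_mono)
      moreover have "0 \<le> r x * x" using r0[OF x] x by simp
      ultimately show "norm (r x * x) \<le> norm (B * (x * v x))" by (simp add: mult_ac)
    qed
  qed (use idm in \<open>intro borel_measurable_times r\<close>)
  have parts: "integrable HL (\<lambda>x. v x * U' x) \<and> (\<integral>x. v x * U' x \<partial>HL) = (\<integral>x. r x * U x \<partial>HL)"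
    if U: "\<And>x. (U has_real_derivative U' x) (at x)" "\<And>x. 0 \<le> U' x" "U 0 = 0" "U' \<in> borel_measurable borel"
     "integrable HL (\<lambda>x. r x * U x)" "\<And>x. 0 \<le> x \<Longrightarrow> 0 \<le> U x" for U U' :: "real \<Rightarrow> real"
  proof -
    have [measurable]: "U' \<in> borel_measurable HL" using U(4) by (rule measurable_HL)
    have "(\<integral>\<^sup>+x. ennreal (v x * U' x) \<partial>HL) = (\<integral>\<^sup>+x. ennreal (r x * U x) \<partial>HL)"
      by (rule nn_integral_by_parts_HL[symmetric]) (use r0 rv U in auto)
    also have "\<dots> = ennreal (\<integral>x. r x * U x \<partial>HL)"
      using U(5) by (rule nn_integral_eq_integral) (auto simp: space_HL r0 U(6) intro!: AE_HL)
    finally have 1: "(\<integral>\<^sup>+x. ennreal (v x * U' x) \<partial>HL) = ennreal (\<integral>x. r x * U x \<partial>HL)" .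
    have 2: "0 \<le> (\<integral>x. r x * U x \<partial>HL)"
      by (intro integral_nonneg_AE AE_HL) (auto simp: space_HL r0 U(6))
    show ?thesis
      using 1 2 by (subst (asm) nn_integral_eq_integrable) (auto simp: space_HL v(1) U(2) less_imp_le intro!: AE_HL)
  qed
  have ivT': "integrable HL (\<lambda>x. v x * T' x)" and eT: "(\<integral>x. v x * T' x \<partial>HL) = (\<integral>x. r x * T x \<partial>HL)"
    using parts[OF der less_imp_le[OF T'pos] T(1) _ irT T(3)] by auto
  have eI: "(\<integral>x. v x \<partial>HL) = (\<integral>x. r x * x \<partial>HL)"
    using parts[of "\<lambda>x. x" "\<lambda>x. 1"] irx by (auto intro!: derivative_eq_intros)
  have bdd: "integrable HL (\<lambda>x. f x * v x)"
    if "f \<in> borel_measurable HL" "\<And>x. 0 \<le> x \<Longrightarrow> \<bar>f x\<bar> \<le> b" for f b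
  proof (rule Bochner_Integration.integrable_bound[OF integrable_mult_right[OF iv(1), of b]])
    show "AE x in HL. norm (f x * v x) \<le> norm (b * v x)"
    proof (rule AE_HL)
      fix x :: real assume x: "0 \<le> x"
      have "\<bar>f x\<bar> * v x \<le> b * v x" using that(2)[OF x] v(1)[OF x] by (intro mult_right_mono) auto
      then show "norm (f x * v x) \<le> norm (b * v x)"
        using v(1)[OF x] by (simp add: abs_mult)
    qed
  qed (use that(1) in measurable)
  have ikv: "integrable HL (\<lambda>x. k x * v x)"
    using k kD by (rule bdd)
  \<comment> \<open>Values of \<psi> in the unit interval give \<open>c\<close> at most 1. Thus the
    integral of \<open>c * v\<close> is finite and can be subtracted at the end.\<close>
  define c where "c = (\<lambda>x. (\<psi> (T x) - \<psi> x)\<^sup>2)"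
  have [measurable]: "c \<in> borel_measurable HL" unfolding c_def by measurable
  have c01: "0 \<le> c x" "c x \<le> 1" if "0 \<le> x" for x
    using \<psi>01[OF that] \<psi>01[OF T(3)[OF that]] by (auto simp: c_def abs_square_le_1)
  have icv: "integrable HL (\<lambda>x. c x * v x)"
    by (rule bdd[of c 1]) (use c01 in auto)
  \<comment> \<open>\<kappa> is the quantity to be bounded. \<open>G\<close> is the density of the
    transport cost before division by \<open>Zv\<close>, and \<open>R\<close> is the pointwise
    majorant that \<open>main\<close> at (x, T x) provides.\<close>
  define \<kappa> where "\<kappa> = ln Zw - ln Zv"
  define G where "G = (\<lambda>x. v x * (T' x - 1 - ln (T' x)))"
  define R where "R = (\<lambda>x. v x * T' x - v x + k x * v x - \<kappa> * v x - (r x * T x - r x * x) + c x * v x / C)"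
  have G0: "0 \<le> G x" if "0 \<le> x" for x
    using v(1)[OF that] ln_le_minus_one[OF T'pos, of x] by (simp add: G_def)
  have GR: "G x \<le> R x" if x: "0 \<le> x" for x
  proof -
    have lnT': "ln (T' x) = \<kappa> + ln (v x) - ln (w (T x))"
      unfolding T'_def \<kappa>_def v0v[OF x] w0w[OF T(3)[OF x]]
      using iv(3) iw(3) v(1)[OF x] w(1)[OF T(3)[OF x]] by (simp add: ln_mult ln_div)
    have "- ln (T' x) \<le> k x - \<kappa> - r x / v x * (T x - x) + c x / C"
      using main[OF x T(3)[OF x]] unfolding lnT' c_def by linarith
    then have "v x * (T' x - 1 + - ln (T' x)) \<le> v x * (T' x - 1 + (k x - \<kappa> - r x / v x * (T x - x) + c x / C))"
      using v(1)[OF x] by (intro mult_left_mono add_left_mono) auto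
    also have "\<dots> = R x" using v(1)[OF x] C by (simp add: R_def field_simps)
    finally show ?thesis by (simp add: G_def)
  qed
  have iR: "integrable HL R" unfolding R_def
    by (intro Bochner_Integration.integrable_add Bochner_Integration.integrable_diff integrable_divide_zero
        integrable_mult_right ivT' iv ikv irT irx icv)
  have "(\<integral>x. R x \<partial>HL) = (\<integral>x. v x * T' x \<partial>HL) - Zv + (\<integral>x. k x * v x \<partial>HL) - \<kappa> * Zv
     - ((\<integral>x. r x * T x \<partial>HL) - (\<integral>x. r x * x \<partial>HL)) + (\<integral>x. c x * v x \<partial>HL) / C"
    unfolding R_def Zv_def using ivT' iv ikv irT irx icv by simp
  then have eR: "(\<integral>x. R x \<partial>HL) = (\<integral>x. k x * v x \<partial>HL) - \<kappa> * Zv + (\<integral>x. c x * v x \<partial>HL) / C"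
    unfolding eT eI[symmetric] Zv_def by simp
  \<comment> \<open>The cost is finite because \<open>G\<close> lies between 0 and the integrable
    \<open>R\<close>; nothing is known beforehand about the size of \<open>T'\<close>.\<close>
  have iG: "integrable HL G"
    by (rule Bochner_Integration.integrable_bound[OF iR])
       (use G0 GR in \<open>auto simp: space_HL G_def intro!: AE_HL order_trans[OF _ abs_ge_self]\<close>)
  have "(\<integral>x. G x \<partial>HL) \<le> (\<integral>x. R x \<partial>HL)"
    using iG iR by (rule integral_mono) (simp add: space_HL GR)
  define h where "h = (\<lambda>x. v x / Zv)"
  \<comment> \<open>A tail integral of the nonnegative \<open>r\<close> decreases. This is how
    monotonicity of the density, which the clipping inequality requires, enters.\<close>
  have anti: "antimono_on {0..} v"
  proof (rule monotone_onI)
    fix x y :: real assume "x \<in> {0..}" "y \<in> {0..}" "x \<le> y"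
    then have "ennreal (v y) \<le> ennreal (v x)"
      by (auto simp: rv intro!: nn_integral_mono split: split_indicator)
    then show "v y \<le> v x" using v(1)[of x] \<open>x \<in> {0..}\<close> by (simp add: ennreal_le_iff)
  qed
  have hdens: "nonincreasing_density h"
    unfolding nonincreasing_density_def nn_integral_HL[symmetric]
  proof (intro conjI allI impI)
    show "0 \<le> h x" if "0 \<le> x" for x using v(1)[OF that] iv(3) by (simp add: h_def)
    show "antimono_on {0..} h"
      using anti iv(3) by (auto simp: h_def monotone_on_def divide_right_mono)
    have "(\<integral>\<^sup>+x. ennreal (h x) \<partial>HL) = ennreal (\<integral>x. v x / Zv \<partial>HL)"
      by (rule nn) (use iv v(1) in \<open>auto simp: h_def less_imp_le\<close>)
    then show "(\<integral>\<^sup>+x. ennreal (h x) \<partial>HL) = 1" using iv(3) by (simp add: Zv_def)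
  qed
  have ac: "abs_continuous_on_interval 0 b T" if "0 \<le> b" for b
  proof -
    have "\<exists>m. \<forall>x\<in>{0..b}. T' x \<le> T' m"
      using continuous_attains_sup[of "{0..b}" T'] continuous_on_subset[OF contT'] that by auto
    then obtain m where m: "\<And>x. x \<in> {0..b} \<Longrightarrow> T' x \<le> T' m" by blast
    show ?thesis
    proof (rule abs_continuous_on_interval_lipschitz)
      fix x y assume xy: "x \<in> {0..b}" "y \<in> {0..b}" "x \<le> y"
      have "\<bar>T y - T x\<bar> = T y - T x" using monoD[OF T(2) xy(3)] by simp
      also have "\<dots> \<le> T' m * (y - x)"
      proof (cases "x = y")
        case False
        then obtain z where z: "x < z" "z < y" "T y - T x = (y - x) * T' z"
          using MVT2[of x y T T'] der xy(3) by auto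
        then show ?thesis using m[of z] xy by (simp add: mult.commute mult_right_mono)
      qed simp
      finally show "\<bar>T y - T x\<bar> \<le> T' m * (y - x)" .
    qed
  qed
  have "(\<integral>\<^sup>+x. ennreal ((\<psi> (T x) - \<psi> x)\<^sup>2 * h x) \<partial>HL)
      \<le> ennreal C * (\<integral>\<^sup>+x. clip_Delta (deriv T x) * ennreal (h x) \<partial>HL)"
    using tc hdens T ac unfolding transport_cost_def by (auto simp: monotone_on_def monotone_def)
  also have "(\<integral>\<^sup>+x. ennreal ((\<psi> (T x) - \<psi> x)\<^sup>2 * h x) \<partial>HL) = ennreal (\<integral>x. c x * v x / Zv \<partial>HL)"
    by (rule nn) (use icv iv(3) v(1) c01 in \<open>auto simp: c_def h_def less_imp_le\<close>)
  also have "(\<integral>\<^sup>+x. clip_Delta (deriv T x) * ennreal (h x) \<partial>HL) = (\<integral>\<^sup>+x. ennreal (G x / Zv) \<partial>HL)"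
  proof (rule nn_integral_cong)
    fix x assume "x \<in> space HL"
    then have x: "0 \<le> x" by (simp add: space_HL)
    have "deriv T x = T' x" using der by (rule DERIV_imp_deriv)
    then show "clip_Delta (deriv T x) * ennreal (h x) = ennreal (G x / Zv)"
      using T'pos[of x] v(1)[OF x] iv(3) ln_le_minus_one[OF T'pos, of x]
      by (simp add: clip_Delta_def G_def h_def ennreal_mult[symmetric] mult_ac)
  qed
  also have "\<dots> = ennreal (\<integral>x. G x / Zv \<partial>HL)"
    by (rule nn) (use iG iv(3) G0 in auto)
  finally have "ennreal (\<integral>x. c x * v x / Zv \<partial>HL) \<le> ennreal C * ennreal (\<integral>x. G x / Zv \<partial>HL)" .
  then have "(\<integral>x. c x * v x \<partial>HL) / Zv \<le> C * ((\<integral>x. G x \<partial>HL) / Zv)"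
  proof -
    have "0 \<le> (\<integral>x. G x \<partial>HL)" by (intro integral_nonneg_AE AE_HL G0)
    then have "0 \<le> C * ((\<integral>x. G x \<partial>HL) / Zv)" using C iv(3) by simp
    then show ?thesis using C \<open>ennreal _ \<le> ennreal C * ennreal _\<close> by (simp add: ennreal_mult'[symmetric] ennreal_le_iff)
  qed
  then have "(\<integral>x. c x * v x \<partial>HL) \<le> C * (\<integral>x. G x \<partial>HL)"
    using iv(3) by (simp add: field_simps)
  also have "\<dots> \<le> C * (\<integral>x. R x \<partial>HL)" using \<open>(\<integral>x. G x \<partial>HL) \<le> (\<integral>x. R x \<partial>HL)\<close> C by simp
  \<comment> \<open>The integral of \<open>c * v\<close> comes back with factor exactly 1 and
    cancels against the left-hand side.\<close>
  also have "\<dots> = C * ((\<integral>x. k x * v x \<partial>HL) - \<kappa> * Zv) + (\<integral>x. c x * v x \<partial>HL)"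
    unfolding eR using C by (simp add: algebra_simps)
  finally have "\<kappa> * Zv \<le> (\<integral>x. k x * v x \<partial>HL)" using C by (simp add: zero_le_mult_iff)
  then have "\<kappa> \<le> (\<integral>x. k x * v x \<partial>HL) / Zv" using iv(3) by (simp add: field_simps)
  then show ?thesis unfolding \<kappa>_def Zv_def Zw_def by simp
qed

section \<open>Transport inequality on the orthant\<close>

interpretation HL: product_sigma_finite "\<lambda>_::'i. HL"
  by (simp add: product_sigma_finite_def sigma_finite_HL)

abbreviation PiHL :: "'i set \<Rightarrow> ('i \<Rightarrow> real) measure" where
  "PiHL I \<equiv> Pi\<^sub>M I (\<lambda>_. HL)"

lemma space_PiHL: "space (PiHL I) = (\<Pi>\<^sub>E i\<in>I. {0..})"
  by (simp add: space_PiM space_HL)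

lemma fun_upd_in_PiHL:
  "x \<in> space (PiHL I) \<Longrightarrow> 0 \<le> s \<Longrightarrow> x(j := s) \<in> space (PiHL (insert j I))"
  by (auto simp: space_PiHL PiE_iff extensional_def)

lemma measurable_upd_HL:
  "0 \<le> s \<Longrightarrow> (\<lambda>x. x(j := s)) \<in> measurable (PiHL I) (PiHL (insert j I))"
  by (rule measurable_fun_upd[where J=I]) (auto simp: space_HL)

lemma measurable_upd_pair_HL:
  "(\<lambda>p. (snd p)(j := fst p)) \<in> measurable (HL \<Otimes>\<^sub>M PiHL I) (PiHL (insert j I))"
  by (rule measurable_fun_upd[where J=I]) auto

lemma measurable_component_HL:
  "i \<in> I \<Longrightarrow> (\<lambda>x. x i) \<in> borel_measurable (PiHL I)"
  using measurable_compose[OF measurable_component_singleton[of i I "\<lambda>_. HL"] measurable_HL[of "\<lambda>x. x" borel]]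
  by simp

lemma PiHL_nonzero:
  assumes "finite I" shows "emeasure (PiHL I) (space (PiHL I)) \<noteq> 0"
proof -
  have *: "{0..1} \<in> sets HL" unfolding sets_HL by (auto simp: sets_restrict_space)
  have "emeasure (PiHL I) (\<Pi>\<^sub>E i\<in>I. {0..1}) = 1"
    using assms by (subst HL.emeasure_PiM) (auto simp: emeasure_HL_unit *)
  then show ?thesis
    using emeasure_space[of "PiHL I" "\<Pi>\<^sub>E i\<in>I. {0..1}"] by (metis le_zero_eq zero_neq_one)
qed

section \<open>Exponentially decaying densities on the orthant and their marginals\<close>

lemma nn_integral_exp_PiHL:
  assumes "finite I" "0 < \<delta>"
  shows "(\<integral>\<^sup>+x. ennreal (exp (- (\<delta> * (\<Sum>i\<in>I. x i)))) \<partial>PiHL I) = ennreal ((1 / \<delta>) ^ card I)"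
proof -
  have "ennreal (exp (- (\<delta> * (\<Sum>i\<in>I. x i)))) = (\<Prod>i\<in>I. ennreal (exp (- (\<delta> * x i))))" for x
    using assms(1) by (simp add: prod_ennreal exp_sum[symmetric] sum_distrib_left sum_negf)
  then have "(\<integral>\<^sup>+x. ennreal (exp (- (\<delta> * (\<Sum>i\<in>I. x i)))) \<partial>PiHL I)
      = (\<Prod>i\<in>I. (\<integral>\<^sup>+x. ennreal (exp (- (\<delta> * x))) \<partial>HL))"
    using HL.product_nn_integral_prod[OF assms(1), of "\<lambda>_ x. ennreal (exp (- (\<delta> * x)))"]
    by (simp add: measurable_HL)
  then show ?thesis using assms by (simp add: nn_integral_exp_HL ennreal_power)
qed

text \<open>A class adapted to peeling off coordinates: sections keep \<open>B\<close> and \<delta>,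
  and the one-dimensional marginals obey the same two bounds. The decay yields integrability and
  finite first moments. Moves of a single coordinate suffice for the Lipschitz bound, since Fubini's
  theorem isolates one coordinate at a time.\<close>

definition admissible :: "'i set \<Rightarrow> real \<Rightarrow> real \<Rightarrow> real \<Rightarrow> (('i \<Rightarrow> real) \<Rightarrow> real) \<Rightarrow> bool" where
  "admissible I B K \<delta> v \<longleftrightarrow> v \<in> borel_measurable (PiHL I) \<and>
     (\<forall>x\<in>space (PiHL I). 0 < v x \<and> v x \<le> K * exp (- (\<delta> * (\<Sum>i\<in>I. x i)))) \<and>
     (\<forall>x\<in>space (PiHL I). \<forall>j\<in>I. \<forall>s\<ge>0. v x \<le> exp (B * \<bar>x j - s\<bar>) * v (x(j := s)))"

lemma admissibleD:
  assumes "admissible I B K \<delta> v"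
  shows "v \<in> borel_measurable (PiHL I)"
    "x \<in> space (PiHL I) \<Longrightarrow> 0 < v x"
    "x \<in> space (PiHL I) \<Longrightarrow> v x \<le> K * exp (- (\<delta> * (\<Sum>i\<in>I. x i)))"
    "x \<in> space (PiHL I) \<Longrightarrow> j \<in> I \<Longrightarrow> 0 \<le> s \<Longrightarrow> v x \<le> exp (B * \<bar>x j - s\<bar>) * v (x(j := s))"
  using assms unfolding admissible_def by auto

lemma admissible_pos:
  assumes v: "admissible I B K \<delta> v" shows "0 < K"
proof -
  let ?x = "\<lambda>i. if i \<in> I then 0 else undefined :: real"
  have "?x \<in> space (PiHL I)" by (auto simp: space_PiHL)
  then show ?thesis using admissibleD(2,3)[OF v, of ?x] by simp
qed

lemma admissible_integral:
  assumes I: "finite I" and \<delta>: "0 < \<delta>" and v: "admissible I B K \<delta> v"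
  shows "integrable (PiHL I) v" "0 < (\<integral>x. v x \<partial>PiHL I)" "(\<integral>x. v x \<partial>PiHL I) \<le> K * (1 / \<delta>) ^ card I"
proof -
  note [measurable] = admissibleD(1)[OF v]
  have K: "0 < K" using v by (rule admissible_pos)
  have le: "(\<integral>\<^sup>+x. ennreal (v x) \<partial>PiHL I) \<le> ennreal (K * (1 / \<delta>) ^ card I)"
  proof -
    have "(\<integral>\<^sup>+x. ennreal (v x) \<partial>PiHL I) \<le> (\<integral>\<^sup>+x. ennreal K * ennreal (exp (- (\<delta> * (\<Sum>i\<in>I. x i)))) \<partial>PiHL I)"
      using admissibleD(3)[OF v] K by (intro nn_integral_mono) (simp add: ennreal_mult[symmetric] ennreal_leI)
    also have "\<dots> = ennreal K * ennreal ((1 / \<delta>) ^ card I)"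
    proof (subst nn_integral_cmult)
      have [measurable]: "(\<lambda>x. \<Sum>i\<in>I. x i) \<in> borel_measurable (PiHL I)"
        by (intro borel_measurable_sum measurable_component_HL)
      show "(\<lambda>x. ennreal (exp (- (\<delta> * (\<Sum>i\<in>I. x i))))) \<in> borel_measurable (PiHL I)" by measurable
    qed (simp add: nn_integral_exp_PiHL[OF I \<delta>])
    finally show ?thesis using K \<delta> by (simp add: ennreal_mult)
  qed
  have nn: "AE x in PiHL I. 0 \<le> v x" using admissibleD(2)[OF v] by (intro AE_I2 less_imp_le) auto
  show i: "integrable (PiHL I) v"
    using le nn by (intro integrableI_nonneg) (auto intro: le_less_trans)
  show "0 < (\<integral>x. v x \<partial>PiHL I)"
    by (rule integral_pos[OF i admissibleD(2)[OF v] PiHL_nonzero[OF I]])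
  show "(\<integral>x. v x \<partial>PiHL I) \<le> K * (1 / \<delta>) ^ card I"
    using le K \<delta> by (simp add: nn_integral_eq_integral[OF i nn] ennreal_le_iff)
qed

lemma admissible_integrable_mult:
  assumes "finite I" "0 < \<delta>" and v: "admissible I B K \<delta> v"
    and f[measurable]: "f \<in> borel_measurable (PiHL I)" and b: "\<And>x. x \<in> space (PiHL I) \<Longrightarrow> \<bar>f x\<bar> \<le> b"
  shows "integrable (PiHL I) (\<lambda>x. f x * v x)"
proof (rule Bochner_Integration.integrable_bound[OF integrable_mult_right[OF admissible_integral(1)[OF assms(1-3)], of b]])
  note [measurable] = admissibleD(1)[OF v]
  show "(\<lambda>x. f x * v x) \<in> borel_measurable (PiHL I)" by measurable
  show "AE x in PiHL I. norm (f x * v x) \<le> norm (b * v x)"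
  proof (rule AE_I2)
    fix x assume x: "x \<in> space (PiHL I)"
    have "\<bar>f x\<bar> * v x \<le> b * v x"
      using b[OF x] admissibleD(2)[OF v x] by (intro mult_right_mono) auto
    then show "norm (f x * v x) \<le> norm (b * v x)"
      using admissibleD(2)[OF v x] by (simp add: abs_mult)
  qed
qed

lemma admissible_section:
  assumes I: "finite I" "j \<notin> I" and \<delta>: "0 < \<delta>" and v: "admissible (insert j I) B K \<delta> v" and s: "0 \<le> s"
  shows "admissible I B (K * exp (- (\<delta> * s))) \<delta> (\<lambda>x. v (x(j := s)))"
  unfolding admissible_def
proof (intro conjI ballI allI impI)
  show "(\<lambda>x. v (x(j := s))) \<in> borel_measurable (PiHL I)"
    using measurable_compose[OF measurable_upd_HL[OF s] admissibleD(1)[OF v]] .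
next
  fix x assume x: "x \<in> space (PiHL I)"
  note xs = fun_upd_in_PiHL[OF x s, of j]
  show "0 < v (x(j := s))" by (rule admissibleD(2)[OF v xs])
  have e: "(\<Sum>i\<in>insert j I. (x(j := s)) i) = s + (\<Sum>i\<in>I. x i)"
    using I by (auto intro!: sum.cong arg_cong2[of _ _ _ _ "(+)"])
  show "v (x(j := s)) \<le> K * exp (- (\<delta> * s)) * exp (- (\<delta> * (\<Sum>i\<in>I. x i)))"
    using admissibleD(3)[OF v xs] unfolding e by (simp add: distrib_left exp_add mult.assoc flip: exp_diff exp_add)
  fix i and u :: real assume i: "i \<in> I" and u: "0 \<le> u"
  have "i \<noteq> j" using i I by auto
  then show "v (x(j := s)) \<le> exp (B * \<bar>x i - u\<bar>) * v ((x(i := u))(j := s))"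
    using admissibleD(4)[OF v xs, of i u] i u by (simp add: fun_upd_twist)
qed

lemma borel_measurable_marginal:
  fixes f :: "('i \<Rightarrow> real) \<Rightarrow> real"
  assumes I: "finite I" and f: "f \<in> borel_measurable (PiHL (insert j I))"
  shows "(\<lambda>s. \<integral>x. f (x(j := s)) \<partial>PiHL I) \<in> borel_measurable HL"
proof -
  interpret P: sigma_finite_measure "PiHL I" using HL.sigma_finite[OF I] .
  show ?thesis
    using measurable_compose[OF measurable_upd_pair_HL f]
    by (intro P.borel_measurable_lebesgue_integral) (simp add: case_prod_beta' )
qed

lemma nn_integral_insert_marginal:
  fixes f :: "('i \<Rightarrow> real) \<Rightarrow> real"
  assumes I: "finite I" "j \<notin> I" and f: "f \<in> borel_measurable (PiHL (insert j I))"
    and nn: "\<And>x. x \<in> space (PiHL (insert j I)) \<Longrightarrow> 0 \<le> f x"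
    and int: "\<And>s. 0 \<le> s \<Longrightarrow> integrable (PiHL I) (\<lambda>x. f (x(j := s)))"
  shows "(\<integral>\<^sup>+x. ennreal (f x) \<partial>PiHL (insert j I)) = (\<integral>\<^sup>+s. ennreal (\<integral>x. f (x(j := s)) \<partial>PiHL I) \<partial>HL)"
proof -
  have "(\<integral>\<^sup>+x. ennreal (f x) \<partial>PiHL (insert j I)) = (\<integral>\<^sup>+s. (\<integral>\<^sup>+x. ennreal (f (x(j := s))) \<partial>PiHL I) \<partial>HL)"
    using f by (intro HL.product_nn_integral_insert_rev I) measurable
  also have "\<dots> = (\<integral>\<^sup>+s. ennreal (\<integral>x. f (x(j := s)) \<partial>PiHL I) \<partial>HL)"
    by (intro nn_integral_cong nn_integral_eq_integral int AE_I2 nn fun_upd_in_PiHL) (auto simp: space_HL)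
  finally show ?thesis .
qed

text \<open>Nonnegativity lets the proof go through \<open>nn_integral\<close>, so joint
  integrability is not a hypothesis. A bounded factor of either sign is first shifted by a
  constant.\<close>

lemma integral_insert_marginal:
  fixes f :: "('i \<Rightarrow> real) \<Rightarrow> real"
  assumes I: "finite I" "j \<notin> I" and f: "f \<in> borel_measurable (PiHL (insert j I))"
    and nn: "\<And>x. x \<in> space (PiHL (insert j I)) \<Longrightarrow> 0 \<le> f x"
    and int: "\<And>s. 0 \<le> s \<Longrightarrow> integrable (PiHL I) (\<lambda>x. f (x(j := s)))"
  shows "(\<integral>x. f x \<partial>PiHL (insert j I)) = (\<integral>s. (\<integral>x. f (x(j := s)) \<partial>PiHL I) \<partial>HL)"
proof -
  have "(\<integral>x. f x \<partial>PiHL (insert j I)) = enn2real (\<integral>\<^sup>+x. ennreal (f x) \<partial>PiHL (insert j I))"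
    by (rule integral_eq_nn_integral[OF f]) (use nn in auto)
  also have "\<dots> = enn2real (\<integral>\<^sup>+s. ennreal (\<integral>x. f (x(j := s)) \<partial>PiHL I) \<partial>HL)"
    by (subst nn_integral_insert_marginal[OF assms]) simp_all
  also have "\<dots> = (\<integral>s. (\<integral>x. f (x(j := s)) \<partial>PiHL I) \<partial>HL)"
    by (rule integral_eq_nn_integral[symmetric, OF borel_measurable_marginal[OF I(1) f]])
       (intro AE_HL integral_nonneg_AE AE_I2 nn fun_upd_in_PiHL)
  finally show ?thesis .
qed

lemma admissible_marginal:
  assumes I: "finite I" "j \<notin> I" and \<delta>: "0 < \<delta>" and v: "admissible (insert j I) B K \<delta> v"
  defines "V \<equiv> \<lambda>s. \<integral>x. v (x(j := s)) \<partial>PiHL I"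
  shows "0 \<le> s \<Longrightarrow> 0 < V s" "0 \<le> s \<Longrightarrow> V s \<le> K * (1 / \<delta>) ^ card I * exp (- (\<delta> * s))"
    "0 \<le> s \<Longrightarrow> 0 \<le> t \<Longrightarrow> V s \<le> exp (B * \<bar>s - t\<bar>) * V t"
proof -
  note sec = admissible_section[OF I \<delta> v]
  note int = admissible_integral[OF I(1) \<delta> sec]
  show "0 < V s" if "0 \<le> s" using int(2)[OF that] by (simp add: V_def)
  show "V s \<le> K * (1 / \<delta>) ^ card I * exp (- (\<delta> * s))" if "0 \<le> s"
    using int(3)[OF that] by (simp add: V_def mult_ac)
  show "V s \<le> exp (B * \<bar>s - t\<bar>) * V t" if s: "0 \<le> s" and t: "0 \<le> t"
    unfolding V_def integral_mult_right_zero[symmetric]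
  proof (rule integral_mono)
    show "v (x(j := s)) \<le> exp (B * \<bar>s - t\<bar>) * v (x(j := t))" if "x \<in> space (PiHL I)" for x
      using admissibleD(4)[OF v fun_upd_in_PiHL[OF that s] insertI1 t] by simp
  qed (use int(1)[OF s] int(1)[OF t] in auto)
qed

text \<open>
  Here \<open>r i\<close> stands for \<open>- \<partial>\<^sub>i v\<close>. Prescribing it through its tail integrals, rather than as a derivative,
  makes the hypothesis pass to marginals by Tonelli, without differentiating under the integral.
\<close>

lemma transport_inequality:
  assumes "finite I" and C: "0 < C" and \<delta>: "0 < \<delta>"
    and "\<And>i. i \<in> I \<Longrightarrow> transport_cost C (\<psi> i)" "\<And>i. i \<in> I \<Longrightarrow> \<psi> i \<in> borel_measurable borel"
    and "\<And>i x. i \<in> I \<Longrightarrow> 0 \<le> x \<Longrightarrow> \<psi> i x \<in> {0..1}"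
    and "admissible I B K \<delta> v" "admissible I B K \<delta> w"
    and "k \<in> borel_measurable (PiHL I)" "\<And>x. x \<in> space (PiHL I) \<Longrightarrow> \<bar>k x\<bar> \<le> D"
    and "\<And>i. i \<in> I \<Longrightarrow> r i \<in> borel_measurable (PiHL I)"
    and "\<And>i x. i \<in> I \<Longrightarrow> x \<in> space (PiHL I) \<Longrightarrow> 0 \<le> r i x"
    and "\<And>i x. i \<in> I \<Longrightarrow> x \<in> space (PiHL I) \<Longrightarrow> r i x \<le> B * v x"
    and "\<And>i x. i \<in> I \<Longrightarrow> x \<in> space (PiHL I) \<Longrightarrow>
       ennreal (v x) = (\<integral>\<^sup>+s. ennreal (r i (x(i := s))) * indicator {x i..} s \<partial>HL)"
    and "\<And>x y. x \<in> space (PiHL I) \<Longrightarrow> y \<in> space (PiHL I) \<Longrightarrow>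
       ln (w y) \<le> k x + ln (v x) - (\<Sum>i\<in>I. r i x / v x * (y i - x i)) + (\<Sum>i\<in>I. (\<psi> i (y i) - \<psi> i (x i))\<^sup>2 / C)"
  shows "ln (\<integral>x. w x \<partial>PiHL I) \<le> ln (\<integral>x. v x \<partial>PiHL I) + (\<integral>x. k x * v x \<partial>PiHL I) / (\<integral>x. v x \<partial>PiHL I)"
  using assms(1,4-)
proof (induction I arbitrary: K v w k D r rule: finite_induct)
  case empty
  \<comment> \<open>Over no coordinates the integral is evaluation at the only point of the space,
    and the claim is the hypothesis there with empty sums.\<close>
  let ?u = "\<lambda>_. undefined :: real"
  have "?u \<in> space (PiHL {})" by (simp add: space_PiHL)
  with empty.prems(12)[of ?u ?u] admissibleD(2)[OF empty.prems(4), of ?u]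
  show ?case by (simp add: PiM_empty lebesgue_integral_count_space_finite)
next
  case (insert j I)
  note I = insert.hyps(1,2)
  note v = insert.prems(4) and w = insert.prems(5) and k = insert.prems(6) and kD = insert.prems(7)
    and r = insert.prems(8) and r0 = insert.prems(9) and rB = insert.prems(10) and rv = insert.prems(11)
    and main = insert.prems(12)
  note vsec = admissible_section[OF I \<delta> v] and wsec = admissible_section[OF I \<delta> w]
  define V W R where "V = (\<lambda>s. \<integral>x. v (x(j := s)) \<partial>PiHL I)" and "W = (\<lambda>s. \<integral>x. w (x(j := s)) \<partial>PiHL I)"
    and "R = (\<lambda>s. \<integral>x. r j (x(j := s)) \<partial>PiHL I)"
  \<comment> \<open>The mean of \<open>k\<close> over the fibre at height \<open>s\<close>, weighted
    by the section of \<open>v\<close>: it keeps the bound \<open>D\<close>, and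
    \<open>k1 * V\<close> integrates to the integral of \<open>k * v\<close>.\<close>
  define k1 where "k1 = (\<lambda>s. (\<integral>x. k (x(j := s)) * v (x(j := s)) \<partial>PiHL I) / V s)"
  note meas_sec = measurable_compose[OF measurable_upd_HL]
  note upd = fun_upd_in_PiHL
  have iv: "integrable (PiHL I) (\<lambda>x. v (x(j := s)))" if "0 \<le> s" for s
    using admissible_integral(1)[OF I(1) \<delta> vsec[OF that]] .
  have Vpos: "0 < V s" if "0 \<le> s" for s
    unfolding V_def by (rule admissible_marginal(1)[OF I \<delta> v that])
  have ikv: "integrable (PiHL I) (\<lambda>x. k (x(j := s)) * v (x(j := s)))" if "0 \<le> s" for s
    by (rule admissible_integrable_mult[OF I(1) \<delta> vsec[OF that] meas_sec[OF that k], of D]) (rule kD[OF upd[OF _ that]])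
  have ir: "integrable (PiHL I) (\<lambda>x. r j (x(j := s)))" if s: "0 \<le> s" for s
  proof (rule Bochner_Integration.integrable_bound[OF integrable_mult_right[OF iv[OF s], of B]])
    show "(\<lambda>x. r j (x(j := s))) \<in> borel_measurable (PiHL I)" by (rule meas_sec[OF s r[OF insertI1]])
    show "AE x in PiHL I. norm (r j (x(j := s))) \<le> norm (B * v (x(j := s)))"
    proof (rule AE_I2)
      fix x assume x: "x \<in> space (PiHL I)"
      have "0 \<le> r j (x(j := s))" "r j (x(j := s)) \<le> B * v (x(j := s))"
        by (rule r0[OF insertI1 upd[OF x s]], rule rB[OF insertI1 upd[OF x s]])
      then show "norm (r j (x(j := s))) \<le> norm (B * v (x(j := s)))" by simp
    qed
  qed
  \<comment> \<open>The induction hypothesis is applied to the section of \<open>v\<close> at height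
    \<open>s\<close> and the section of \<open>w\<close> at a different height \<open>t\<close>. The
    terms of coordinate \<open>j\<close>, in which the two heights are fixed, move into the error
    \<open>kk\<close>; averaging \<open>kk\<close> over the fibre produces precisely the
    one-dimensional hypothesis for the marginals \<open>V\<close>, \<open>W\<close>, with slope
    \<open>R / V\<close>.\<close>
  have step: "ln (W t) \<le> k1 s + ln (V s) - R s / V s * (t - s) + (\<psi> j t - \<psi> j s)\<^sup>2 / C"
    if s: "0 \<le> s" and t: "0 \<le> t" for s t
  proof -
    define kk where "kk = (\<lambda>x. k (x(j := s)) - r j (x(j := s)) / v (x(j := s)) * (t - s) + (\<psi> j t - \<psi> j s)\<^sup>2 / C)"
    have [measurable]: "(\<lambda>x. k (x(j := s))) \<in> borel_measurable (PiHL I)" "(\<lambda>x. v (x(j := s))) \<in> borel_measurable (PiHL I)"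
       "(\<lambda>x. r j (x(j := s))) \<in> borel_measurable (PiHL I)"
      by (rule meas_sec[OF s k] meas_sec[OF s admissibleD(1)[OF v]] meas_sec[OF s r[OF insertI1]])+
    have K0: "0 \<le> K" using admissible_pos[OF v] by simp
    \<comment> \<open>The sections at \<open>s\<close> and \<open>t\<close> come with different
      constants \<open>K * exp (- (\<delta> * s))\<close>; both are relaxed to \<open>K\<close>,
      since the induction hypothesis has a single constant for both densities.\<close>
    have weak: "admissible I B K \<delta> (\<lambda>x. u (x(j := s)))" if "admissible (insert j I) B K \<delta> u" "0 \<le> s" for u s
    proof -
      have "K * exp (- (\<delta> * s)) \<le> K * 1" using K0 \<delta> that by (intro mult_left_mono) auto
      then have "K * exp (- (\<delta> * s)) * exp z \<le> K * exp z" for z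
        by (intro mult_right_mono) auto
      then show ?thesis
        using admissible_section[OF I \<delta> that] unfolding admissible_def by (blast intro: order_trans)
    qed
    have "ln (W t) \<le> ln (V s) + (\<integral>x. kk x * v (x(j := s)) \<partial>PiHL I) / V s"
      unfolding V_def W_def
    \<comment> \<open>The new bound on the error: \<open>r j / v\<close> is at most
      \<open>B\<close>, so the linear term in coordinate \<open>j\<close> is at most
      \<open>B * \<bar>t - s\<bar>\<close>.\<close>
    proof (rule insert.IH[where r = "\<lambda>i x. r i (x(j := s))" and D = "D + B * \<bar>t - s\<bar> + (\<psi> j t - \<psi> j s)\<^sup>2 / C"])
      show "admissible I B K \<delta> (\<lambda>x. v (x(j := s)))" "admissible I B K \<delta> (\<lambda>x. w (x(j := t)))"
        using weak v w s t by blast+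
      show "kk \<in> borel_measurable (PiHL I)" unfolding kk_def by measurable
      show "(\<lambda>x. r i (x(j := s))) \<in> borel_measurable (PiHL I)" if "i \<in> I" for i
        by (rule meas_sec[OF s r]) (use that in simp)
      fix x assume x: "x \<in> space (PiHL I)"
      note xs = upd[OF x s, of j]
      have vx: "0 < v (x(j := s))" by (rule admissibleD(2)[OF v xs])
      have rx: "0 \<le> r j (x(j := s))" "r j (x(j := s)) \<le> B * v (x(j := s))"
        by (rule r0[OF insertI1 xs], rule rB[OF insertI1 xs])
      have kx: "\<bar>k (x(j := s))\<bar> \<le> D" by (rule kD[OF xs])
      have "0 \<le> r j (x(j := s)) / v (x(j := s))" "r j (x(j := s)) / v (x(j := s)) \<le> B"
        using rx vx by (auto simp: field_simps)
      then have "\<bar>r j (x(j := s)) / v (x(j := s)) * (t - s)\<bar> \<le> B * \<bar>t - s\<bar>"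
        unfolding abs_mult by (intro mult_right_mono) auto
      moreover have "0 \<le> (\<psi> j t - \<psi> j s)\<^sup>2 / C" using C by simp
      ultimately show "\<bar>kk x\<bar> \<le> D + B * \<bar>t - s\<bar> + (\<psi> j t - \<psi> j s)\<^sup>2 / C"
        using kx unfolding kk_def abs_le_iff by linarith
      show "ln (w (y(j := t))) \<le> kk x + ln (v (x(j := s))) - (\<Sum>i\<in>I. r i (x(j := s)) / v (x(j := s)) * (y i - x i))
          + (\<Sum>i\<in>I. (\<psi> i (y i) - \<psi> i (x i))\<^sup>2 / C)" if y: "y \<in> space (PiHL I)" for y
      proof -
        have e1: "(\<Sum>i\<in>I. r i (x(j := s)) / v (x(j := s)) * ((y(j := t)) i - (x(j := s)) i))
            = (\<Sum>i\<in>I. r i (x(j := s)) / v (x(j := s)) * (y i - x i))"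
          using I by (intro sum.cong) auto
        have e2: "(\<Sum>i\<in>I. (\<psi> i ((y(j := t)) i) - \<psi> i ((x(j := s)) i))\<^sup>2 / C) = (\<Sum>i\<in>I. (\<psi> i (y i) - \<psi> i (x i))\<^sup>2 / C)"
          using I by (intro sum.cong) auto
        have "ln (w (y(j := t))) \<le> k (x(j := s)) + ln (v (x(j := s)))
            - (\<Sum>i\<in>insert j I. r i (x(j := s)) / v (x(j := s)) * ((y(j := t)) i - (x(j := s)) i))
            + (\<Sum>i\<in>insert j I. (\<psi> i ((y(j := t)) i) - \<psi> i ((x(j := s)) i))\<^sup>2 / C)"
          by (rule main[OF xs upd[OF y t]])
        then show ?thesis
          unfolding sum.insert[OF I] e1 e2 kk_def by simp
      qed
      fix i assume i: "i \<in> I"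
      then have ij: "i \<noteq> j" using I by auto
      show "0 \<le> r i (x(j := s))" "r i (x(j := s)) \<le> B * v (x(j := s))"
        by (rule r0[OF insertI2[OF i] xs], rule rB[OF insertI2[OF i] xs])
      show "ennreal (v (x(j := s))) = (\<integral>\<^sup>+u. ennreal (r i ((x(i := u))(j := s))) * indicator {x i..} u \<partial>HL)"
      proof -
        have "ennreal (v (x(j := s))) = (\<integral>\<^sup>+u. ennreal (r i ((x(j := s))(i := u))) * indicator {(x(j := s)) i..} u \<partial>HL)"
          by (rule rv[OF insertI2[OF i] xs])
        then show ?thesis using ij by (simp add: fun_upd_twist)
      qed
    qed (use insert.prems(1-3) in auto)
    also have "(\<integral>x. kk x * v (x(j := s)) \<partial>PiHL I)
        = (\<integral>x. k (x(j := s)) * v (x(j := s)) - (t - s) * r j (x(j := s)) + (\<psi> j t - \<psi> j s)\<^sup>2 / C * v (x(j := s)) \<partial>PiHL I)"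
    proof (rule Bochner_Integration.integral_cong)
      fix x assume "x \<in> space (PiHL I)"
      then have "0 < v (x(j := s))" by (intro admissibleD(2)[OF v] upd s)
      then show "kk x * v (x(j := s)) = k (x(j := s)) * v (x(j := s)) - (t - s) * r j (x(j := s)) + (\<psi> j t - \<psi> j s)\<^sup>2 / C * v (x(j := s))"
        unfolding kk_def by (simp add: field_simps)
    qed simp
    also have "\<dots> = k1 s * V s - (t - s) * R s + (\<psi> j t - \<psi> j s)\<^sup>2 / C * V s"
      using ikv[OF s] ir[OF s] iv[OF s] Vpos[OF s] by (simp add: k1_def V_def R_def)
    finally show ?thesis
      using Vpos[OF s] by (simp add: diff_divide_distrib add_divide_distrib mult.commute)
  qed
  have k1D: "\<bar>k1 s\<bar> \<le> D" if s: "0 \<le> s" for s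
  proof -
    have b: "k (x(j := s)) * v (x(j := s)) \<le> D * v (x(j := s)) \<and> - D * v (x(j := s)) \<le> k (x(j := s)) * v (x(j := s))"
      if x: "x \<in> space (PiHL I)" for x
    proof -
      have "\<bar>k (x(j := s))\<bar> \<le> D" by (rule kD[OF upd[OF x s]])
      moreover have "0 < v (x(j := s))" by (rule admissibleD(2)[OF v upd[OF x s]])
      ultimately show ?thesis by (intro conjI mult_right_mono) auto
    qed
    have "(\<integral>x. k (x(j := s)) * v (x(j := s)) \<partial>PiHL I) \<le> (\<integral>x. D * v (x(j := s)) \<partial>PiHL I)"
      by (rule integral_mono[OF ikv[OF s] integrable_mult_right[OF iv[OF s]]]) (use b in auto)
    moreover have "(\<integral>x. - D * v (x(j := s)) \<partial>PiHL I) \<le> (\<integral>x. k (x(j := s)) * v (x(j := s)) \<partial>PiHL I)"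
      by (rule integral_mono[OF integrable_mult_right[OF iv[OF s]] ikv[OF s]]) (use b in auto)
    moreover have "(\<integral>x. v (x(j := s)) \<partial>PiHL I) = V s" by (simp add: V_def)
    ultimately show ?thesis
      unfolding k1_def using Vpos[OF s] by (simp add: abs_le_iff field_simps)
  qed
  note marg = borel_measurable_marginal[OF I(1)]
  have Vm: "V \<in> borel_measurable HL" unfolding V_def by (rule marg[OF admissibleD(1)[OF v]])
  have [measurable]: "(\<lambda>x. k x * v x) \<in> borel_measurable (PiHL (insert j I))"
    using k admissibleD(1)[OF v] by measurable
  have k1m: "k1 \<in> borel_measurable HL"
    unfolding k1_def by (rule borel_measurable_divide[OF marg Vm]) measurable
  have R0: "0 \<le> R s" if "0 \<le> s" for s
    unfolding R_def by (intro integral_nonneg_AE AE_I2 r0 upd that) auto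
  have RB: "R s \<le> B * V s" if s: "0 \<le> s" for s
    unfolding R_def V_def integral_mult_right_zero[symmetric]
    by (rule integral_mono[OF ir[OF s] integrable_mult_right[OF iv[OF s]]]) (intro rB upd s insertI1)
  have RV: "ennreal (V s) = (\<integral>\<^sup>+u. ennreal (R u) * indicator {s..} u \<partial>HL)" if s: "0 \<le> s" for s
  proof -
    interpret P: pair_sigma_finite HL "PiHL I"
      by (simp add: pair_sigma_finite_def sigma_finite_HL HL.sigma_finite[OF I(1)])
    have [measurable]: "(\<lambda>(u, x). r j (x(j := u))) \<in> borel_measurable (HL \<Otimes>\<^sub>M PiHL I)"
      unfolding case_prod_beta' by (rule measurable_compose[OF measurable_upd_pair_HL r[OF insertI1]])
    have [measurable]: "(\<lambda>u. indicator {s..} u :: ennreal) \<in> borel_measurable HL"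
      by (rule measurable_HL) measurable
    have "ennreal (V s) = (\<integral>\<^sup>+x. ennreal (v (x(j := s))) \<partial>PiHL I)"
      unfolding V_def by (intro nn_integral_eq_integral[symmetric] iv s AE_I2 less_imp_le admissibleD(2)[OF v] upd)
    also have "\<dots> = (\<integral>\<^sup>+x. (\<integral>\<^sup>+u. ennreal (r j (x(j := u))) * indicator {s..} u \<partial>HL) \<partial>PiHL I)"
    proof (rule nn_integral_cong)
      fix x assume "x \<in> space (PiHL I)"
      then have "ennreal (v (x(j := s))) = (\<integral>\<^sup>+u. ennreal (r j ((x(j := s))(j := u))) * indicator {(x(j := s)) j..} u \<partial>HL)"
        by (rule rv[OF insertI1 upd[OF _ s]])
      then show "ennreal (v (x(j := s))) = (\<integral>\<^sup>+u. ennreal (r j (x(j := u))) * indicator {s..} u \<partial>HL)"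
        by simp
    qed
    also have "\<dots> = (\<integral>\<^sup>+u. (\<integral>\<^sup>+x. ennreal (r j (x(j := u))) * indicator {s..} u \<partial>PiHL I) \<partial>HL)"
      by (rule P.Fubini') measurable
    also have "\<dots> = (\<integral>\<^sup>+u. ennreal (R u) * indicator {s..} u \<partial>HL)"
    proof (rule nn_integral_cong)
      fix u assume "u \<in> space HL"
      then have u: "0 \<le> u" by (simp add: space_HL)
      have [measurable]: "(\<lambda>x. r j (x(j := u))) \<in> borel_measurable (PiHL I)" by (rule meas_sec[OF u r[OF insertI1]])
      have "(\<integral>\<^sup>+x. ennreal (r j (x(j := u))) * indicator {s..} u \<partial>PiHL I)
          = (\<integral>\<^sup>+x. ennreal (r j (x(j := u))) \<partial>PiHL I) * indicator {s..} u"
        by (rule nn_integral_multc) measurable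
      also have "(\<integral>\<^sup>+x. ennreal (r j (x(j := u))) \<partial>PiHL I) = ennreal (R u)"
        unfolding R_def by (intro nn_integral_eq_integral ir u AE_I2 r0 upd) auto
      finally show "(\<integral>\<^sup>+x. ennreal (r j (x(j := u))) * indicator {s..} u \<partial>PiHL I) = ennreal (R u) * indicator {s..} u" .
    qed
    finally show ?thesis .
  qed
  have Vb: "V s \<le> K * (1 / \<delta>) ^ card I * exp (- (\<delta> * s))"
    and Wb: "0 < W s" "W s \<le> K * (1 / \<delta>) ^ card I * exp (- (\<delta> * s))" if "0 \<le> s" for s
    unfolding V_def W_def by (rule admissible_marginal[OF I \<delta> v that] admissible_marginal[OF I \<delta> w that])+
  have Vl: "V s \<le> exp (B * \<bar>s - t\<bar>) * V t" and Wl: "W s \<le> exp (B * \<bar>s - t\<bar>) * W t"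
    if "0 \<le> s" "0 \<le> t" for s t
    unfolding V_def W_def by (rule admissible_marginal(3)[OF I \<delta> v that] admissible_marginal(3)[OF I \<delta> w that])+
  have Rm: "R \<in> borel_measurable HL" unfolding R_def by (rule marg[OF r[OF insertI1]])
  have main1: "ln (\<integral>s. W s \<partial>HL) \<le> ln (\<integral>s. V s \<partial>HL) + (\<integral>s. k1 s * V s \<partial>HL) / (\<integral>s. V s \<partial>HL)"
    by (rule transport_inequality_1d[OF C insert.prems(1)[OF insertI1] insert.prems(2)[OF insertI1] insert.prems(3)[OF insertI1] \<delta>
          Vpos Vb Vl Wb Wl Rm R0 RB RV k1m k1D step])
  have eV: "(\<integral>s. V s \<partial>HL) = (\<integral>x. v x \<partial>PiHL (insert j I))"
    unfolding V_def by (rule integral_insert_marginal[symmetric, OF I admissibleD(1)[OF v] less_imp_le[OF admissibleD(2)[OF v]] iv])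
  have eW: "(\<integral>s. W s \<partial>HL) = (\<integral>x. w x \<partial>PiHL (insert j I))"
    unfolding W_def
    by (rule integral_insert_marginal[symmetric, OF I admissibleD(1)[OF w] less_imp_le[OF admissibleD(2)[OF w]]
          admissible_integral(1)[OF I(1) \<delta> wsec]])
  have finI: "finite (insert j I)" using I by simp
  note ivI = admissible_integral(1)[OF finI \<delta> v]
  have ikvI: "integrable (PiHL (insert j I)) (\<lambda>x. k x * v x)"
    by (rule admissible_integrable_mult[OF finI \<delta> v k kD])
  \<comment> \<open>Marginalisation is available for nonnegative integrands, so it is applied to
    \<open>k + D\<close>; the contribution of \<open>D\<close> is subtracted afterwards.\<close>
  have iV: "integrable HL V" and iHk: "integrable HL (\<lambda>s. (k1 s + D) * V s)"
    and ek: "(\<integral>s. (k1 s + D) * V s \<partial>HL) = (\<integral>x. (k x + D) * v x \<partial>PiHL (insert j I))"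
  proof -
    have m: "(\<lambda>x. (k x + D) * v x) \<in> borel_measurable (PiHL (insert j I))"
      using k admissibleD(1)[OF v] by measurable
    have nn: "0 \<le> (k x + D) * v x" if "x \<in> space (PiHL (insert j I))" for x
      using kD[OF that] admissibleD(2)[OF v that] by (intro mult_nonneg_nonneg) auto
    have int: "integrable (PiHL I) (\<lambda>x. (k (x(j := s)) + D) * v (x(j := s)))" if "0 \<le> s" for s
      unfolding distrib_right by (intro Bochner_Integration.integrable_add ikv integrable_mult_right iv that)
    have e: "(\<integral>x. (k (x(j := s)) + D) * v (x(j := s)) \<partial>PiHL I) = (k1 s + D) * V s" if s: "0 \<le> s" for s
      using ikv[OF s] iv[OF s] Vpos[OF s] by (simp add: distrib_right k1_def V_def)
    have "(\<integral>s. (k1 s + D) * V s \<partial>HL) = (\<integral>s. (\<integral>x. (k (x(j := s)) + D) * v (x(j := s)) \<partial>PiHL I) \<partial>HL)"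
      by (rule Bochner_Integration.integral_cong) (auto simp: e space_HL)
    also have "\<dots> = (\<integral>x. (k x + D) * v x \<partial>PiHL (insert j I))"
      by (rule integral_insert_marginal[symmetric, OF I m nn int])
    finally show "(\<integral>s. (k1 s + D) * V s \<partial>HL) = (\<integral>x. (k x + D) * v x \<partial>PiHL (insert j I))" .
    have "(\<integral>\<^sup>+x. ennreal (v x) \<partial>PiHL (insert j I)) = (\<integral>\<^sup>+s. ennreal (V s) \<partial>HL)"
      unfolding V_def
      by (rule nn_integral_insert_marginal[OF I admissibleD(1)[OF v] less_imp_le[OF admissibleD(2)[OF v]] iv])
    moreover have "(\<integral>\<^sup>+x. ennreal (v x) \<partial>PiHL (insert j I)) = ennreal (\<integral>x. v x \<partial>PiHL (insert j I))"
      by (intro nn_integral_eq_integral ivI AE_I2 less_imp_le[OF admissibleD(2)[OF v]])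
    ultimately have "(\<integral>\<^sup>+s. ennreal (V s) \<partial>HL) = ennreal (\<integral>x. v x \<partial>PiHL (insert j I))"
      by simp
    then show iV: "integrable HL V"
      using Vm Vpos by (intro integrableI_nonneg AE_HL less_imp_le) auto
    show "integrable HL (\<lambda>s. (k1 s + D) * V s)"
    proof (rule Bochner_Integration.integrable_bound[OF integrable_mult_right[OF iV, of "2 * D"]])
      show "(\<lambda>s. (k1 s + D) * V s) \<in> borel_measurable HL" using k1m Vm by measurable
      show "AE s in HL. norm ((k1 s + D) * V s) \<le> norm (2 * D * V s)"
      proof (rule AE_HL)
        fix s :: real assume s: "0 \<le> s"
        have "\<bar>k1 s + D\<bar> \<le> \<bar>2 * D\<bar>" using k1D[OF s] by (auto simp: abs_real_def split: if_splits)
        then show "norm ((k1 s + D) * V s) \<le> norm (2 * D * V s)"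
          unfolding real_norm_def abs_mult[of _ "V s"] by (intro mult_right_mono) auto
      qed
    qed
  qed
  have "(\<integral>s. k1 s * V s \<partial>HL) = (\<integral>s. (k1 s + D) * V s - D * V s \<partial>HL)"
    by (simp add: algebra_simps)
  also have "\<dots> = (\<integral>x. (k x + D) * v x \<partial>PiHL (insert j I)) - D * (\<integral>x. v x \<partial>PiHL (insert j I))"
    using iHk iV by (simp add: ek eV)
  also have "\<dots> = (\<integral>x. k x * v x \<partial>PiHL (insert j I))"
    using ikvI ivI by (simp add: distrib_right)
  finally show ?case using main1 by (simp add: eV eW)
qed

section \<open>Averaging the clipping inequality\<close>

text \<open>A smooth bounded concave profile psi with psi 0 = 0 is a mixture of the functions min (x
  / R) 1 with weight - R psi'' R. For 1 - exp (- a x) this weight is a^2 R exp (- a R), the Gamma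
  density of shape 2 and rate \<open>a\<close>. The library counts the Erlang shape from 0, whence
  the index 1.\<close>

lemma nn_integral_clip_erlang:
  assumes a: "0 < a" and x: "0 \<le> x"
  shows "(\<integral>\<^sup>+R. ennreal (clip R x) \<partial>density lborel (erlang_density 1 a)) = ennreal (1 - exp (- (a * x)))"
proof -
  \<comment> \<open>For \<open>R < x\<close> the clip is saturated and leaves the density
    \<open>?f\<close>; for \<open>R > x\<close> the factor \<open>x / R\<close> cancels the
    \<open>R\<close> of the density and leaves \<open>?g\<close>.\<close>
  let ?f = "\<lambda>R. a\<^sup>2 * R * exp (- (a * R))" and ?g = "\<lambda>R. x * a\<^sup>2 * exp (- (a * R))"
  have [measurable]: "(\<lambda>R. clip R x) \<in> borel_measurable borel" unfolding clip_def by measurable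
  have 1: "(\<integral>\<^sup>+R. ennreal (?f R) * indicator {0..x} R \<partial>lborel)
      = ennreal (- (a * x + 1) * exp (- (a * x)) - (- (a * 0 + 1) * exp (- (a * 0))))"
    by (rule nn_integral_FTC_Icc) (use a x in \<open>auto intro!: derivative_eq_intros simp: algebra_simps power2_eq_square\<close>)
  have "filterlim (\<lambda>R. a * R) at_top at_top"
    using a by (intro filterlim_tendsto_pos_mult_at_top[OF tendsto_const]) (auto simp: filterlim_ident)
  then have "((\<lambda>R. exp (- (a * R))) \<longlongrightarrow> 0) at_top"
    by (intro filterlim_compose[OF exp_at_bot]) (simp add: filterlim_uminus_at_top)
  then have lim: "((\<lambda>R. - (x * a) * exp (- (a * R))) \<longlongrightarrow> - (x * a) * 0) at_top"
    by (intro tendsto_mult tendsto_const)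
  have 2: "(\<integral>\<^sup>+R. ennreal (?g R) * indicator {x..} R \<partial>lborel) = ennreal (0 - (- (x * a) * exp (- (a * x))))"
    by (rule nn_integral_FTC_atLeast[where F = "\<lambda>R. - (x * a) * exp (- (a * R))"])
       (use a x lim in \<open>auto intro!: derivative_eq_intros simp: algebra_simps power2_eq_square\<close>)
  have "(\<integral>\<^sup>+R. ennreal (clip R x) \<partial>density lborel (erlang_density 1 a))
      = (\<integral>\<^sup>+R. ennreal (erlang_density 1 a R) * ennreal (clip R x) \<partial>lborel)"
    by (subst nn_integral_density) auto
  also have "\<dots> = (\<integral>\<^sup>+R. ennreal (?f R) * indicator {0..x} R + ennreal (?g R) * indicator {x..} R \<partial>lborel)"
  proof (rule nn_integral_cong_AE)
    show "AE R in lborel. ennreal (erlang_density 1 a R) * ennreal (clip R x)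
        = ennreal (?f R) * indicator {0..x} R + ennreal (?g R) * indicator {x..} R"
      using AE_lborel_singleton[of x] AE_lborel_singleton[of 0]
    proof eventually_elim
      fix R :: real assume R: "R \<noteq> x" "R \<noteq> 0"
      consider "R < 0" | "0 < R" "R < x" | "0 < R" "x < R" using R by linarith
      then show "ennreal (erlang_density 1 a R) * ennreal (clip R x)
        = ennreal (?f R) * indicator {0..x} R + ennreal (?g R) * indicator {x..} R"
      proof cases
        case 1 then show ?thesis using x by (simp add: erlang_density_def)
      next
        case 2
        then have "clip R x = 1" by (simp add: clip_def min_def field_simps)
        with 2 show ?thesis by (simp add: erlang_density_def power2_eq_square)
      next
        case 3
        then have "clip R x = x / R" using x by (simp add: clip_def min_def field_simps)
        with 3 x show ?thesis
          by (simp add: erlang_density_def ennreal_mult'[symmetric] ennreal_mult''[symmetric] power2_eq_square mult_ac)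
      qed
    qed
  qed
  also have "\<dots> = ennreal (1 - (a * x + 1) * exp (- (a * x))) + ennreal (x * a * exp (- (a * x)))"
  proof (subst nn_integral_add)
    have "- (a * x + 1) * exp (- (a * x)) - (- (a * 0 + 1) * exp (- (a * 0))) = 1 - (a * x + 1) * exp (- (a * x))"
      by (simp add: algebra_simps)
    with 1 2 show "(\<integral>\<^sup>+R. ennreal (?f R) * indicator {0..x} R \<partial>lborel) + (\<integral>\<^sup>+R. ennreal (?g R) * indicator {x..} R \<partial>lborel)
        = ennreal (1 - (a * x + 1) * exp (- (a * x))) + ennreal (x * a * exp (- (a * x)))"
      by (simp only:) simp
  qed measurable
  also have "\<dots> = ennreal (1 - exp (- (a * x)))"
  proof (subst ennreal_plus[symmetric])
    have "(a * x + 1) * exp (- (a * x)) \<le> exp (a * x) * exp (- (a * x))"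
      using exp_ge_add_one_self[of "a * x"] by (intro mult_right_mono) (auto simp: add.commute)
    then show "0 \<le> 1 - (a * x + 1) * exp (- (a * x))" by (simp add: exp_minus)
    show "0 \<le> x * a * exp (- (a * x))" using a x by simp
  qed (simp add: algebra_simps)
  finally show ?thesis .
qed

lemma measurable_restrict_HL:
  "f \<in> borel_measurable (restrict_space borel {0..}) \<Longrightarrow> f \<in> borel_measurable HL"
  using measurable_cong_sets[OF sets_HL refl] by blast

text \<open>The profile is a mean of clips, so by Jensen's inequality its squared increment is at
  most the mean of their squared increments. The right-hand side of the clipping inequality does not
  involve R, and the mixing measure has mass one, so Tonelli's theorem returns the same constant for
  every \<open>a\<close>.\<close>

lemma transport_cost_exp:
  assumes C: "clipping_constant C" and a: "0 < a"
  shows "transport_cost C (\<lambda>x. 1 - exp (- (a * x)))"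
  unfolding transport_cost_def
proof (intro allI impI)
  fix h T :: "real \<Rightarrow> real"
  assume h: "nonincreasing_density h" and T: "mono_on {0..} T" "\<forall>x\<ge>0. 0 \<le> T x" "T 0 = 0"
    and ac: "\<forall>b\<ge>0. abs_continuous_on_interval 0 b T"
  define P where "P = density lborel (\<lambda>R. ennreal (erlang_density 1 a R))"
  interpret P: prob_space P
    unfolding P_def using a by (rule prob_space_erlang_density)
  interpret PHL: pair_sigma_finite HL P
    by (simp add: pair_sigma_finite_def sigma_finite_HL P.sigma_finite_measure_axioms)
  have [measurable_cong, simp]: "sets P = sets borel" by (simp add: P_def)
  \<comment> \<open>The clipping inequality is assumed for positive R, and \<open>clip R\<close>
    takes values in the unit interval only there; every statement about it below therefore holds
    almost everywhere.\<close>
  have Rpos: "AE R in P. 0 < R"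
    unfolding P_def using AE_lborel_singleton[of 0]
    by (subst AE_density) (auto simp: erlang_density_def elim!: eventually_mono)
  \<comment> \<open>Neither \<open>T\<close> nor \<open>h\<close> is assumed measurable; for both it
    follows from monotonicity.\<close>
  have Tm[measurable]: "T \<in> borel_measurable HL"
    by (rule measurable_restrict_HL, rule borel_measurable_mono_on_fnc[OF T(1)])
  have "mono_on {0..} (\<lambda>x. - h x)"
    using h by (auto simp: nonincreasing_density_def monotone_on_def)
  then have "(\<lambda>x. - h x) \<in> borel_measurable HL"
    by (intro measurable_restrict_HL borel_measurable_mono_on_fnc)
  then have "(\<lambda>x. - (- h x)) \<in> borel_measurable HL" by (rule borel_measurable_uminus)
  then have hm[measurable]: "h \<in> borel_measurable HL" by simp
  have h0: "0 \<le> h x" if "0 \<le> x" for x using h that by (simp add: nonincreasing_density_def)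
  have clipm: "(\<lambda>R. clip R x) \<in> borel_measurable P" for x unfolding clip_def by measurable
  have clip01: "AE R in P. 0 \<le> clip R x \<and> clip R x \<le> 1" if "0 \<le> x" for x
    using Rpos by eventually_elim (use that in \<open>simp add: clip_def\<close>)
  have iclip: "integrable P (\<lambda>R. clip R x)" if "0 \<le> x" for x
  proof (rule P.integrable_const_bound[of _ 1])
    show "AE R in P. norm (clip R x) \<le> 1" using clip01[OF that] by eventually_elim auto
  qed (rule clipm)
  have eclip: "(\<integral>R. clip R x \<partial>P) = 1 - exp (- (a * x))" if x: "0 \<le> x" for x
  proof -
    have "(\<integral>R. clip R x \<partial>P) = enn2real (\<integral>\<^sup>+R. ennreal (clip R x) \<partial>P)"
    proof (rule integral_eq_nn_integral)
      show "AE R in P. 0 \<le> clip R x" using clip01[OF x] by eventually_elim auto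
    qed (rule clipm)
    then show ?thesis using nn_integral_clip_erlang[OF a x] a x by (simp add: P_def)
  qed
  have jensen: "((1 - exp (- (a * y))) - (1 - exp (- (a * x))))\<^sup>2 \<le> (\<integral>R. (clip R y - clip R x)\<^sup>2 \<partial>P)"
    and isq: "integrable P (\<lambda>R. (clip R y - clip R x)\<^sup>2)" if xy: "0 \<le> x" "0 \<le> y" for x y
  proof -
    have "AE R in P. norm ((clip R y - clip R x)\<^sup>2) \<le> 1"
      using clip01[OF xy(1)] clip01[OF xy(2)]
    proof eventually_elim
      fix R assume "0 \<le> clip R x \<and> clip R x \<le> 1" "0 \<le> clip R y \<and> clip R y \<le> 1"
      then have "\<bar>clip R y - clip R x\<bar> \<le> 1" by auto
      then show "norm ((clip R y - clip R x)\<^sup>2) \<le> 1" by (simp add: abs_square_le_1)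
    qed
    then show isq: "integrable P (\<lambda>R. (clip R y - clip R x)\<^sup>2)"
      by (intro P.integrable_const_bound[of _ 1] borel_measurable_power borel_measurable_diff clipm)
    have "((1 - exp (- (a * y))) - (1 - exp (- (a * x))))\<^sup>2 = (\<integral>R. clip R y - clip R x \<partial>P)\<^sup>2"
      using iclip[OF xy(1)] iclip[OF xy(2)] by (simp add: eclip xy)
    also have "\<dots> \<le> (\<integral>R. (clip R y - clip R x)\<^sup>2 \<partial>P)"
      using P.variance_eq[of "\<lambda>R. clip R y - clip R x"] P.variance_positive[of "\<lambda>R. clip R y - clip R x"]
        Bochner_Integration.integrable_diff[OF iclip[OF xy(2)] iclip[OF xy(1)]] isq
      by simp
    finally show "((1 - exp (- (a * y))) - (1 - exp (- (a * x))))\<^sup>2 \<le> (\<integral>R. (clip R y - clip R x)\<^sup>2 \<partial>P)" .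
  qed
  have idm: "(\<lambda>x. x) \<in> borel_measurable HL" by (rule measurable_HL) measurable
  have fm: "(\<lambda>p. f (fst p)) \<in> borel_measurable (HL \<Otimes>\<^sub>M P)" if "f \<in> borel_measurable HL" for f :: "real \<Rightarrow> real"
    using that by measurable
  have cm: "(\<lambda>p. clip (snd p) (f (fst p))) \<in> borel_measurable (HL \<Otimes>\<^sub>M P)" if "f \<in> borel_measurable HL" for f
    unfolding clip_def by (intro borel_measurable_min borel_measurable_divide fm that) measurable
  have m: "(\<lambda>(x, R). ennreal (\<bar>clip R (T x) - clip R x\<bar>\<^sup>2 * h x)) \<in> borel_measurable (HL \<Otimes>\<^sub>M P)"
    unfolding case_prod_beta'
    by (intro measurable_compose[OF _ measurable_ennreal] borel_measurable_times borel_measurable_power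
        borel_measurable_abs borel_measurable_diff cm[OF Tm] cm[OF idm] fm[OF hm])
  let ?E = "\<integral>\<^sup>+x. clip_Delta (deriv T x) * ennreal (h x) \<partial>HL"
  have "(\<integral>\<^sup>+x. ennreal (((1 - exp (- (a * T x))) - (1 - exp (- (a * x))))\<^sup>2 * h x) \<partial>HL)
      \<le> (\<integral>\<^sup>+x. (\<integral>\<^sup>+R. ennreal (\<bar>clip R (T x) - clip R x\<bar>\<^sup>2 * h x) \<partial>P) \<partial>HL)"
  proof (rule nn_integral_mono)
    fix x assume "x \<in> space HL"
    then have x: "0 \<le> x" "0 \<le> T x" using T by (auto simp: space_HL)
    have "ennreal (((1 - exp (- (a * T x))) - (1 - exp (- (a * x))))\<^sup>2 * h x)
        \<le> ennreal ((\<integral>R. (clip R (T x) - clip R x)\<^sup>2 \<partial>P) * h x)"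
      using jensen[OF x] h0[OF x(1)] by (intro ennreal_leI mult_right_mono) auto
    also have "\<dots> = ennreal (\<integral>R. (clip R (T x) - clip R x)\<^sup>2 * h x \<partial>P)" by simp
    also have "\<dots> = (\<integral>\<^sup>+R. ennreal (\<bar>clip R (T x) - clip R x\<bar>\<^sup>2 * h x) \<partial>P)"
      using isq[OF x] h0[OF x(1)] by (subst nn_integral_eq_integral) auto
    finally show "ennreal (((1 - exp (- (a * T x))) - (1 - exp (- (a * x))))\<^sup>2 * h x)
        \<le> (\<integral>\<^sup>+R. ennreal (\<bar>clip R (T x) - clip R x\<bar>\<^sup>2 * h x) \<partial>P)" .
  qed
  also have "\<dots> = (\<integral>\<^sup>+R. (\<integral>\<^sup>+x. ennreal (\<bar>clip R (T x) - clip R x\<bar>\<^sup>2 * h x) \<partial>HL) \<partial>P)"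
    by (rule PHL.Fubini'[symmetric, OF m])
  also have "\<dots> \<le> (\<integral>\<^sup>+R. ennreal C * ?E \<partial>P)"
  proof (rule nn_integral_mono_AE)
    show "AE R in P. (\<integral>\<^sup>+x. ennreal (\<bar>clip R (T x) - clip R x\<bar>\<^sup>2 * h x) \<partial>HL) \<le> ennreal C * ?E"
      using Rpos
    proof eventually_elim
      fix R :: real assume "0 < R"
      with C h T ac show "(\<integral>\<^sup>+x. ennreal (\<bar>clip R (T x) - clip R x\<bar>\<^sup>2 * h x) \<partial>HL) \<le> ennreal C * ?E"
        unfolding clipping_constant_def nn_integral_HL by blast
    qed
  qed
  also have "\<dots> = ennreal C * ?E" by (simp add: P.emeasure_space_1)
  finally show "(\<integral>\<^sup>+x. ennreal (((1 - exp (- (a * T x))) - (1 - exp (- (a * x))))\<^sup>2 * h x) \<partial>HL) \<le> ennreal C * ?E" .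
qed

text \<open>Permits a strictly positive constant: \<open>clipping_constant\<close> admits 0, by
  which the transport argument could not divide.\<close>

lemma clipping_constant_mono:
  assumes "clipping_constant C" "C \<le> C'" shows "clipping_constant C'"
  unfolding clipping_constant_def
proof (intro conjI allI impI)
  show "0 \<le> C'" using assms by (simp add: clipping_constant_def)
  fix R :: real and h T :: "real \<Rightarrow> real"
  assume "0 < R" "nonincreasing_density h" "mono_on {0..} T" "\<forall>x\<ge>0. 0 \<le> T x" "T 0 = 0"
    "\<forall>b\<ge>0. abs_continuous_on_interval 0 b T"
  then have "(\<integral>\<^sup>+x\<in>{0..}. ennreal (\<bar>clip R (T x) - clip R x\<bar>\<^sup>2 * h x) \<partial>lborel)
      \<le> ennreal C * (\<integral>\<^sup>+x\<in>{0..}. clip_Delta (deriv T x) * ennreal (h x) \<partial>lborel)"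
    using assms(1) unfolding clipping_constant_def by blast
  also have "\<dots> \<le> ennreal C' * (\<integral>\<^sup>+x\<in>{0..}. clip_Delta (deriv T x) * ennreal (h x) \<partial>lborel)"
    using assms(2) by (intro mult_right_mono ennreal_leI) auto
  finally show "(\<integral>\<^sup>+x\<in>{0..}. ennreal (\<bar>clip R (T x) - clip R x\<bar>\<^sup>2 * h x) \<partial>lborel)
      \<le> ennreal C' * (\<integral>\<^sup>+x\<in>{0..}. clip_Delta (deriv T x) * ennreal (h x) \<partial>lborel)" .
qed

section \<open>Prekopa--Leindler inequality\<close>

lemma emeasure_lborel_affine:
  fixes A :: "real set"
  assumes [measurable]: "A \<in> sets borel" and c: "0 < c"
  shows "emeasure lborel {y. (y - t) / c \<in> A} = ennreal c * emeasure lborel A"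
proof -
  have [measurable]: "{y. (y - t) / c \<in> A} \<in> sets borel" by measurable
  have "emeasure lborel {y. (y - t) / c \<in> A} = (\<integral>\<^sup>+y. indicator {y. (y - t) / c \<in> A} y \<partial>lborel)"
    by simp
  also have "\<dots> = ennreal \<bar>c\<bar> * (\<integral>\<^sup>+y. indicator {y. (y - t) / c \<in> A} (t + c * y) \<partial>lborel)"
    by (rule nn_integral_real_affine) (use c in auto)
  also have "(\<integral>\<^sup>+y. indicator {y. (y - t) / c \<in> A} (t + c * y) \<partial>lborel) = (\<integral>\<^sup>+y. indicator A y \<partial>lborel)"
    using c by (intro nn_integral_cong) (auto split: split_indicator)
  finally show ?thesis using c by simp
qed

text \<open>The sets \<theta> A + (1 - \<theta>) b0 and \<theta> a0 + (1 - \<theta>) B both lie in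
  \<open>S\<close>. With \<open>a0\<close> near the supremum of \<open>A\<close> and
  \<open>b0\<close> near the infimum of \<open>B\<close>, the first ends about where the second
  begins, so they overlap in measure at most \<eta>. The margin \<eta> covers extremes that are not
  attained. \<open>S\<close> is any Borel superset of the combination, because a sum of Borel sets
  may fail to be Borel.\<close>

lemma brunn_minkowski_1d:
  fixes A B S :: "real set"
  assumes [measurable]: "A \<in> sets borel" "B \<in> sets borel" "S \<in> sets borel"
    and A: "A \<noteq> {}" "bounded A" and B: "B \<noteq> {}" "bounded B" and \<theta>: "0 < \<theta>" "\<theta> < 1"
    and S: "\<And>a b. a \<in> A \<Longrightarrow> b \<in> B \<Longrightarrow> \<theta> * a + (1 - \<theta>) * b \<in> S"
  shows "ennreal \<theta> * emeasure lborel A + ennreal (1 - \<theta>) * emeasure lborel B \<le> emeasure lborel S"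
proof (rule ennreal_le_epsilon)
  fix \<eta> :: real assume \<eta>: "0 < \<eta>"
  have bA: "bdd_above A" and bB: "bdd_below B" using A B by (auto simp: bounded_imp_bdd_above bounded_imp_bdd_below)
  obtain a0 where a0: "a0 \<in> A" "Sup A - \<eta> < a0"
    using less_cSup_iff[OF A(1) bA, of "Sup A - \<eta>"] \<eta> by auto
  obtain b0 where b0: "b0 \<in> B" "b0 < Inf B + \<eta>"
    using cInf_less_iff[OF B(1) bB, of "Inf B + \<eta>"] \<eta> by auto
  define A1 where "A1 = {y. (y - (1 - \<theta>) * b0) / \<theta> \<in> A}"
  define B1 where "B1 = {y. (y - \<theta> * a0) / (1 - \<theta>) \<in> B}"
  have [measurable]: "A1 \<in> sets borel" "B1 \<in> sets borel" unfolding A1_def B1_def by measurable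
  have "A1 \<union> B1 \<subseteq> S"
  proof
    fix y assume "y \<in> A1 \<union> B1"
    then show "y \<in> S"
      using S[OF _ b0(1), of "(y - (1 - \<theta>) * b0) / \<theta>"] S[OF a0(1), of "(y - \<theta> * a0) / (1 - \<theta>)"] \<theta>
      by (auto simp: A1_def B1_def)
  qed
  then have 1: "emeasure lborel (A1 \<union> B1) \<le> emeasure lborel S" by (intro emeasure_mono) auto
  have "A1 \<inter> B1 \<subseteq> {\<theta> * a0 + (1 - \<theta>) * Inf B..\<theta> * Sup A + (1 - \<theta>) * b0}"
  proof
    fix y assume y: "y \<in> A1 \<inter> B1"
    have "(y - (1 - \<theta>) * b0) / \<theta> \<le> Sup A" using y bA by (auto simp: A1_def intro: cSup_upper)
    moreover have "Inf B \<le> (y - \<theta> * a0) / (1 - \<theta>)" using y bB by (auto simp: B1_def intro: cInf_lower)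
    ultimately show "y \<in> {\<theta> * a0 + (1 - \<theta>) * Inf B..\<theta> * Sup A + (1 - \<theta>) * b0}"
      using \<theta> by (simp add: field_simps)
  qed
  then have "emeasure lborel (A1 \<inter> B1)
      \<le> emeasure lborel {\<theta> * a0 + (1 - \<theta>) * Inf B..\<theta> * Sup A + (1 - \<theta>) * b0}"
    by (intro emeasure_mono) auto
  also have "\<dots> \<le> ennreal \<eta>"
  proof -
    have "\<theta> * Sup A + (1 - \<theta>) * b0 - (\<theta> * a0 + (1 - \<theta>) * Inf B) = \<theta> * (Sup A - a0) + (1 - \<theta>) * (b0 - Inf B)"
      by (simp add: algebra_simps)
    also have "\<dots> \<le> \<theta> * \<eta> + (1 - \<theta>) * \<eta>"
      using a0 b0 \<theta> by (intro add_mono mult_left_mono) auto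
    finally have "\<theta> * Sup A + (1 - \<theta>) * b0 - (\<theta> * a0 + (1 - \<theta>) * Inf B) \<le> \<eta>" by (simp add: algebra_simps)
    then show ?thesis using \<eta> by (auto simp: emeasure_lborel_Icc_eq ennreal_leI)
  qed
  finally have 2: "emeasure lborel (A1 \<inter> B1) \<le> ennreal \<eta>" .
  have "ennreal \<theta> * emeasure lborel A + ennreal (1 - \<theta>) * emeasure lborel B = emeasure lborel A1 + emeasure lborel B1"
    unfolding A1_def B1_def using \<theta> by (simp add: emeasure_lborel_affine)
  also have "\<dots> = emeasure lborel (A1 \<union> B1) + emeasure lborel (A1 \<inter> B1)"
    by (rule emeasure_Un_Int) auto
  also have "\<dots> \<le> emeasure lborel S + ennreal \<eta>" using 1 2 by (rule add_mono)
  finally show "ennreal \<theta> * emeasure lborel A + ennreal (1 - \<theta>) * emeasure lborel B \<le> emeasure lborel S + ennreal \<eta>" .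
qed

text \<open>The cut at height \<open>c\<close> suits a function about which only the levels below
  \<open>c\<close> are controlled; for a function bounded by \<open>c\<close> it changes nothing and
  the formula is the usual one.\<close>

lemma layer_cake_min:
  fixes f :: "real \<Rightarrow> real"
  assumes [measurable]: "f \<in> borel_measurable borel" and f: "\<And>x. 0 \<le> f x" and c: "0 < c"
  shows "(\<integral>\<^sup>+x. ennreal (min (f x / c) 1) \<partial>lborel) = (\<integral>\<^sup>+l\<in>{0<..<1}. emeasure lborel {x. l * c < f x} \<partial>lborel)"
proof -
  have "(\<integral>\<^sup>+x. ennreal (min (f x / c) 1) \<partial>lborel)
      = (\<integral>\<^sup>+x. (\<integral>\<^sup>+l. indicator {0<..<1} l * indicator {x. l * c < f x} x \<partial>lborel) \<partial>lborel)"
  proof (rule nn_integral_cong)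
    fix x :: real
    have "(\<integral>\<^sup>+l. indicator {0<..<1} l * indicator {x. l * c < f x} x \<partial>lborel)
        = (\<integral>\<^sup>+l. indicator {0<..<min (f x / c) 1} l \<partial>lborel)"
      using c by (intro nn_integral_cong) (auto split: split_indicator simp: field_simps)
    also have "\<dots> = ennreal (min (f x / c) 1)" using f[of x] c by simp
    finally show "ennreal (min (f x / c) 1)
        = (\<integral>\<^sup>+l. indicator {0<..<1} l * indicator {x. l * c < f x} x \<partial>lborel)" ..
  qed
  also have "\<dots> = (\<integral>\<^sup>+l. (\<integral>\<^sup>+x. indicator {0<..<1} l * indicator {x. l * c < f x} x \<partial>lborel) \<partial>lborel)"
    by (rule lborel_pair.Fubini') measurable
  also have "\<dots> = (\<integral>\<^sup>+l\<in>{0<..<1}. emeasure lborel {x. l * c < f x} \<partial>lborel)"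
    by (intro nn_integral_cong) (auto simp: nn_integral_cmult mult.commute)
  finally show ?thesis .
qed

text \<open>\<open>F\<close> and \<open>G\<close> are first divided by their suprema
  \<open>a\<close> and \<open>b\<close>. Then for each level \<open>l\<close> below 1 both
  superlevel sets are nonempty, and their combination lies in the superlevel set of \<open>H\<close>
  at \<open>l * c\<close> with \<open>c = a powr \<theta> * b powr (1 - \<theta>)\<close>. The
  Brunn--Minkowski inequality integrated over \<open>l\<close> bounds the arithmetic mean of the
  normalised integrals, and Young's inequality passes to the geometric mean. Without normalisation
  one of the superlevel sets may be empty while the other has positive measure, and the set
  inequality would break down.\<close>

lemma prekopa_leindler_1d:
  fixes F G H :: "real \<Rightarrow> real"
  assumes [measurable]: "F \<in> borel_measurable borel" "G \<in> borel_measurable borel" "H \<in> borel_measurable borel"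
    and F: "\<And>u. 0 \<le> F u" "\<And>u. F u \<le> 1" "\<And>e. 0 < e \<Longrightarrow> bounded {u. e < F u}"
    and G: "\<And>u. 0 \<le> G u" "\<And>u. G u \<le> 1" "\<And>e. 0 < e \<Longrightarrow> bounded {u. e < G u}"
    and H: "\<And>u. 0 \<le> H u" and \<theta>: "0 < \<theta>" "\<theta> < 1"
    and FGH: "\<And>u v. F u powr \<theta> * G v powr (1 - \<theta>) \<le> H (\<theta> * u + (1 - \<theta>) * v)"
    and IF: "(\<integral>\<^sup>+u. ennreal (F u) \<partial>lborel) = ennreal IF" "0 \<le> IF"
    and IG: "(\<integral>\<^sup>+u. ennreal (G u) \<partial>lborel) = ennreal IG" "0 \<le> IG"
    and IH: "(\<integral>\<^sup>+u. ennreal (H u) \<partial>lborel) = ennreal IH" "0 \<le> IH"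
  shows "IF powr \<theta> * IG powr (1 - \<theta>) \<le> IH"
proof (cases "0 < IF \<and> 0 < IG")
  case False
  with IF IG IH show ?thesis by (auto simp: le_less)
next
  case True
  have pos: "0 < Sup (range f)" and le: "f u \<le> Sup (range f)"
    and int: "(\<integral>\<^sup>+l\<in>{0<..<1}. emeasure lborel {x. l * Sup (range f) < f x} \<partial>lborel) = ennreal (I / Sup (range f))"
    and ne: "\<And>l. l < 1 \<Longrightarrow> {x. l * Sup (range f) < f x} \<noteq> {}"
    if f: "f \<in> borel_measurable borel" "\<And>u. 0 \<le> f u" "\<And>u. f u \<le> 1" "(\<integral>\<^sup>+u. ennreal (f u) \<partial>lborel) = ennreal I" "0 < I"
    for f :: "real \<Rightarrow> real" and I u
  proof -
    have bdd: "bdd_above (range f)" using f(3) by (auto intro!: bdd_aboveI[of _ 1])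
    then show le: "f u \<le> Sup (range f)" for u by (intro cSup_upper) auto
    show pos: "0 < Sup (range f)"
    proof (rule ccontr)
      assume "\<not> 0 < Sup (range f)"
      then have "f u = 0" for u using le[of u] f(2)[of u] by linarith
      with f(4,5) show False by simp
    qed
    have [measurable]: "f \<in> borel_measurable borel" by (rule f(1))
    have "(\<integral>\<^sup>+l\<in>{0<..<1}. emeasure lborel {x. l * Sup (range f) < f x} \<partial>lborel)
        = (\<integral>\<^sup>+x. ennreal (min (f x / Sup (range f)) 1) \<partial>lborel)"
      by (rule layer_cake_min[symmetric]) (use f pos in auto)
    also have "\<dots> = (\<integral>\<^sup>+x. ennreal (f x) * ennreal (1 / Sup (range f)) \<partial>lborel)"
    proof (rule nn_integral_cong)
      fix x
      have "min (f x / Sup (range f)) 1 = f x * (1 / Sup (range f))" using le[of x] pos by (simp add: min_def field_simps)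
      then show "ennreal (min (f x / Sup (range f)) 1) = ennreal (f x) * ennreal (1 / Sup (range f))"
        using f(2)[of x] pos by (simp add: ennreal_mult[symmetric])
    qed
    also have "\<dots> = ennreal (I / Sup (range f))"
      using f(5) pos by (simp add: nn_integral_multc f(4) ennreal_mult[symmetric])
    finally show "(\<integral>\<^sup>+l\<in>{0<..<1}. emeasure lborel {x. l * Sup (range f) < f x} \<partial>lborel) = ennreal (I / Sup (range f))" .
    show "{x. l * Sup (range f) < f x} \<noteq> {}" if "l < 1" for l
    proof -
      have "l * Sup (range f) < Sup (range f)" using that pos by simp
      then obtain y where "y \<in> range f" "l * Sup (range f) < y"
        by (subst (asm) less_cSup_iff) (use bdd in auto)
      then show ?thesis by auto
    qed
  qed
  define a b where "a = Sup (range F)" and "b = Sup (range G)"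
  note Fa = pos[of F, OF _ F(1,2) IF(1)] le[of F, OF _ F(1,2) IF(1)] int[of F, OF _ F(1,2) IF(1)] ne[of F, OF _ F(1,2) IF(1)]
  note Gb = pos[of G, OF _ G(1,2) IG(1)] le[of G, OF _ G(1,2) IG(1)] int[of G, OF _ G(1,2) IG(1)] ne[of G, OF _ G(1,2) IG(1)]
  have ab: "0 < a" "0 < b" unfolding a_def b_def using Fa(1) Gb(1) True by auto
  define c where "c = a powr \<theta> * b powr (1 - \<theta>)"
  have c: "0 < c" using ab by (simp add: c_def)
  have "ennreal (\<theta> * (IF / a) + (1 - \<theta>) * (IG / b))
      = ennreal \<theta> * ennreal (IF / a) + ennreal (1 - \<theta>) * ennreal (IG / b)"
    using \<theta> ab True by (simp add: ennreal_mult[symmetric] del: times_divide_eq_right)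
  also have "\<dots> = ennreal \<theta> * (\<integral>\<^sup>+l\<in>{0<..<1}. emeasure lborel {x. l * a < F x} \<partial>lborel)
      + ennreal (1 - \<theta>) * (\<integral>\<^sup>+l\<in>{0<..<1}. emeasure lborel {x. l * b < G x} \<partial>lborel)"
    using Fa(3) Gb(3) True by (simp add: a_def b_def)
  also have "\<dots> = (\<integral>\<^sup>+l. ennreal \<theta> * (emeasure lborel {x. l * a < F x} * indicator {0<..<1} l)
      + ennreal (1 - \<theta>) * (emeasure lborel {x. l * b < G x} * indicator {0<..<1} l) \<partial>lborel)"
    by (subst nn_integral_add) (auto simp: nn_integral_cmult)
  also have "\<dots> \<le> (\<integral>\<^sup>+l\<in>{0<..<1}. emeasure lborel {x. l * c < H x} \<partial>lborel)"
  proof (rule nn_integral_mono)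
    fix l :: real
    show "ennreal \<theta> * (emeasure lborel {x. l * a < F x} * indicator {0<..<1} l)
      + ennreal (1 - \<theta>) * (emeasure lborel {x. l * b < G x} * indicator {0<..<1} l)
      \<le> emeasure lborel {x. l * c < H x} * indicator {0<..<1} l"
    proof (cases "l \<in> {0<..<1}")
      case l: True
      have "ennreal \<theta> * emeasure lborel {x. l * a < F x} + ennreal (1 - \<theta>) * emeasure lborel {x. l * b < G x}
          \<le> emeasure lborel {x. l * c < H x}"
      proof (rule brunn_minkowski_1d[OF _ _ _ _ _ _ _ \<theta>])
        fix u v assume u: "u \<in> {x. l * a < F x}" and v: "v \<in> {x. l * b < G x}"
        have "l * c = (l * a) powr \<theta> * (l * b) powr (1 - \<theta>)"
          using l ab by (simp add: c_def powr_mult powr_add[symmetric] mult_ac flip: mult.assoc)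
        also have "\<dots> < F u powr \<theta> * G v powr (1 - \<theta>)"
        proof -
          have "0 < l * a" "0 < l * b" using l ab by auto
          then show ?thesis using u v \<theta> by (intro mult_strict_mono powr_less_mono2) auto
        qed
        also have "\<dots> \<le> H (\<theta> * u + (1 - \<theta>) * v)" by (rule FGH)
        finally show "\<theta> * u + (1 - \<theta>) * v \<in> {x. l * c < H x}" by simp
      next
        show "{x. l * a < F x} \<noteq> {}" "{x. l * b < G x} \<noteq> {}"
          unfolding a_def b_def using Fa(4) Gb(4) True l by auto
        show "bounded {x. l * a < F x}" "bounded {x. l * b < G x}" using F(3) G(3) l ab by auto
      qed measurable
      then show ?thesis using l by simp
    qed simp
  qed
  also have "\<dots> = (\<integral>\<^sup>+x. ennreal (min (H x / c) 1) \<partial>lborel)"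
    by (rule layer_cake_min[symmetric]) (use H c in auto)
  also have "\<dots> \<le> (\<integral>\<^sup>+x. ennreal (H x) * ennreal (1 / c) \<partial>lborel)"
    using H c by (intro nn_integral_mono) (auto simp: ennreal_mult[symmetric] intro!: ennreal_leI)
  also have "\<dots> = ennreal (IH / c)"
    using IH c by (simp add: nn_integral_multc ennreal_mult[symmetric])
  finally have "\<theta> * (IF / a) + (1 - \<theta>) * (IG / b) \<le> IH / c"
    using IH c by (simp add: ennreal_le_iff)
  moreover have "(IF / a) powr \<theta> * (IG / b) powr (1 - \<theta>) \<le> \<theta> * (IF / a) + (1 - \<theta>) * (IG / b)"
    by (rule Youngs_inequality_0) (use \<theta> True ab in auto)
  moreover have "(IF / a) powr \<theta> * (IG / b) powr (1 - \<theta>) = IF powr \<theta> * IG powr (1 - \<theta>) / c"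
    using True ab by (simp add: powr_divide c_def)
  ultimately have "IF powr \<theta> * IG powr (1 - \<theta>) / c \<le> IH / c" by linarith
  then show ?thesis using c by (simp add: divide_le_cancel)
qed

section \<open>Log-concavity of exponential averages\<close>

lemma nn_integral_exp_layer:
  fixes \<nu> :: "'a measure" and \<kappa> :: "'a \<Rightarrow> real"
  assumes "prob_space \<nu>" and [measurable]: "\<kappa> \<in> borel_measurable \<nu>"
    and that: "\<And>z. 0 \<le> \<kappa> z"
  shows "(\<integral>\<^sup>+u. ennreal (exp (- u) * measure \<nu> {z\<in>space \<nu>. \<kappa> z \<le> u}) \<partial>lborel) = ennreal (\<integral>z. exp (- \<kappa> z) \<partial>\<nu>)"
proof -
  interpret prob_space \<nu> by fact
  interpret pair_sigma_finite lborel \<nu>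
    by (simp add: pair_sigma_finite_def lborel.sigma_finite_measure_axioms sigma_finite_measure_axioms)
  have "(\<integral>\<^sup>+u. ennreal (exp (- u) * measure \<nu> {z\<in>space \<nu>. \<kappa> z \<le> u}) \<partial>lborel)
      = (\<integral>\<^sup>+u. (\<integral>\<^sup>+z. ennreal (exp (- u)) * indicator {z\<in>space \<nu>. \<kappa> z \<le> u} z \<partial>\<nu>) \<partial>lborel)"
    by (intro nn_integral_cong) (simp add: nn_integral_cmult emeasure_eq_measure ennreal_mult)
  also have "\<dots> = (\<integral>\<^sup>+u. (\<integral>\<^sup>+z. ennreal (exp (- u)) * (if \<kappa> z \<le> u then 1 else 0) \<partial>\<nu>) \<partial>lborel)"
    by (intro nn_integral_cong) (auto split: split_indicator)
  also have "\<dots> = (\<integral>\<^sup>+z. (\<integral>\<^sup>+u. ennreal (exp (- u)) * (if \<kappa> z \<le> u then 1 else 0) \<partial>lborel) \<partial>\<nu>)"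
    by (rule Fubini'[symmetric]) measurable
  also have "\<dots> = (\<integral>\<^sup>+z. ennreal (exp (- \<kappa> z)) \<partial>\<nu>)"
  proof (rule nn_integral_cong)
    fix z
    have "(\<integral>\<^sup>+u. ennreal (exp (- u)) * (if \<kappa> z \<le> u then 1 else 0) \<partial>lborel)
        = (\<integral>\<^sup>+u. ennreal (exp (- u)) * indicator {\<kappa> z..} u \<partial>lborel)"
      by (intro nn_integral_cong) (auto split: split_indicator)
    also have "\<dots> = ennreal (0 - (- exp (- \<kappa> z)))"
    proof (rule nn_integral_FTC_atLeast)
      have "((\<lambda>u::real. exp (- u)) \<longlongrightarrow> 0) at_top"
        by (intro filterlim_compose[OF exp_at_bot]) (simp add: filterlim_uminus_at_bot_at_top)
      then show "((\<lambda>u::real. - exp (- u)) \<longlongrightarrow> 0) at_top" using tendsto_minus by force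
    qed (auto intro!: derivative_eq_intros)
    finally show "(\<integral>\<^sup>+u. ennreal (exp (- u)) * (if \<kappa> z \<le> u then 1 else 0) \<partial>lborel) = ennreal (exp (- \<kappa> z))" by simp
  qed
  also have "\<dots> = ennreal (\<integral>z. exp (- \<kappa> z) \<partial>\<nu>)"
    by (intro nn_integral_eq_integral integrable_const_bound[of _ 1]) (use that in auto)
  finally show ?thesis .
qed

text \<open>Because exp (- \<kappa>) is the integral of exp (- u) over u \<ge> \<kappa>, each
  average is the integral over the line of exp (- u) times the mass of the sublevel set at
  \<open>u\<close>. Convexity in the form \<open>conv\<close> puts the combination of two sublevel
  sets inside the third one, so log-concavity of \<nu> on compact sets is the hypothesis of the
  one-dimensional inequality. No density of \<nu> is involved, which admits laws on a
  subspace.\<close>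

lemma log_concave_exp_average:
  fixes \<nu> :: "(real ^ 'd) measure"
  assumes \<nu>: "prob_space \<nu>" "sets \<nu> = sets borel" "log_concave_measure \<nu>"
    and \<theta>: "0 < \<theta>" "\<theta> < 1"
    and nn: "\<And>z. 0 \<le> \<kappa>1 z" "\<And>z. 0 \<le> \<kappa>2 z" "\<And>z. 0 \<le> \<kappa>3 z"
    and comp: "\<And>u. compact {z. \<kappa>1 z \<le> u}" "\<And>u. compact {z. \<kappa>2 z \<le> u}"
    and [measurable]: "\<kappa>1 \<in> borel_measurable borel" "\<kappa>2 \<in> borel_measurable borel" "\<kappa>3 \<in> borel_measurable borel"
    and conv: "\<And>x y. \<kappa>3 (\<theta> *\<^sub>R x + (1 - \<theta>) *\<^sub>R y) \<le> \<theta> * \<kappa>1 x + (1 - \<theta>) * \<kappa>2 y"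
  shows "(\<integral>z. exp (- \<kappa>1 z) \<partial>\<nu>) powr \<theta> * (\<integral>z. exp (- \<kappa>2 z) \<partial>\<nu>) powr (1 - \<theta>) \<le> (\<integral>z. exp (- \<kappa>3 z) \<partial>\<nu>)"
proof -
  interpret prob_space \<nu> by fact
  have sp: "space \<nu> = UNIV" using sets_eq_imp_space_eq[OF \<nu>(2)] by simp
  note [measurable_cong] = \<nu>(2)
  define F where "F = (\<lambda>\<kappa> u. exp (- u) * measure \<nu> {z. \<kappa> z \<le> (u::real)})"
  have meas: "F \<kappa> \<in> borel_measurable borel" if [measurable]: "\<kappa> \<in> borel_measurable borel" for \<kappa>
  proof -
    have "mono (\<lambda>u. measure \<nu> {z. \<kappa> z \<le> (u::real)})"
      by (intro monoI finite_measure_mono) (auto simp: \<nu>(2))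
    then have [measurable]: "(\<lambda>u. measure \<nu> {z. \<kappa> z \<le> (u::real)}) \<in> borel_measurable borel"
      by (rule borel_measurable_mono)
    show ?thesis unfolding F_def by measurable
  qed
  have F0: "0 \<le> F \<kappa> u" for \<kappa> u by (simp add: F_def)
  have Fneg: "F \<kappa> u = 0" if "\<And>z. 0 \<le> \<kappa> z" "u < 0" for \<kappa> u
  proof -
    have "{z. \<kappa> z \<le> u} = {}" using that by (auto simp: not_le intro: less_le_trans)
    then show ?thesis by (simp add: F_def)
  qed
  have Fexp: "F \<kappa> u \<le> exp (- u)" for \<kappa> u
    unfolding F_def by (rule mult_left_le) auto
  have F1: "F \<kappa> u \<le> 1" if "\<And>z. 0 \<le> \<kappa> z" for \<kappa> u
    using Fneg[of \<kappa> u] Fexp[of \<kappa> u] that by (cases "u < 0") (auto intro: order_trans)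
  have Fb: "bounded {u. e < F \<kappa> u}" if "\<And>z. 0 \<le> \<kappa> z" "0 < e" for \<kappa> e
  proof (rule bounded_subset[of "{0..- ln e}"])
    show "{u. e < F \<kappa> u} \<subseteq> {0..- ln e}"
    proof
      fix u assume u: "u \<in> {u. e < F \<kappa> u}"
      then have "0 \<le> u" using Fneg[of \<kappa> u] that by force
      moreover have "e < exp (- u)" using u Fexp[of \<kappa> u] by auto
      then have "ln e < - u" using that(2) by (metis exp_less_cancel_iff exp_ln)
      ultimately show "u \<in> {0..- ln e}" by auto
    qed
  qed auto
  have int: "(\<integral>\<^sup>+u. ennreal (F \<kappa> u) \<partial>lborel) = ennreal (\<integral>z. exp (- \<kappa> z) \<partial>\<nu>)"
    if [measurable]: "\<kappa> \<in> borel_measurable borel" and "\<And>z. 0 \<le> \<kappa> z" for \<kappa>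
    using nn_integral_exp_layer[OF \<nu>(1), of \<kappa>] that(2) by (simp add: F_def sp)
  have pos: "0 \<le> (\<integral>z. exp (- \<kappa> z) \<partial>\<nu>)" for \<kappa> :: "real ^ 'd \<Rightarrow> real" by (rule integral_nonneg_AE) simp
  show ?thesis
  proof (rule prekopa_leindler_1d[OF meas[of \<kappa>1] meas[of \<kappa>2] meas[of \<kappa>3] F0 F1 Fb F0 F1 Fb F0 \<theta> _ int pos int pos int pos])
    fix u v :: real
    let ?A = "{z. \<kappa>1 z \<le> u}" and ?B = "{z. \<kappa>2 z \<le> v}" and ?S = "{z. \<kappa>3 z \<le> \<theta> * u + (1 - \<theta>) * v}"
    show "F \<kappa>1 u powr \<theta> * F \<kappa>2 v powr (1 - \<theta>) \<le> F \<kappa>3 (\<theta> * u + (1 - \<theta>) * v)"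
    \<comment> \<open>Log-concavity is stated for nonempty sets; on an empty sublevel set
      \<open>F\<close> vanishes, and 0 to a power is 0.\<close>
    proof (cases "?A = {} \<or> ?B = {}")
      case True
      then show ?thesis using F0 by (auto simp: F_def)
    next
      case False
      have "measure \<nu> ?A powr \<theta> * measure \<nu> ?B powr (1 - \<theta>)
          \<le> measure \<nu> {\<theta> *\<^sub>R x + (1 - \<theta>) *\<^sub>R y | x y. x \<in> ?A \<and> y \<in> ?B}"
      proof -
        have "\<theta> \<in> {0..1}" "?A \<noteq> {}" "?B \<noteq> {}" using \<theta> False by auto
        then show ?thesis
          using \<nu>(3)[unfolded log_concave_measure_def, rule_format, of \<theta> ?A ?B] comp(1)[of u] comp(2)[of v] by blast
      qed
      also have "\<dots> \<le> measure \<nu> ?S"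
      proof (rule finite_measure_mono)
        show "{\<theta> *\<^sub>R x + (1 - \<theta>) *\<^sub>R y | x y. x \<in> ?A \<and> y \<in> ?B} \<subseteq> ?S"
        proof
          fix z assume "z \<in> {\<theta> *\<^sub>R x + (1 - \<theta>) *\<^sub>R y | x y. x \<in> ?A \<and> y \<in> ?B}"
          then obtain x y where z: "z = \<theta> *\<^sub>R x + (1 - \<theta>) *\<^sub>R y" "\<kappa>1 x \<le> u" "\<kappa>2 y \<le> v" by auto
          have "\<theta> * \<kappa>1 x + (1 - \<theta>) * \<kappa>2 y \<le> \<theta> * u + (1 - \<theta>) * v"
            using z \<theta> by (intro add_mono mult_left_mono) auto
          then show "z \<in> ?S" using conv[of x y] z(1) by simp
        qed
        show "?S \<in> sets \<nu>" unfolding \<nu>(2) by measurable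
      qed
      finally have "exp (- (\<theta> * u + (1 - \<theta>) * v)) * (measure \<nu> ?A powr \<theta> * measure \<nu> ?B powr (1 - \<theta>))
          \<le> exp (- (\<theta> * u + (1 - \<theta>) * v)) * measure \<nu> ?S"
        by (intro mult_left_mono) auto
      moreover have "exp (- (\<theta> * u + (1 - \<theta>) * v)) = exp (- u) powr \<theta> * exp (- v) powr (1 - \<theta>)"
        by (simp add: powr_def exp_add[symmetric] algebra_simps)
      ultimately show ?thesis by (simp add: F_def powr_mult mult_ac)
    qed
  qed (use nn in auto)
qed

lemma (in prob_space) has_real_derivative_integral:
  fixes f f' :: "real \<Rightarrow> 'a \<Rightarrow> real"
  assumes [measurable]: "\<And>t. f t \<in> borel_measurable M" "f' t0 \<in> borel_measurable M"
    and int: "\<And>t. integrable M (f t)"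
    and der: "\<And>t z. z \<in> space M \<Longrightarrow> ((\<lambda>t. f t z) has_real_derivative f' t z) (at t)"
    and bnd: "\<And>t z. z \<in> space M \<Longrightarrow> \<bar>f' t z\<bar> \<le> D"
  shows "((\<lambda>t. \<integral>z. f t z \<partial>M) has_real_derivative (\<integral>z. f' t0 z \<partial>M)) (at t0)"
  unfolding has_field_derivative_iff tendsto_at_iff_sequentially comp_def
proof (intro allI impI)
  fix X :: "nat \<Rightarrow> real" assume X: "\<forall>i. X i \<in> UNIV - {t0}" "X \<longlonglongrightarrow> t0"
  have "(\<lambda>i. \<integral>z. (f (X i) z - f t0 z) / (X i - t0) \<partial>M) \<longlonglongrightarrow> (\<integral>z. f' t0 z \<partial>M)"
  proof (rule integral_dominated_convergence[where w = "\<lambda>_. D"])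
    show "AE z in M. (\<lambda>i. (f (X i) z - f t0 z) / (X i - t0)) \<longlonglongrightarrow> f' t0 z"
      using der[of _ t0] X unfolding has_field_derivative_iff tendsto_at_iff_sequentially comp_def
      by (intro AE_I2) blast
    fix i
    show "AE z in M. norm ((f (X i) z - f t0 z) / (X i - t0)) \<le> D"
    proof (rule AE_I2)
      fix z assume z: "z \<in> space M"
      have "norm (f (X i) z - f t0 z) \<le> D * norm (X i - t0)"
        by (rule field_differentiable_bound[of UNIV "\<lambda>t. f t z" "\<lambda>t. f' t z"]) (use der bnd z in auto)
      then show "norm ((f (X i) z - f t0 z) / (X i - t0)) \<le> D"
        using X(1) by (simp add: norm_divide divide_le_eq)
    qed
  qed auto
  then show "(\<lambda>i. ((\<integral>z. f (X i) z \<partial>M) - (\<integral>z. f t0 z \<partial>M)) / (X i - t0)) \<longlonglongrightarrow> (\<integral>z. f' t0 z \<partial>M)"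
    using int by simp
qed

section \<open>Smoothed densities\<close>

text \<open>
  A smooth substitute for \<open>\<bar>N u\<bar>\<close>: it keeps the smoothed density logarithmically Lipschitz and makes it differentiable.
\<close>

definition soft_abs :: "real \<Rightarrow> real \<Rightarrow> real" where
  "soft_abs N u = sqrt (1 + (N * u)\<^sup>2)"

definition soft_sgn :: "real \<Rightarrow> real \<Rightarrow> real" where
  "soft_sgn N u = N * (N * u) / sqrt (1 + (N * u)\<^sup>2)"

lemma soft_abs_pos: "0 < 1 + (N * u)\<^sup>2" for N u :: real
  by (rule add_pos_nonneg) simp_all

lemma soft_abs_nonneg: "0 \<le> soft_abs N u"
  by (simp add: soft_abs_def)

lemma soft_abs_ge: "\<bar>N * u\<bar> \<le> soft_abs N u"
  unfolding soft_abs_def by (rule real_le_rsqrt) (unfold power2_abs, simp)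

lemma soft_abs_minus: "soft_abs N (- u) = soft_abs N u"
  by (simp add: soft_abs_def)

lemma has_real_derivative_soft_abs:
  "(soft_abs N has_real_derivative soft_sgn N u) (at u)"
proof -
  have "((\<lambda>u. 1 + (N * u)\<^sup>2) has_real_derivative (2 * (N * u) * N)) (at u)"
    by (auto intro!: derivative_eq_intros)
  from DERIV_chain2[OF DERIV_real_sqrt[OF soft_abs_pos] this]
  have "(soft_abs N has_real_derivative inverse (sqrt (1 + (N * u)\<^sup>2)) / 2 * (2 * (N * u) * N)) (at u)"
    unfolding soft_abs_def[abs_def] .
  moreover have "inverse (sqrt (1 + (N * u)\<^sup>2)) / 2 * (2 * (N * u) * N) = soft_sgn N u"
    unfolding soft_sgn_def divide_inverse by simp
  ultimately show ?thesis by simp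
qed

lemma soft_sgn_bound: "\<bar>soft_sgn N u\<bar> \<le> \<bar>N\<bar>"
proof -
  have s: "0 < sqrt (1 + (N * u)\<^sup>2)" using soft_abs_pos by simp
  have "\<bar>N\<bar> * \<bar>N * u\<bar> \<le> \<bar>N\<bar> * sqrt (1 + (N * u)\<^sup>2)"
    using soft_abs_ge[of N u] by (intro mult_left_mono) (auto simp: soft_abs_def)
  then show ?thesis using s by (simp add: soft_sgn_def abs_mult divide_le_eq)
qed

lemma soft_abs_lipschitz: "\<bar>soft_abs N u - soft_abs N w\<bar> \<le> \<bar>N\<bar> * \<bar>u - w\<bar>"
proof -
  have "norm (soft_abs N u - soft_abs N w) \<le> \<bar>N\<bar> * norm (u - w)"
  proof (rule field_differentiable_bound[of UNIV])
    show "(soft_abs N has_real_derivative soft_sgn N z) (at z within UNIV)" for z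
      by (rule has_real_derivative_soft_abs)
    show "norm (soft_sgn N z) \<le> \<bar>N\<bar>" for z by (simp add: soft_sgn_bound)
  qed auto
  then show ?thesis by simp
qed

text \<open>\<open>soft_abs N u\<close> is the modulus of the complex number 1 + i N u, which is
  affine in \<open>u\<close>; convexity is the triangle inequality.\<close>

lemma soft_abs_convex:
  assumes "0 \<le> \<theta>" "\<theta> \<le> 1"
  shows "soft_abs N (\<theta> * u + (1 - \<theta>) * w) \<le> \<theta> * soft_abs N u + (1 - \<theta>) * soft_abs N w"
proof -
  have e: "soft_abs N x = cmod (Complex 1 (N * x))" for x
    by (simp add: soft_abs_def cmod_def)
  have "Complex 1 (N * (\<theta> * u + (1 - \<theta>) * w)) = \<theta> *\<^sub>R Complex 1 (N * u) + (1 - \<theta>) *\<^sub>R Complex 1 (N * w)"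
    by (simp add: complex_eq_iff algebra_simps)
  then have "soft_abs N (\<theta> * u + (1 - \<theta>) * w) \<le> cmod (\<theta> *\<^sub>R Complex 1 (N * u)) + cmod ((1 - \<theta>) *\<^sub>R Complex 1 (N * w))"
    unfolding e by (metis norm_triangle_ineq)
  then show ?thesis using assms by (simp add: e)
qed

lemma measurable_soft_abs[measurable]: "soft_abs N \<in> borel_measurable borel"
  unfolding soft_abs_def[abs_def] by measurable

lemma measurable_soft_sgn[measurable]: "soft_sgn N \<in> borel_measurable borel"
  unfolding soft_sgn_def[abs_def] by measurable

section \<open>Smoothing of an unconditional log-concave law\<close>

lemma measurable_vec_nth: "(\<lambda>z::real ^ 'd. z $ i) \<in> borel_measurable borel"
  by (intro borel_measurable_continuous_onI continuous_intros)

text \<open>\<open>1 / N\<close> is the width of the smoothing and \<delta> the rate of the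
  exponential weight. Both are fixed here; they tend to 0 together at the end.\<close>

locale smoothed_measure = prob_space \<nu> for \<nu> :: "(real ^ 'd) measure" +
  fixes N \<delta> :: real
  assumes sets_eq: "sets \<nu> = sets borel" and lc: "log_concave_measure \<nu>"
    and sym: "\<And>e :: real ^ 'd. (\<And>i. e $ i \<in> {-1, 1}) \<Longrightarrow> distr \<nu> borel (\<lambda>z. \<chi> i. e $ i * z $ i) = \<nu>"
    and N: "0 < N" and \<delta>: "0 < \<delta>"
begin

definition kern :: "('d \<Rightarrow> real) \<Rightarrow> real ^ 'd \<Rightarrow> real" where
  "kern y z = (\<Sum>i\<in>UNIV. soft_abs N (y i - z $ i))"

text \<open>The convolution of \<nu> with a kernel that is not normalised: its mass is a constant
  times \<open>N\<close> to the power minus the dimension, and this factor is restored in the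
  limit.\<close>

definition q :: "('d \<Rightarrow> real) \<Rightarrow> real" where
  "q y = (\<integral>z. exp (- kern y z) \<partial>\<nu>)"

text \<open>Minus the partial derivative of \<open>q\<close> in direction \<open>j\<close>, a sign
  chosen to make it nonnegative on the orthant. \<open>ddens\<close> follows the same convention for
  \<open>dens\<close>.\<close>

definition dq :: "'d \<Rightarrow> ('d \<Rightarrow> real) \<Rightarrow> real" where
  "dq j y = (\<integral>z. soft_sgn N (y j - z $ j) * exp (- kern y z) \<partial>\<nu>)"

text \<open>The weight gives the pointwise decay that \<open>admissible\<close> asks for without any
  appeal to the tails of \<nu>, and being log-linear it preserves log-concavity.\<close>

definition dens :: "('d \<Rightarrow> real) \<Rightarrow> real" where
  "dens y = q y * exp (- (\<delta> * (\<Sum>i\<in>UNIV. y i)))"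

definition ddens :: "'d \<Rightarrow> ('d \<Rightarrow> real) \<Rightarrow> real" where
  "ddens j y = (dq j y + \<delta> * q y) * exp (- (\<delta> * (\<Sum>i\<in>UNIV. y i)))"

lemma space_eq: "space \<nu> = UNIV"
  using sets_eq_imp_space_eq[OF sets_eq] by simp

declare sets_eq[measurable_cong]

lemma measurable_nth[measurable]: "(\<lambda>z. z $ i) \<in> borel_measurable \<nu>"
  unfolding measurable_cong_sets[OF sets_eq refl] by (rule measurable_vec_nth)

lemma measurable_diff_nth:
  assumes "Y \<in> borel_measurable M'"
  shows "(\<lambda>p. Y (fst p) - snd p $ i) \<in> borel_measurable (M' \<Otimes>\<^sub>M \<nu>)"
  by (rule borel_measurable_diff[OF measurable_compose[OF measurable_fst assms] measurable_compose[OF measurable_snd measurable_nth]])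

lemma measurable_kern:
  assumes "\<And>i. Y i \<in> borel_measurable M'"
  shows "(\<lambda>p. kern (\<lambda>i. Y i (fst p)) (snd p)) \<in> borel_measurable (M' \<Otimes>\<^sub>M \<nu>)"
  unfolding kern_def
  by (intro borel_measurable_sum measurable_compose[OF _ measurable_soft_abs] measurable_diff_nth assms)

lemma measurable_kern1[measurable]: "kern y \<in> borel_measurable \<nu>"
  unfolding kern_def by measurable

lemma measurable_q:
  assumes "\<And>i. Y i \<in> borel_measurable M'"
  shows "(\<lambda>x. q (\<lambda>i. Y i x)) \<in> borel_measurable M'"
  unfolding q_def
proof (rule borel_measurable_lebesgue_integral)
  show "(\<lambda>(x, z). exp (- kern (\<lambda>i. Y i x) z)) \<in> borel_measurable (M' \<Otimes>\<^sub>M \<nu>)"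
    unfolding case_prod_beta'
    by (intro measurable_compose[OF _ borel_measurable_exp] borel_measurable_uminus measurable_kern assms)
qed

lemma measurable_dq:
  assumes "\<And>i. Y i \<in> borel_measurable M'"
  shows "(\<lambda>x. dq j (\<lambda>i. Y i x)) \<in> borel_measurable M'"
  unfolding dq_def
proof (rule borel_measurable_lebesgue_integral)
  show "(\<lambda>(x, z). soft_sgn N (Y j x - z $ j) * exp (- kern (\<lambda>i. Y i x) z)) \<in> borel_measurable (M' \<Otimes>\<^sub>M \<nu>)"
    unfolding case_prod_beta'
    by (intro borel_measurable_times measurable_compose[OF measurable_diff_nth measurable_soft_sgn]
        measurable_compose[OF _ borel_measurable_exp] borel_measurable_uminus measurable_kern assms)
qed

lemma kern_nonneg: "0 \<le> kern y z"
  unfolding kern_def by (intro sum_nonneg soft_abs_nonneg)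

lemma integrable_exp_kern: "integrable \<nu> (\<lambda>z. exp (- kern y z))"
  by (rule integrable_const_bound[of _ 1]) (auto simp: kern_nonneg)

lemma integrable_dq: "integrable \<nu> (\<lambda>z. soft_sgn N (y j - z $ j) * exp (- kern y z))"
proof (rule integrable_const_bound[of _ N])
  show "AE z in \<nu>. norm (soft_sgn N (y j - z $ j) * exp (- kern y z)) \<le> N"
  proof (rule AE_I2)
    fix z
    have "\<bar>soft_sgn N (y j - z $ j)\<bar> * exp (- kern y z) \<le> N * 1"
      using soft_sgn_bound[of N] N kern_nonneg by (intro mult_mono) auto
    then show "norm (soft_sgn N (y j - z $ j) * exp (- kern y z)) \<le> N" by (simp add: abs_mult)
  qed
qed measurable

lemma q_pos: "0 < q y"
  unfolding q_def
  by (rule integral_pos[OF integrable_exp_kern]) (auto simp: emeasure_space_1)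

lemma q_le_1: "q y \<le> 1"
proof -
  have "q y \<le> (\<integral>z. 1 \<partial>\<nu>)"
    unfolding q_def by (rule integral_mono[OF integrable_exp_kern]) (auto simp: kern_nonneg)
  then show ?thesis by (simp add: prob_space)
qed

lemma dq_bound: "dq j y \<le> N * q y"
  unfolding dq_def q_def integral_mult_right_zero[symmetric]
proof (rule integral_mono[OF integrable_dq integrable_mult_right[OF integrable_exp_kern]])
  fix z
  show "soft_sgn N (y j - z $ j) * exp (- kern y z) \<le> N * exp (- kern y z)"
    using soft_sgn_bound[of N "y j - z $ j"] N by (intro mult_right_mono) auto
qed

lemma q_lipschitz: "q y \<le> exp (N * \<bar>y j - s\<bar>) * q (y(j := s))"
  unfolding q_def integral_mult_right_zero[symmetric]
proof (rule integral_mono[OF integrable_exp_kern integrable_mult_right[OF integrable_exp_kern]])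
  fix z
  have *: "kern x z = soft_abs N (x j - z $ j) + (\<Sum>i\<in>UNIV - {j}. soft_abs N (x i - z $ i))" for x
    unfolding kern_def by (subst sum.remove[of _ j]) auto
  have "(\<Sum>i\<in>UNIV - {j}. soft_abs N ((y(j := s)) i - z $ i)) = (\<Sum>i\<in>UNIV - {j}. soft_abs N (y i - z $ i))"
    by (intro sum.cong) auto
  then have "kern (y(j := s)) z - kern y z = soft_abs N (s - z $ j) - soft_abs N (y j - z $ j)"
    using *[of y] *[of "y(j := s)"] by simp
  also have "\<dots> \<le> N * \<bar>y j - s\<bar>"
    using soft_abs_lipschitz[of N "s - z $ j" "y j - z $ j"] N by (simp add: abs_minus_commute)
  finally show "exp (- kern y z) \<le> exp (N * \<bar>y j - s\<bar>) * exp (- kern (y(j := s)) z)"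
    by (simp add: exp_add[symmetric])
qed

lemma q_derivative:
  "((\<lambda>t. q (\<lambda>i. y i + t * h i)) has_real_derivative - (\<Sum>i\<in>UNIV. h i * dq i (\<lambda>i. y i + t * h i))) (at t)"
proof -
  define f' where "f' = (\<lambda>t z. - (\<Sum>i\<in>UNIV. h i * soft_sgn N (y i + t * h i - z $ i)) * exp (- kern (\<lambda>i. y i + t * h i) z))"
  have "((\<lambda>t. \<integral>z. exp (- kern (\<lambda>i. y i + t * h i) z) \<partial>\<nu>) has_real_derivative (\<integral>z. f' t z \<partial>\<nu>)) (at t)"
  proof (rule has_real_derivative_integral[where D = "\<Sum>i\<in>UNIV. \<bar>h i\<bar> * N"])
    show "f' t \<in> borel_measurable \<nu>" unfolding f'_def by measurable
    show "integrable \<nu> (\<lambda>z. exp (- kern (\<lambda>i. y i + t * h i) z))" for t by (rule integrable_exp_kern)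
    fix t z
    have "((\<lambda>t. soft_abs N (y i + t * h i - z $ i)) has_real_derivative (soft_sgn N (y i + t * h i - z $ i) * h i)) (at t)" for i
      by (rule DERIV_chain2[OF has_real_derivative_soft_abs]) (auto intro!: derivative_eq_intros)
    then have "((\<lambda>t. kern (\<lambda>i. y i + t * h i) z) has_real_derivative (\<Sum>i\<in>UNIV. soft_sgn N (y i + t * h i - z $ i) * h i)) (at t)"
      unfolding kern_def by (intro DERIV_sum)
    then have "((\<lambda>t. exp (- kern (\<lambda>i. y i + t * h i) z)) has_real_derivative
        (exp (- kern (\<lambda>i. y i + t * h i) z) * - (\<Sum>i\<in>UNIV. soft_sgn N (y i + t * h i - z $ i) * h i))) (at t)"
      by (intro DERIV_chain2[OF DERIV_exp] DERIV_minus)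
    then show "((\<lambda>t. exp (- kern (\<lambda>i. y i + t * h i) z)) has_real_derivative f' t z) (at t)"
      by (simp add: f'_def mult_ac)
    have "\<bar>f' t z\<bar> = \<bar>\<Sum>i\<in>UNIV. h i * soft_sgn N (y i + t * h i - z $ i)\<bar> * exp (- kern (\<lambda>i. y i + t * h i) z)"
      by (simp add: f'_def abs_mult)
    also have "\<dots> \<le> (\<Sum>i\<in>UNIV. \<bar>h i * soft_sgn N (y i + t * h i - z $ i)\<bar>) * 1"
      by (intro mult_mono sum_abs) (auto simp: kern_nonneg sum_nonneg)
    also have "\<dots> \<le> (\<Sum>i\<in>UNIV. \<bar>h i\<bar> * N)"
      using soft_sgn_bound[of N] N by (auto simp: abs_mult intro!: sum_mono mult_left_mono)
    finally show "\<bar>f' t z\<bar> \<le> (\<Sum>i\<in>UNIV. \<bar>h i\<bar> * N)" .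
  qed measurable
  then have der: "((\<lambda>t. q (\<lambda>i. y i + t * h i)) has_real_derivative (\<integral>z. f' t z \<partial>\<nu>)) (at t)"
    unfolding q_def .
  have eq: "(\<integral>z. f' t z \<partial>\<nu>) = - (\<Sum>i\<in>UNIV. h i * dq i (\<lambda>i. y i + t * h i))"
  proof -
    have "f' t z = - (\<Sum>i\<in>UNIV. h i * (soft_sgn N (y i + t * h i - z $ i) * exp (- kern (\<lambda>i. y i + t * h i) z)))" for z
      by (simp add: f'_def sum_distrib_left mult_ac)
    moreover have "(\<integral>z. (\<Sum>i\<in>UNIV. h i * (soft_sgn N (y i + t * h i - z $ i) * exp (- kern (\<lambda>i. y i + t * h i) z))) \<partial>\<nu>)
        = (\<Sum>i\<in>UNIV. h i * dq i (\<lambda>i. y i + t * h i))"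
      unfolding dq_def using integrable_dq[of "\<lambda>i. y i + t * h i"]
      by (subst Bochner_Integration.integral_sum) auto
    ultimately show ?thesis by (simp only: integral_minus)
  qed
  show ?thesis using der unfolding eq .
qed

lemma kern_continuous: "continuous_on UNIV (kern y)"
proof -
  have "continuous_on UNIV (\<lambda>z::real ^ 'd. soft_abs N (y i - z $ i))" for i
    unfolding soft_abs_def
    by (intro continuous_on_real_sqrt continuous_on_add continuous_on_power continuous_on_mult continuous_on_diff
        continuous_on_const continuous_on_component continuous_on_id)
  then show ?thesis
    unfolding kern_def[abs_def] by (rule continuous_on_sum)
qed

lemma compact_kern: "compact {z. kern y z \<le> u}"
  unfolding compact_eq_bounded_closed
proof
  show "closed {z. kern y z \<le> u}"
    by (intro closed_Collect_le kern_continuous continuous_on_const)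
  show "bounded {z. kern y z \<le> u}"
    unfolding bounded_iff
  proof (intro exI ballI)
    fix z assume z: "z \<in> {z. kern y z \<le> u}"
    have "\<bar>z $ i\<bar> \<le> \<bar>y i\<bar> + u / N" for i
    proof -
      have "N * \<bar>y i - z $ i\<bar> \<le> soft_abs N (y i - z $ i)" using soft_abs_ge[of N "y i - z $ i"] N by (simp add: abs_mult)
      also have "\<dots> \<le> kern y z" unfolding kern_def
        by (rule member_le_sum[of i UNIV "\<lambda>i. soft_abs N (y i - z $ i)"]) (simp_all add: soft_abs_nonneg)
      also have "\<dots> \<le> u" using z by simp
      finally have "\<bar>y i - z $ i\<bar> \<le> u / N" using N by (simp add: pos_le_divide_eq mult.commute)
      then show ?thesis by linarith
    qed
    then have "(\<Sum>i\<in>UNIV. \<bar>z $ i\<bar>) \<le> (\<Sum>i\<in>UNIV. \<bar>y i\<bar> + u / N)" by (rule sum_mono)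
    then show "norm z \<le> (\<Sum>i\<in>UNIV. \<bar>y i\<bar> + u / N)" using norm_le_l1_cart[of z] by linarith
  qed
qed

text \<open>The kernel exponent depends on y - z through a convex function, so it is jointly convex
  in \<open>y\<close> and \<open>z\<close>; this is what \<open>log_concave_exp_average\<close>
  needs.\<close>

lemma q_log_concave:
  assumes \<theta>: "0 < \<theta>" "\<theta> < 1"
  shows "\<theta> * ln (q x) + (1 - \<theta>) * ln (q y) \<le> ln (q (\<lambda>i. \<theta> * x i + (1 - \<theta>) * y i))"
proof -
  have [measurable]: "kern u \<in> borel_measurable borel" for u
    using kern_continuous by (rule borel_measurable_continuous_onI)
  have "q x powr \<theta> * q y powr (1 - \<theta>) \<le> q (\<lambda>i. \<theta> * x i + (1 - \<theta>) * y i)"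
    unfolding q_def
  proof (rule log_concave_exp_average[OF prob_space_axioms sets_eq lc \<theta> kern_nonneg kern_nonneg kern_nonneg compact_kern compact_kern])
    fix z w :: "real ^ 'd"
    have "kern (\<lambda>i. \<theta> * x i + (1 - \<theta>) * y i) (\<theta> *\<^sub>R z + (1 - \<theta>) *\<^sub>R w)
        = (\<Sum>i\<in>UNIV. soft_abs N (\<theta> * (x i - z $ i) + (1 - \<theta>) * (y i - w $ i)))"
      unfolding kern_def by (intro sum.cong refl arg_cong[of _ _ "soft_abs N"]) (simp add: algebra_simps)
    also have "\<dots> \<le> (\<Sum>i\<in>UNIV. \<theta> * soft_abs N (x i - z $ i) + (1 - \<theta>) * soft_abs N (y i - w $ i))"
      using \<theta> by (intro sum_mono soft_abs_convex) auto
    also have "\<dots> = \<theta> * kern x z + (1 - \<theta>) * kern y w"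
      by (simp add: kern_def sum.distrib sum_distrib_left)
    finally show "kern (\<lambda>i. \<theta> * x i + (1 - \<theta>) * y i) (\<theta> *\<^sub>R z + (1 - \<theta>) *\<^sub>R w) \<le> \<theta> * kern x z + (1 - \<theta>) * kern y w" .
  qed measurable
  then have "ln (q x powr \<theta> * q y powr (1 - \<theta>)) \<le> ln (q (\<lambda>i. \<theta> * x i + (1 - \<theta>) * y i))"
  proof (subst ln_le_cancel_iff)
    show "0 < q x powr \<theta> * q y powr (1 - \<theta>)" using q_pos[of x] q_pos[of y] by (intro mult_pos_pos) simp_all
  qed (rule q_pos)
  then show ?thesis using q_pos[of x] q_pos[of y] by (simp add: ln_mult ln_powr)
qed

text \<open>Along the segment from \<open>x\<close> to \<open>y\<close> concavity of
  \<open>ln q\<close> keeps the difference quotient at \<open>x\<close> above the full increment;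
  the limit at \<open>x\<close> is the directional derivative.\<close>

lemma q_tangent: "ln (q y) \<le> ln (q x) - (\<Sum>i\<in>UNIV. dq i x / q x * (y i - x i))"
proof -
  let ?p = "\<lambda>t i. x i + t * (y i - x i)"
  let ?D = "- (\<Sum>i\<in>UNIV. dq i x / q x * (y i - x i))"
  have "((\<lambda>t. ln (q (?p t))) has_real_derivative (1 / q (?p 0) * (- (\<Sum>i\<in>UNIV. (y i - x i) * dq i (?p 0))))) (at 0)"
    by (rule DERIV_chain2[where g = "\<lambda>t. q (?p t)", OF DERIV_ln_divide[OF q_pos] q_derivative])
  then have "((\<lambda>t. ln (q (?p t))) has_real_derivative ?D) (at 0)"
    by (simp add: sum_divide_distrib mult_ac)
  then have "((\<lambda>t. (ln (q (?p t)) - ln (q (?p 0))) / (t - 0)) \<longlongrightarrow> ?D) (at 0)"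
    by (simp add: has_field_derivative_iff)
  then have lim: "((\<lambda>t. (ln (q (?p t)) - ln (q x)) / t) \<longlongrightarrow> ?D) (at_right 0)"
    by (simp add: filterlim_at_split)
  have "\<forall>\<^sub>F t in at_right 0. ln (q y) - ln (q x) \<le> (ln (q (?p t)) - ln (q x)) / t"
    unfolding eventually_at_right_field
  proof (intro exI[of _ 1] conjI allI impI)
    fix t :: real assume t: "0 < t" "t < 1"
    have "?p t = (\<lambda>i. t * y i + (1 - t) * x i)" by (auto simp: algebra_simps)
    then have "t * ln (q y) + (1 - t) * ln (q x) \<le> ln (q (?p t))" using q_log_concave[OF t, of y x] by simp
    then show "ln (q y) - ln (q x) \<le> (ln (q (?p t)) - ln (q x)) / t"
      using t by (simp add: field_simps)
  qed simp
  from tendsto_lowerbound[OF lim this] show ?thesis by simp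
qed

text \<open>A flip of signs preserves \<nu>, and applied to both arguments it preserves the kernel,
  because \<open>soft_abs\<close> is even.\<close>

lemma q_sign_flip:
  assumes e: "\<And>i. e i \<in> {-1, 1}"
  shows "q (\<lambda>i. e i * y i) = q y"
proof -
  define e' :: "real ^ 'd" where "e' = (\<chi> i. e i)"
  define F where "F = (\<lambda>z :: real ^ 'd. \<chi> i. e' $ i * z $ i)"
  have "continuous_on UNIV F"
    unfolding F_def
    by (intro continuous_on_vec_lambda continuous_on_mult continuous_on_const continuous_on_component continuous_on_id)
  then have F: "F \<in> measurable \<nu> borel"
    unfolding measurable_cong_sets[OF sets_eq refl] by (rule borel_measurable_continuous_onI)
  have k: "(\<lambda>z. exp (- kern (\<lambda>i. e i * y i) z)) \<in> borel_measurable borel"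
    by (intro borel_measurable_continuous_onI continuous_on_exp continuous_on_minus kern_continuous)
  have eq: "distr \<nu> borel F = \<nu>"
    unfolding F_def by (rule sym) (use e in \<open>simp add: e'_def\<close>)
  have "q (\<lambda>i. e i * y i) = (\<integral>z. exp (- kern (\<lambda>i. e i * y i) (F z)) \<partial>\<nu>)"
    using integral_distr[OF F k] unfolding eq q_def .
  also have "\<dots> = q y"
  proof -
    have "soft_abs N (e i * y i - e i * z $ i) = soft_abs N (y i - z $ i)" for i and z :: "real ^ 'd"
      using e[of i] soft_abs_minus[of N "y i - z $ i"] by auto
    then have "kern (\<lambda>i. e i * y i) (F z) = kern y z" for z unfolding kern_def F_def e'_def by simp
    then show ?thesis unfolding q_def by simp
  qed
  finally show ?thesis .
qed

text \<open>As a function of coordinate \<open>j\<close>, \<open>q\<close> is even and log-concave,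
  and \<open>s\<close> is a convex combination of \<open>u\<close> and \<open>- u\<close>, where
  \<open>q\<close> has equal values. The weight \<theta> solves \<theta> u - (1 - \<theta>) u =
  s.\<close>

lemma q_antimono:
  assumes "0 \<le> s" "s \<le> u" shows "q (y(j := u)) \<le> q (y(j := s))"
proof (cases "s = u")
  case False
  then have u: "0 < u" using assms by auto
  define \<theta> where "\<theta> = (s + u) / (2 * u)"
  have \<theta>: "0 < \<theta>" "\<theta> < 1" using assms u False by (auto simp: \<theta>_def field_simps)
  have e: "(\<lambda>i. (if i = j then -1 else 1) * (y(j := u)) i) = y(j := - u)" by auto
  have "q (y(j := - u)) = q (y(j := u))"
    using q_sign_flip[of "\<lambda>i. if i = j then -1 else 1" "y(j := u)"] unfolding e by auto
  moreover have "\<theta> * u - (1 - \<theta>) * u = s" using u by (simp add: \<theta>_def field_simps)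
  then have "(\<lambda>i. \<theta> * (y(j := u)) i + (1 - \<theta>) * (y(j := - u)) i) = y(j := s)"
    by (auto simp: algebra_simps)
  ultimately have "\<theta> * ln (q (y(j := u))) + (1 - \<theta>) * ln (q (y(j := u))) \<le> ln (q (y(j := s)))"
    using q_log_concave[OF \<theta>, of "y(j := u)" "y(j := - u)"] by simp
  then have "ln (q (y(j := u))) \<le> ln (q (y(j := s)))" by (simp add: algebra_simps)
  then show ?thesis using q_pos by simp
qed simp

lemma q_derivative_coord:
  "((\<lambda>s. q (y(j := s))) has_real_derivative - dq j (y(j := s))) (at s)"
proof -
  let ?h = "\<lambda>i. if i = j then 1 else 0 :: real"
  have e: "(\<lambda>i. (y(j := 0)) i + t * ?h i) = y(j := t)" for t by auto
  have "(\<Sum>i\<in>UNIV. ?h i * dq i (y(j := s))) = dq j (y(j := s))"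
    by (simp add: if_distrib[of "\<lambda>x. x * _"] sum.delta cong: if_cong)
  with q_derivative[of "y(j := 0)" ?h s] show ?thesis unfolding e by simp
qed

lemma dq_nonneg:
  assumes "0 \<le> y j" shows "0 \<le> dq j y"
proof (rule ccontr)
  assume "\<not> 0 \<le> dq j y"
  then have "0 < - dq j (y(j := y j))" by simp
  \<comment> \<open>Increments to the right are used because they stay in the half-line where
    \<open>q_antimono\<close> applies, also when \<open>y j = 0\<close>.\<close>
  then obtain d where d: "0 < d" "\<And>h. 0 < h \<Longrightarrow> h < d \<Longrightarrow> q (y(j := y j)) < q (y(j := y j + h))"
    using has_real_derivative_pos_inc_right[OF q_derivative_coord[of y j "y j", THEN has_field_derivative_at_within, of UNIV]] by auto
  have "q (y(j := y j + d / 2)) \<le> q (y(j := y j))"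
    using assms d by (intro q_antimono) auto
  then show False using d(2)[of "d / 2"] d(1) by simp
qed

lemma sum_fun_upd: "(\<Sum>i\<in>UNIV. (y(j := s)) i) = (\<Sum>i\<in>UNIV. y i) - y j + s" for y :: "'d \<Rightarrow> real"
proof -
  have "(\<Sum>i\<in>UNIV - {j}. (y(j := s)) i) = (\<Sum>i\<in>UNIV - {j}. y i)" by (intro sum.cong) auto
  then show ?thesis
    using sum.remove[of UNIV j y] sum.remove[of UNIV j "y(j := s)"] by simp
qed

lemma dens_pos: "0 < dens y"
  using q_pos by (simp add: dens_def)

lemma dens_le: "dens y \<le> exp (- (\<delta> * (\<Sum>i\<in>UNIV. y i)))"
  unfolding dens_def using q_le_1 q_pos by (intro mult_left_le_one_le) (auto intro: less_imp_le)

lemma dens_lipschitz: "dens y \<le> exp ((N + \<delta>) * \<bar>y j - s\<bar>) * dens (y(j := s))"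
proof -
  have "exp (- (\<delta> * (\<Sum>i\<in>UNIV. y i))) = exp (\<delta> * (s - y j)) * exp (- (\<delta> * (\<Sum>i\<in>UNIV. (y(j := s)) i)))"
    unfolding sum_fun_upd by (simp add: exp_add[symmetric] algebra_simps)
  also have "\<dots> \<le> exp (\<delta> * \<bar>y j - s\<bar>) * exp (- (\<delta> * (\<Sum>i\<in>UNIV. (y(j := s)) i)))"
    using \<delta> by (intro mult_right_mono) auto
  finally have "dens y \<le> (exp (N * \<bar>y j - s\<bar>) * q (y(j := s))) * (exp (\<delta> * \<bar>y j - s\<bar>) * exp (- (\<delta> * (\<Sum>i\<in>UNIV. (y(j := s)) i))))"
    unfolding dens_def using q_lipschitz[of y j s] q_pos[of "y(j := s)"] by (intro mult_mono) auto
  then show ?thesis by (simp add: dens_def exp_add distrib_right mult_ac)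
qed

lemma measurable_dens: "dens \<in> borel_measurable (PiHL UNIV)"
  unfolding dens_def[abs_def]
  by (intro borel_measurable_times measurable_q measurable_compose[OF _ borel_measurable_exp] borel_measurable_uminus
      borel_measurable_const borel_measurable_sum measurable_component_HL UNIV_I)

lemma measurable_ddens:
  assumes "\<And>i. Y i \<in> borel_measurable M'"
  shows "(\<lambda>x. ddens j (\<lambda>i. Y i x)) \<in> borel_measurable M'"
  unfolding ddens_def[abs_def]
  by (intro borel_measurable_times borel_measurable_add measurable_q measurable_dq measurable_compose[OF _ borel_measurable_exp]
      borel_measurable_uminus borel_measurable_const borel_measurable_sum assms)

lemma ddens_nonneg: "0 \<le> y j \<Longrightarrow> 0 \<le> ddens j y"
  unfolding ddens_def using dq_nonneg[of y j] q_pos[of y] \<delta> by (intro mult_nonneg_nonneg add_nonneg_nonneg) auto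

lemma ddens_le: "ddens j y \<le> (N + \<delta>) * dens y"
proof -
  have "dq j y + \<delta> * q y \<le> (N + \<delta>) * q y" using dq_bound[of j y] by (simp add: distrib_right)
  then have "(dq j y + \<delta> * q y) * exp (- (\<delta> * (\<Sum>i\<in>UNIV. y i))) \<le> (N + \<delta>) * q y * exp (- (\<delta> * (\<Sum>i\<in>UNIV. y i)))"
    by (rule mult_right_mono) simp
  then show ?thesis by (simp add: ddens_def dens_def mult.assoc)
qed

text \<open>The tail form that \<open>transport_inequality\<close> requires; the exponential weight
  makes \<open>dens\<close> vanish at infinity along coordinate \<open>j\<close>, so only the value
  at \<open>x j\<close> survives.\<close>

lemma dens_eq_integral_ddens:
  assumes x: "0 \<le> x j"
  shows "ennreal (dens x) = (\<integral>\<^sup>+s. ennreal (ddens j (x(j := s))) * indicator {x j..} s \<partial>HL)"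
proof -
  let ?S = "(\<Sum>i\<in>UNIV. x i) - x j"
  have "(\<integral>\<^sup>+s. ennreal (ddens j (x(j := s))) * indicator {x j..} s \<partial>HL)
      = (\<integral>\<^sup>+s. ennreal (ddens j (x(j := s))) * indicator {x j..} s \<partial>lborel)"
    unfolding nn_integral_HL using x by (intro nn_integral_cong) (auto split: split_indicator)
  also have "\<dots> = ennreal (0 - (- dens (x(j := x j))))"
  proof (rule nn_integral_FTC_atLeast)
    have "(\<lambda>s. ddens j (\<lambda>i. if i = j then s else x i)) \<in> borel_measurable borel"
      by (rule measurable_ddens) auto
    then show "(\<lambda>s. ddens j (x(j := s))) \<in> borel_measurable borel" by (simp add: fun_upd_def)
    show "0 \<le> ddens j (x(j := s))" if "x j \<le> s" for s
      using x that by (intro ddens_nonneg) simp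
    show "((\<lambda>s. - dens (x(j := s))) has_real_derivative ddens j (x(j := s))) (at s)" for s
    proof -
      have "((\<lambda>s. exp (- (\<delta> * (?S + s)))) has_real_derivative (exp (- (\<delta> * (?S + s))) * - \<delta>)) (at s)"
        by (auto intro!: derivative_eq_intros)
      from DERIV_minus[OF DERIV_mult[OF q_derivative_coord[of x j s] this]]
      show ?thesis unfolding dens_def ddens_def sum_fun_upd by (simp add: algebra_simps)
    qed
    have "((\<lambda>s. dens (x(j := s))) \<longlongrightarrow> 0) at_top"
    proof (rule Lim_null_comparison)
      show "\<forall>\<^sub>F s in at_top. norm (dens (x(j := s))) \<le> exp (- (\<delta> * (?S + s)))"
      proof (intro always_eventually allI)
        fix s
        show "norm (dens (x(j := s))) \<le> exp (- (\<delta> * (?S + s)))"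
          using dens_le[of "x(j := s)"] dens_pos[of "x(j := s)"] unfolding sum_fun_upd by simp
      qed
      have "filterlim (\<lambda>s. \<delta> * (?S + s)) at_top at_top"
        using \<delta> by (intro filterlim_tendsto_pos_mult_at_top[OF tendsto_const] filterlim_tendsto_add_at_top[OF tendsto_const])
          (auto simp: filterlim_ident)
      then show "((\<lambda>s. exp (- (\<delta> * (?S + s)))) \<longlongrightarrow> 0) at_top"
        by (intro filterlim_compose[OF exp_at_bot]) (simp add: filterlim_uminus_at_top)
    qed
    from tendsto_minus[OF this] show "((\<lambda>s. - dens (x(j := s))) \<longlongrightarrow> 0) at_top" by simp
  qed
  finally show ?thesis by simp
qed

lemma admissible_dens:
  assumes B: "N + \<delta> \<le> B" and K: "1 \<le> K"
  shows "admissible UNIV B K \<delta> dens"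
  unfolding admissible_def
proof (intro conjI ballI allI impI measurable_dens dens_pos)
  fix x :: "'d \<Rightarrow> real" and j s
  have "1 * exp (- (\<delta> * (\<Sum>i\<in>UNIV. x i))) \<le> K * exp (- (\<delta> * (\<Sum>i\<in>UNIV. x i)))"
    using K by (intro mult_right_mono) auto
  then show "dens x \<le> K * exp (- (\<delta> * (\<Sum>i\<in>UNIV. x i)))" using dens_le[of x] by linarith
  have "exp ((N + \<delta>) * \<bar>x j - s\<bar>) * dens (x(j := s)) \<le> exp (B * \<bar>x j - s\<bar>) * dens (x(j := s))"
    using B dens_pos[of "x(j := s)"] by (intro mult_right_mono) (auto intro!: mult_right_mono)
  then show "dens x \<le> exp (B * \<bar>x j - s\<bar>) * dens (x(j := s))" using dens_lipschitz[of x j s] by linarith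
qed

text \<open>The logarithm of the weight is linear, so it adds an equality to the tangent inequality
  of \<open>q\<close>.\<close>

lemma dens_tangent: "ln (dens y) \<le> ln (dens x) - (\<Sum>i\<in>UNIV. ddens i x / dens x * (y i - x i))"
proof -
  have "ddens i x / dens x = dq i x / q x + \<delta>" for i
    using q_pos[of x] by (simp add: ddens_def dens_def add_divide_distrib)
  moreover have "(\<Sum>i\<in>UNIV. (dq i x / q x + \<delta>) * (y i - x i))
      = (\<Sum>i\<in>UNIV. dq i x / q x * (y i - x i)) + \<delta> * ((\<Sum>i\<in>UNIV. y i) - (\<Sum>i\<in>UNIV. x i))"
    by (simp add: distrib_right sum.distrib sum_subtractf flip: sum_distrib_left)
  ultimately show ?thesis
    using q_tangent[of y x] q_pos[of x] q_pos[of y] by (simp add: dens_def ln_mult algebra_simps)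
qed

end

section \<open>Laplace transform of the smoothed density\<close>

lemma exp_diff_le:
  fixes a u w :: real
  assumes "0 \<le> a" "0 \<le> u" "0 \<le> w"
  shows "\<bar>exp (- (a * u)) - exp (- (a * w))\<bar> \<le> a * \<bar>u - w\<bar>"
proof -
  have "norm (exp (- (a * u)) - exp (- (a * w))) \<le> a * norm (u - w)"
  proof (rule field_differentiable_bound[of "{0..}"])
    show "((\<lambda>u. exp (- (a * u))) has_real_derivative exp (- (a * z)) * - a) (at z within {0..})" for z
      by (auto intro!: derivative_eq_intros)
    show "norm (exp (- (a * z)) * - a) \<le> a" if "z \<in> {0..}" for z
      using assms(1) that mult_right_mono[of "exp (- (a * z))" 1 a] by (simp add: abs_mult)
  qed (use assms in auto)
  then show ?thesis by simp
qed

lemma (in smoothed_measure) log_laplace_dens: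
  fixes a :: "'d \<Rightarrow> real" and G :: "('d \<Rightarrow> real) \<Rightarrow> real"
  defines "\<psi> \<equiv> \<lambda>i x. 1 - exp (- (a i * x))"
  assumes C: "0 < C" and a: "\<And>i. 0 < a i" and tc: "\<And>i. transport_cost C (\<psi> i)"
    and G: "G \<in> borel_measurable (PiHL UNIV)" and L: "0 \<le> L"
    and Gb: "\<And>y. y \<in> space (PiHL UNIV) \<Longrightarrow> \<bar>G y\<bar> \<le> b"
    and Glip: "\<And>x y. x \<in> space (PiHL UNIV) \<Longrightarrow> y \<in> space (PiHL UNIV) \<Longrightarrow>
       \<bar>G y - G x\<bar> \<le> L * sqrt (\<Sum>i\<in>UNIV. (\<psi> i (y i) - \<psi> i (x i))\<^sup>2)"
  shows "ln (\<integral>y. exp (t * G y) * dens y \<partial>PiHL UNIV)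
     \<le> ln (\<integral>y. dens y \<partial>PiHL UNIV) + (t * (\<integral>y. G y * dens y \<partial>PiHL UNIV)) / (\<integral>y. dens y \<partial>PiHL UNIV) + C / 4 * L\<^sup>2 * t\<^sup>2"
proof -
  \<comment> \<open>A move of coordinate \<open>j\<close> costs \<open>N + \<delta>\<close> in
    \<open>ln dens\<close> and at most \<open>\<bar>t\<bar> * L * a j\<close> in
    \<open>t * G\<close>. The parameters \<open>a\<close> thus enter the auxiliary bound
    \<open>B\<close>, which is absent from the conclusion.\<close>
  define B where "B = N + \<delta> + \<bar>t\<bar> * L * (\<Sum>i\<in>UNIV. a i)"
  define c where "c = C / 4 * L\<^sup>2 * t\<^sup>2"
  have sa: "a j \<le> (\<Sum>i\<in>UNIV. a i)" for j
    by (rule member_le_sum) (simp_all add: less_imp_le[OF a])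
  have sa0: "0 \<le> (\<Sum>i\<in>UNIV. a i)" by (intro sum_nonneg less_imp_le a)
  have BN: "N + \<delta> \<le> B" using L sa0 by (simp add: B_def)
  have sp: "x \<in> space (PiHL UNIV) \<longleftrightarrow> (\<forall>i. 0 \<le> x i)" for x :: "'d \<Rightarrow> real"
    by (auto simp: space_PiHL)
  have b0: "0 \<le> b" using Gb[of "\<lambda>_. 0"] by (simp add: sp)
  define K where "K = exp (\<bar>t\<bar> * b)"
  have K1: "1 \<le> K" using b0 by (simp add: K_def)
  have tG: "\<bar>t * G y\<bar> \<le> \<bar>t\<bar> * b" if "y \<in> space (PiHL UNIV)" for y :: "'d \<Rightarrow> real"
    using Gb[OF that] by (simp add: abs_mult mult_left_mono)
  have admv: "admissible UNIV B K \<delta> dens" using BN K1 by (rule admissible_dens)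
  have admw: "admissible UNIV B K \<delta> (\<lambda>y. exp (t * G y) * dens y)"
    unfolding admissible_def
  proof (intro conjI ballI allI impI)
    show "(\<lambda>y. exp (t * G y) * dens y) \<in> borel_measurable (PiHL UNIV)"
      using G measurable_dens by measurable
    fix x :: "'d \<Rightarrow> real" assume x: "x \<in> space (PiHL UNIV)"
    show "0 < exp (t * G x) * dens x" using dens_pos[of x] by simp
    show "exp (t * G x) * dens x \<le> K * exp (- (\<delta> * (\<Sum>i\<in>UNIV. x i)))"
      using tG[OF x] dens_le[of x] dens_pos[of x] unfolding K_def by (intro mult_mono) auto
    fix j and s :: real assume s: "0 \<le> s"
    have xs: "x(j := s) \<in> space (PiHL UNIV)" using x s by (auto simp: sp)
    have "(\<Sum>i\<in>UNIV. (\<psi> i (x i) - \<psi> i ((x(j := s)) i))\<^sup>2) = (\<Sum>i\<in>UNIV. if i = j then (\<psi> j (x j) - \<psi> j s)\<^sup>2 else 0)"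
      by (intro sum.cong) auto
    then have "\<bar>G x - G (x(j := s))\<bar> \<le> L * \<bar>\<psi> j (x j) - \<psi> j s\<bar>"
      using Glip[OF xs x] by simp
    also have "\<dots> \<le> L * ((\<Sum>i\<in>UNIV. a i) * \<bar>x j - s\<bar>)"
    proof (rule mult_left_mono[OF _ L])
      have "\<bar>\<psi> j (x j) - \<psi> j s\<bar> \<le> a j * \<bar>x j - s\<bar>"
        using exp_diff_le[of "a j" "x j" s] a[of j] x s by (simp add: \<psi>_def sp less_imp_le abs_minus_commute)
      also have "\<dots> \<le> (\<Sum>i\<in>UNIV. a i) * \<bar>x j - s\<bar>" using sa by (intro mult_right_mono) auto
      finally show "\<bar>\<psi> j (x j) - \<psi> j s\<bar> \<le> (\<Sum>i\<in>UNIV. a i) * \<bar>x j - s\<bar>" .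
    qed
    finally have "\<bar>t\<bar> * \<bar>G x - G (x(j := s))\<bar> \<le> \<bar>t\<bar> * (L * ((\<Sum>i\<in>UNIV. a i) * \<bar>x j - s\<bar>))"
      by (rule mult_left_mono) simp
    then have "t * G x - t * G (x(j := s)) \<le> \<bar>t\<bar> * L * (\<Sum>i\<in>UNIV. a i) * \<bar>x j - s\<bar>"
      unfolding abs_mult[symmetric] right_diff_distrib by (simp add: mult.assoc)
    then have "exp (t * G x) \<le> exp (\<bar>t\<bar> * L * (\<Sum>i\<in>UNIV. a i) * \<bar>x j - s\<bar>) * exp (t * G (x(j := s)))"
      by (simp add: exp_add[symmetric])
    then have "exp (t * G x) * dens x \<le> (exp (\<bar>t\<bar> * L * (\<Sum>i\<in>UNIV. a i) * \<bar>x j - s\<bar>) * exp (t * G (x(j := s))))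
        * (exp ((N + \<delta>) * \<bar>x j - s\<bar>) * dens (x(j := s)))"
      using dens_lipschitz[of x j s] dens_pos[of x] by (intro mult_mono) auto
    also have "\<dots> = exp (B * \<bar>x j - s\<bar>) * (exp (t * G (x(j := s))) * dens (x(j := s)))"
    proof -
      have e: "B * \<bar>x j - s\<bar> = \<bar>t\<bar> * L * (\<Sum>i\<in>UNIV. a i) * \<bar>x j - s\<bar> + (N + \<delta>) * \<bar>x j - s\<bar>"
        unfolding B_def by (simp only: distrib_right add_ac)
      show ?thesis unfolding e exp_add by (simp only: mult_ac)
    qed
    finally show "exp (t * G x) * dens x \<le> exp (B * \<bar>x j - s\<bar>) * (exp (t * G (x(j := s))) * dens (x(j := s)))" .
  qed
  have c0: "0 \<le> c" using C by (simp add: c_def)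
  have "ln (\<integral>y. exp (t * G y) * dens y \<partial>PiHL UNIV)
     \<le> ln (\<integral>y. dens y \<partial>PiHL UNIV) + (\<integral>y. (t * G y + c) * dens y \<partial>PiHL UNIV) / (\<integral>y. dens y \<partial>PiHL UNIV)"
  proof (rule transport_inequality[OF finite C \<delta> tc _ _ admv admw, where r = ddens and D = "\<bar>t\<bar> * b + c"])
    show "\<psi> i \<in> borel_measurable borel" for i unfolding \<psi>_def by measurable
    show "\<psi> i x \<in> {0..1}" if "0 \<le> x" for i x using a[of i] that by (simp add: \<psi>_def)
    show "(\<lambda>y. t * G y + c) \<in> borel_measurable (PiHL UNIV)" using G by measurable
    show "\<bar>t * G x + c\<bar> \<le> \<bar>t\<bar> * b + c" if "x \<in> space (PiHL UNIV)" for x :: "'d \<Rightarrow> real"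
      using tG[OF that] c0 by linarith
    show "ddens i \<in> borel_measurable (PiHL UNIV)" for i
      by (rule measurable_ddens[of "\<lambda>i x. x i"]) (rule measurable_component_HL[OF UNIV_I])
    fix i and x :: "'d \<Rightarrow> real" assume x: "x \<in> space (PiHL UNIV)"
    show "0 \<le> ddens i x" using x by (intro ddens_nonneg) (simp add: sp)
    have "(N + \<delta>) * dens x \<le> B * dens x" using BN dens_pos[of x] by (intro mult_right_mono) auto
    then show "ddens i x \<le> B * dens x" using ddens_le[of i x] by linarith
    show "ennreal (dens x) = (\<integral>\<^sup>+s. ennreal (ddens i (x(i := s))) * indicator {x i..} s \<partial>HL)"
      using x by (intro dens_eq_integral_ddens) (simp add: sp)
  next
    fix x y :: "'d \<Rightarrow> real" assume x: "x \<in> space (PiHL UNIV)" and y: "y \<in> space (PiHL UNIV)"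
    define S where "S = (\<Sum>i\<in>UNIV. (\<psi> i (y i) - \<psi> i (x i))\<^sup>2)"
    have S0: "0 \<le> S" unfolding S_def by (intro sum_nonneg) simp
    have "t * G y - t * G x \<le> \<bar>t\<bar> * \<bar>G y - G x\<bar>"
      unfolding abs_mult[symmetric] right_diff_distrib by simp
    also have "\<dots> \<le> \<bar>t\<bar> * (L * sqrt S)" using Glip[OF x y] by (intro mult_left_mono) (auto simp: S_def)
    also have "\<dots> \<le> c + S / C"
    proof -
      \<comment> \<open>The square is chosen so that the term without \<open>S\<close> is exactly
        \<open>c\<close>; this is the origin of the factor 1/4.\<close>
      have "0 \<le> (C * \<bar>t\<bar> * L / 2 - sqrt S)\<^sup>2 / C" using C by simp
      also have "\<dots> = c - \<bar>t\<bar> * (L * sqrt S) + S / C"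
        using C S0 by (simp add: c_def power2_eq_square field_simps abs_mult_self_eq)
      finally show ?thesis by simp
    qed
    finally have "t * G y \<le> t * G x + c + S / C" by simp
    then show "ln (exp (t * G y) * dens y) \<le> t * G x + c + ln (dens x) - (\<Sum>i\<in>UNIV. ddens i x / dens x * (y i - x i))
        + (\<Sum>i\<in>UNIV. (\<psi> i (y i) - \<psi> i (x i))\<^sup>2 / C)"
      using dens_tangent[of y x] dens_pos[of y] by (simp add: ln_mult sum_divide_distrib[symmetric] S_def)
  qed
  also have "(\<integral>y. (t * G y + c) * dens y \<partial>PiHL UNIV) = t * (\<integral>y. G y * dens y \<partial>PiHL UNIV) + c * (\<integral>y. dens y \<partial>PiHL UNIV)"
    using admissible_integrable_mult[OF finite \<delta> admv G Gb] admissible_integral(1)[OF finite \<delta> admv]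
    by (simp add: distrib_right mult.assoc)
  finally show ?thesis
    using admissible_integral(2)[OF finite \<delta> admv] by (simp add: c_def add_divide_distrib)
qed

section \<open>Removing the smoothing\<close>

text \<open>Coordinatewise change of variables. It is used for the folding by absolute value, where
  \<kappa> is 2, and for the rescaling around a point, where \<kappa> is \<open>N\<close>.\<close>

lemma nn_integral_PiM_map:
  fixes A :: "'b measure" and B :: "'c measure" and f :: "('i \<Rightarrow> 'c) \<Rightarrow> ennreal"
  assumes "finite I" and A: "sigma_finite_measure A" and B: "sigma_finite_measure B"
    and T: "\<And>i. T i \<in> measurable A B"
    and int: "\<And>i g. g \<in> borel_measurable B \<Longrightarrow> (\<integral>\<^sup>+u. g (T i u) \<partial>A) = \<kappa> * (\<integral>\<^sup>+x. g x \<partial>B)"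
    and f: "f \<in> borel_measurable (Pi\<^sub>M I (\<lambda>_. B))"
  shows "(\<integral>\<^sup>+u. f (\<lambda>i\<in>I. T i (u i)) \<partial>Pi\<^sub>M I (\<lambda>_. A)) = \<kappa> ^ card I * (\<integral>\<^sup>+x. f x \<partial>Pi\<^sub>M I (\<lambda>_. B))"
  using assms(1) f
proof (induction I arbitrary: f rule: finite_induct)
  case empty
  show ?case by (simp add: PiM_empty nn_integral_count_space_finite)
next
  case (insert j I)
  interpret PA: product_sigma_finite "\<lambda>_::'i. A" using A by (simp add: product_sigma_finite_def)
  interpret PB: product_sigma_finite "\<lambda>_::'i. B" using B by (simp add: product_sigma_finite_def)
  note f = insert.prems
  have Tm: "(\<lambda>u. \<lambda>i\<in>insert j I. T i (u i)) \<in> measurable (Pi\<^sub>M (insert j I) (\<lambda>_. A)) (Pi\<^sub>M (insert j I) (\<lambda>_. B))"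
    by (rule measurable_restrict) (rule measurable_compose[OF measurable_component_singleton[of _ _ "\<lambda>_. A"] T])
  have fm: "(\<lambda>p. f ((snd p)(j := fst p))) \<in> borel_measurable (B \<Otimes>\<^sub>M Pi\<^sub>M I (\<lambda>_. B))"
    by (rule measurable_compose[OF measurable_fun_upd[where J=I] f]) auto
  interpret PI: sigma_finite_measure "Pi\<^sub>M I (\<lambda>_. B)" using PB.sigma_finite[OF insert.hyps(1)] .
  have mB: "(\<lambda>y. \<integral>\<^sup>+x. f (x(j := y)) \<partial>Pi\<^sub>M I (\<lambda>_. B)) \<in> borel_measurable B"
    by (intro PI.borel_measurable_nn_integral) (use fm in \<open>simp add: case_prod_beta'\<close>)
  have "(\<integral>\<^sup>+u. f (\<lambda>i\<in>insert j I. T i (u i)) \<partial>Pi\<^sub>M (insert j I) (\<lambda>_. A))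
      = (\<integral>\<^sup>+y. (\<integral>\<^sup>+x. f (\<lambda>i\<in>insert j I. T i ((x(j := y)) i)) \<partial>Pi\<^sub>M I (\<lambda>_. A)) \<partial>A)"
    by (rule PA.product_nn_integral_insert_rev[OF insert.hyps(1,2) measurable_compose[OF Tm f]])
  also have "\<dots> = (\<integral>\<^sup>+y. (\<integral>\<^sup>+x. f ((\<lambda>i\<in>I. T i (x i))(j := T j y)) \<partial>Pi\<^sub>M I (\<lambda>_. A)) \<partial>A)"
  proof (intro nn_integral_cong arg_cong[of _ _ f])
    show "(\<lambda>i\<in>insert j I. T i ((x(j := y)) i)) = (\<lambda>i\<in>I. T i (x i))(j := T j y)" for x y
      using insert.hyps(2) by (auto simp: restrict_def fun_eq_iff)
  qed
  also have "\<dots> = (\<integral>\<^sup>+y. \<kappa> ^ card I * (\<integral>\<^sup>+x. f (x(j := T j y)) \<partial>Pi\<^sub>M I (\<lambda>_. B)) \<partial>A)"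
  proof (rule nn_integral_cong)
    fix y assume "y \<in> space A"
    then have "T j y \<in> space B" using T by (rule measurable_space[rotated])
    then have "(\<lambda>x. f (x(j := T j y))) \<in> borel_measurable (Pi\<^sub>M I (\<lambda>_. B))"
      by (intro measurable_compose[OF measurable_fun_upd[where J=I] f]) auto
    then show "(\<integral>\<^sup>+x. f ((\<lambda>i\<in>I. T i (x i))(j := T j y)) \<partial>Pi\<^sub>M I (\<lambda>_. A))
        = \<kappa> ^ card I * (\<integral>\<^sup>+x. f (x(j := T j y)) \<partial>Pi\<^sub>M I (\<lambda>_. B))"
      by (rule insert.IH)
  qed
  also have "\<dots> = \<kappa> * (\<integral>\<^sup>+y. \<kappa> ^ card I * (\<integral>\<^sup>+x. f (x(j := y)) \<partial>Pi\<^sub>M I (\<lambda>_. B)) \<partial>B)"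
    by (rule int) (use mB in measurable)
  also have "\<dots> = \<kappa> * (\<kappa> ^ card I * (\<integral>\<^sup>+y. (\<integral>\<^sup>+x. f (x(j := y)) \<partial>Pi\<^sub>M I (\<lambda>_. B)) \<partial>B))"
    by (subst nn_integral_cmult[OF mB]) simp
  also have "(\<integral>\<^sup>+y. (\<integral>\<^sup>+x. f (x(j := y)) \<partial>Pi\<^sub>M I (\<lambda>_. B)) \<partial>B) = (\<integral>\<^sup>+x. f x \<partial>Pi\<^sub>M (insert j I) (\<lambda>_. B))"
    by (rule PB.product_nn_integral_insert_rev[OF insert.hyps(1,2) f, symmetric])
  finally show ?case using insert.hyps by (simp add: mult.assoc)
qed

lemma nn_integral_abs_fold:
  fixes g :: "real \<Rightarrow> ennreal"
  assumes g: "g \<in> borel_measurable HL"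
  shows "(\<integral>\<^sup>+u. g \<bar>u\<bar> \<partial>lborel) = 2 * (\<integral>\<^sup>+x. g x \<partial>HL)"
proof -
  have abs: "(\<lambda>u. \<bar>u\<bar>) \<in> measurable lborel HL"
    unfolding HL_def by (rule measurable_restrict_space2) auto
  have [measurable]: "(\<lambda>u. g \<bar>u\<bar>) \<in> borel_measurable borel"
    using measurable_compose[OF abs g] by simp
  have pos: "(\<integral>\<^sup>+u. g \<bar>u\<bar> * indicator {0..} u \<partial>lborel) = (\<integral>\<^sup>+x. g x \<partial>HL)"
    unfolding nn_integral_HL by (intro nn_integral_cong) (auto split: split_indicator)
  have "(\<integral>\<^sup>+u. g \<bar>u\<bar> * indicator {..<0} u \<partial>lborel) = (\<integral>\<^sup>+u. g \<bar>u\<bar> * indicator {0<..} u \<partial>lborel)"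
    by (subst nn_integral_real_affine[where c = "-1" and t = 0]) (auto intro!: nn_integral_cong split: split_indicator)
  also have "\<dots> = (\<integral>\<^sup>+u. g \<bar>u\<bar> * indicator {0..} u \<partial>lborel)"
    by (intro nn_integral_cong_AE AE_I[of _ _ "{0}"]) (auto split: split_indicator)
  finally have neg: "(\<integral>\<^sup>+u. g \<bar>u\<bar> * indicator {..<0} u \<partial>lborel) = (\<integral>\<^sup>+x. g x \<partial>HL)" unfolding pos .
  have "(\<integral>\<^sup>+u. g \<bar>u\<bar> \<partial>lborel) = (\<integral>\<^sup>+u. g \<bar>u\<bar> * indicator {0..} u + g \<bar>u\<bar> * indicator {..<0} u \<partial>lborel)"
    by (intro nn_integral_cong) (auto split: split_indicator)
  also have "\<dots> = (\<integral>\<^sup>+x. g x \<partial>HL) + (\<integral>\<^sup>+x. g x \<partial>HL)"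
    by (subst nn_integral_add) (auto simp: pos neg)
  finally show ?thesis by (simp add: mult_2)
qed

section \<open>Unfolding the orthant and letting the smoothing vanish\<close>

abbreviation PiLB :: "('i \<Rightarrow> real) measure" where
  "PiLB \<equiv> Pi\<^sub>M UNIV (\<lambda>_. lborel)"

lemma measurable_abs_PiHL:
  assumes "\<And>i. Y i \<in> borel_measurable M"
  shows "(\<lambda>x i. \<bar>Y i x\<bar>) \<in> measurable M (PiHL (UNIV :: 'i set))"
proof (rule measurable_PiM_single')
  fix i :: 'i
  have "(\<lambda>x. \<bar>Y i x\<bar>) \<in> measurable M lborel" using assms[of i] by simp
  then show "(\<lambda>x. \<bar>Y i x\<bar>) \<in> measurable M HL"
    unfolding HL_def by (intro measurable_restrict_space2) auto
qed (auto simp: space_HL)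

text \<open>The density integral as an expectation: up to a constant factor, \<open>dens\<close>
  without its weight is the density of the vector of absolute values of Z + U / N, with Z of law
  \<nu> and an independent noise U of density proportional to the exponential of minus the sum of
  the \<open>soft_abs 1\<close>. Evenness of \<open>q\<close> spreads the integral over the whole
  space and costs a factor 2 per coordinate; centring and rescaling the noise costs a factor
  \<open>N\<close> per coordinate.\<close>

lemma (in smoothed_measure) nn_integral_dens:
  fixes \<phi> :: "('d \<Rightarrow> real) \<Rightarrow> real"
  assumes \<phi>: "\<phi> \<in> borel_measurable (PiHL UNIV)" and \<phi>0: "\<And>y. y \<in> space (PiHL UNIV) \<Longrightarrow> 0 \<le> \<phi> y"
  shows "ennreal ((2 * N) ^ CARD('d)) * (\<integral>\<^sup>+y. ennreal (\<phi> y * dens y) \<partial>PiHL UNIV)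
    = (\<integral>\<^sup>+p. ennreal (\<phi> (\<lambda>i. \<bar>fst p $ i + snd p i / N\<bar>) * exp (- (\<delta> * (\<Sum>i\<in>UNIV. \<bar>fst p $ i + snd p i / N\<bar>)))
         * exp (- (\<Sum>i\<in>UNIV. soft_abs 1 (snd p i)))) \<partial>(\<nu> \<Otimes>\<^sub>M PiLB))"
proof -
  have sf\<nu>: "sigma_finite_measure \<nu>" by (rule sigma_finite_measure_axioms)
  interpret LB: product_sigma_finite "\<lambda>_::'d. lborel :: real measure"
    by (simp add: product_sigma_finite_def lborel.sigma_finite_measure_axioms)
  interpret PL: sigma_finite_measure "PiLB :: ('d \<Rightarrow> real) measure" by (rule LB.sigma_finite) simp
  interpret pair_sigma_finite \<nu> "PiLB :: ('d \<Rightarrow> real) measure"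
    by (simp add: pair_sigma_finite_def sigma_finite_measure_axioms PL.sigma_finite_measure_axioms)
  let ?d = "CARD('d)"
  have spn: "y \<in> space (PiHL UNIV) \<longleftrightarrow> (\<forall>i. 0 \<le> y i)" for y :: "'d \<Rightarrow> real" by (auto simp: space_PiHL)
  have comp: "(\<lambda>y. y i) \<in> borel_measurable (PiLB :: ('d \<Rightarrow> real) measure)" for i
    using measurable_component_singleton[of i UNIV "\<lambda>_. lborel :: real measure"] by simp
  define w where "w = (\<lambda>y. \<phi> (\<lambda>i. \<bar>y i\<bar>) * exp (- (\<delta> * (\<Sum>i\<in>UNIV. \<bar>y i\<bar>))))"
  have w0: "0 \<le> w y" for y unfolding w_def by (intro mult_nonneg_nonneg \<phi>0) (auto simp: spn)
  have wm: "w \<in> borel_measurable PiLB"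
    unfolding w_def
    by (intro borel_measurable_times measurable_compose[OF measurable_abs_PiHL \<phi>] measurable_compose[OF _ borel_measurable_exp]
        borel_measurable_uminus borel_measurable_const borel_measurable_sum borel_measurable_abs comp)
  have q_abs: "q (\<lambda>i. \<bar>y i\<bar>) = q y" for y
  proof -
    have "(\<lambda>i. (if y i < 0 then -1 else 1) * y i) = (\<lambda>i. \<bar>y i\<bar>)" by auto
    then show ?thesis using q_sign_flip[of "\<lambda>i. if y i < 0 then -1 else 1" y] by simp
  qed
  have km: "(\<lambda>p. w (fst p) * exp (- kern (fst p) (snd p))) \<in> borel_measurable (PiLB \<Otimes>\<^sub>M \<nu>)"
    by (intro borel_measurable_times measurable_compose[OF measurable_fst wm] measurable_compose[OF _ borel_measurable_exp]
        borel_measurable_uminus measurable_kern[of "\<lambda>i y. y i"] comp)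
  have "ennreal (2 ^ ?d) * (\<integral>\<^sup>+y. ennreal (\<phi> y * dens y) \<partial>PiHL UNIV)
      = (\<integral>\<^sup>+y. ennreal (\<phi> (\<lambda>i. \<bar>y i\<bar>) * dens (\<lambda>i. \<bar>y i\<bar>)) \<partial>PiLB)"
  proof -
    have "(\<integral>\<^sup>+y. ennreal (\<phi> (\<lambda>i\<in>UNIV. \<bar>y i\<bar>) * dens (\<lambda>i\<in>UNIV. \<bar>y i\<bar>)) \<partial>PiLB)
        = 2 ^ card (UNIV :: 'd set) * (\<integral>\<^sup>+y. ennreal (\<phi> y * dens y) \<partial>PiHL UNIV)"
    proof (rule nn_integral_PiM_map[where T = "\<lambda>_ u. \<bar>u\<bar>"])
      show "(\<lambda>u::real. \<bar>u\<bar>) \<in> measurable lborel HL" unfolding HL_def by (rule measurable_restrict_space2) auto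
      show "(\<lambda>y. ennreal (\<phi> y * dens y)) \<in> borel_measurable (PiHL UNIV)"
        using \<phi> measurable_dens by measurable
    qed (auto simp: nn_integral_abs_fold sigma_finite_HL lborel.sigma_finite_measure_axioms)
    then show ?thesis by (simp add: restrict_UNIV ennreal_power[symmetric])
  qed
  also have "\<dots> = (\<integral>\<^sup>+y. (\<integral>\<^sup>+z. ennreal (w y * exp (- kern y z)) \<partial>\<nu>) \<partial>PiLB)"
  proof (rule nn_integral_cong)
    fix y :: "'d \<Rightarrow> real"
    have "\<phi> (\<lambda>i. \<bar>y i\<bar>) * dens (\<lambda>i. \<bar>y i\<bar>) = (\<integral>z. w y * exp (- kern y z) \<partial>\<nu>)"
      by (simp add: w_def dens_def q_abs q_def[of y])
    also have "ennreal \<dots> = (\<integral>\<^sup>+z. ennreal (w y * exp (- kern y z)) \<partial>\<nu>)"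
      using w0[of y] by (intro nn_integral_eq_integral[symmetric] integrable_mult_right integrable_exp_kern) auto
    finally show "ennreal (\<phi> (\<lambda>i. \<bar>y i\<bar>) * dens (\<lambda>i. \<bar>y i\<bar>)) = (\<integral>\<^sup>+z. ennreal (w y * exp (- kern y z)) \<partial>\<nu>)" .
  qed
  also have "\<dots> = (\<integral>\<^sup>+z. (\<integral>\<^sup>+y. ennreal (w y * exp (- kern y z)) \<partial>PiLB) \<partial>\<nu>)"
  proof -
    interpret S: pair_sigma_finite "PiLB :: ('d \<Rightarrow> real) measure" \<nu>
      by (simp add: pair_sigma_finite_def sf\<nu> PL.sigma_finite_measure_axioms)
    show ?thesis
      by (rule S.Fubini'[symmetric]) (use measurable_compose[OF km measurable_ennreal] in \<open>simp add: case_prod_beta'\<close>)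
  qed
  finally have 1: "ennreal (2 ^ ?d) * (\<integral>\<^sup>+y. ennreal (\<phi> y * dens y) \<partial>PiHL UNIV)
      = (\<integral>\<^sup>+z. (\<integral>\<^sup>+y. ennreal (w y * exp (- kern y z)) \<partial>PiLB) \<partial>\<nu>)" .
  \<comment> \<open>Under the substitution y = z + u / N the kernel becomes a weight that depends on
    neither \<open>N\<close> nor \<open>z\<close>, which is what allows a limit.\<close>
  have 2: "ennreal (N ^ ?d) * (\<integral>\<^sup>+y. ennreal (w y * exp (- kern y z)) \<partial>PiLB)
      = (\<integral>\<^sup>+u. ennreal (w (\<lambda>i. z $ i + u i / N) * exp (- (\<Sum>i\<in>UNIV. soft_abs 1 (u i)))) \<partial>PiLB)" for z :: "real ^ 'd"
  proof -
    have "(\<integral>\<^sup>+u. ennreal (w (\<lambda>i\<in>UNIV. z $ i + u i / N) * exp (- kern (\<lambda>i\<in>UNIV. z $ i + u i / N) z)) \<partial>PiLB)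
        = ennreal N ^ card (UNIV :: 'd set) * (\<integral>\<^sup>+y. ennreal (w y * exp (- kern y z)) \<partial>PiLB)"
    proof (rule nn_integral_PiM_map[where T = "\<lambda>i u. z $ i + u / N"])
      show "(\<lambda>u. z $ i + u / N) \<in> measurable lborel lborel" for i by measurable
      show "(\<lambda>y. ennreal (w y * exp (- kern y z))) \<in> borel_measurable PiLB"
        using measurable_compose[OF measurable_Pair[OF measurable_ident measurable_const] measurable_compose[OF km measurable_ennreal]]
        by (simp add: space_eq)
      fix i and g :: "real \<Rightarrow> ennreal" assume [measurable]: "g \<in> borel_measurable lborel"
      have "(\<integral>\<^sup>+x. g x \<partial>lborel) = ennreal \<bar>1 / N\<bar> * (\<integral>\<^sup>+u. g (z $ i + 1 / N * u) \<partial>lborel)"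
        by (rule nn_integral_real_affine) (use N in auto)
      then show "(\<integral>\<^sup>+u. g (z $ i + u / N) \<partial>lborel) = ennreal N * (\<integral>\<^sup>+x. g x \<partial>lborel)"
        using N by (simp add: mult.assoc[symmetric] ennreal_mult[symmetric])
    qed (auto simp: lborel.sigma_finite_measure_axioms)
    moreover have "soft_abs N (z $ i + x / N - z $ i) = soft_abs 1 x" for i x
      using N by (simp add: soft_abs_def)
    ultimately show ?thesis using N by (simp add: kern_def restrict_UNIV ennreal_power)
  qed
  have jm: "(\<lambda>p. w (\<lambda>i. fst p $ i + snd p i / N)) \<in> borel_measurable (\<nu> \<Otimes>\<^sub>M PiLB)"
    and sm: "(\<lambda>p. exp (- (\<Sum>i\<in>(UNIV :: 'd set). soft_abs 1 (snd p i)))) \<in> borel_measurable (\<nu> \<Otimes>\<^sub>M PiLB)"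
  proof -
    have s: "(\<lambda>p. snd p i) \<in> borel_measurable (\<nu> \<Otimes>\<^sub>M PiLB)" for i :: 'd
      by (rule measurable_compose[OF measurable_snd comp])
    have f: "(\<lambda>p. fst p $ i) \<in> borel_measurable (\<nu> \<Otimes>\<^sub>M (PiLB :: ('d \<Rightarrow> real) measure))" for i
      by (rule measurable_compose[OF measurable_fst measurable_nth])
    show "(\<lambda>p. exp (- (\<Sum>i\<in>(UNIV :: 'd set). soft_abs 1 (snd p i)))) \<in> borel_measurable (\<nu> \<Otimes>\<^sub>M PiLB)"
      by (intro measurable_compose[OF _ borel_measurable_exp] borel_measurable_uminus borel_measurable_sum
          measurable_compose[OF s measurable_soft_abs])
    have "(\<lambda>p i. fst p $ i + snd p i / N) \<in> measurable (\<nu> \<Otimes>\<^sub>M PiLB) PiLB"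
      by (rule measurable_PiM_single') (use s f in auto)
    then show "(\<lambda>p. w (\<lambda>i. fst p $ i + snd p i / N)) \<in> borel_measurable (\<nu> \<Otimes>\<^sub>M PiLB)"
      by (rule measurable_compose[OF _ wm])
  qed
  have "ennreal ((2 * N) ^ ?d) * (\<integral>\<^sup>+y. ennreal (\<phi> y * dens y) \<partial>PiHL UNIV)
      = ennreal (N ^ ?d) * (ennreal (2 ^ ?d) * (\<integral>\<^sup>+y. ennreal (\<phi> y * dens y) \<partial>PiHL UNIV))"
    using N by (simp add: power_mult_distrib ennreal_mult mult_ac)
  also have "\<dots> = (\<integral>\<^sup>+z. ennreal (N ^ ?d) * (\<integral>\<^sup>+y. ennreal (w y * exp (- kern y z)) \<partial>PiLB) \<partial>\<nu>)"
    unfolding 1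
  proof (rule nn_integral_cmult[symmetric])
    have sw: "(\<lambda>p. (snd p, fst p)) \<in> measurable (\<nu> \<Otimes>\<^sub>M PiLB) (PiLB \<Otimes>\<^sub>M \<nu>)" by measurable
    show "(\<lambda>z. \<integral>\<^sup>+y. ennreal (w y * exp (- kern y z)) \<partial>PiLB) \<in> borel_measurable \<nu>"
      by (rule PL.borel_measurable_nn_integral)
         (use measurable_compose[OF sw measurable_compose[OF km measurable_ennreal]] in \<open>simp add: case_prod_beta'\<close>)
  qed
  also have "\<dots> = (\<integral>\<^sup>+z. (\<integral>\<^sup>+u. ennreal (w (\<lambda>i. z $ i + u i / N) * exp (- (\<Sum>i\<in>UNIV. soft_abs 1 (u i)))) \<partial>PiLB) \<partial>\<nu>)"
    unfolding 2 ..
  also have "\<dots> = (\<integral>\<^sup>+p. ennreal (w (\<lambda>i. fst p $ i + snd p i / N) * exp (- (\<Sum>i\<in>UNIV. soft_abs 1 (snd p i)))) \<partial>(\<nu> \<Otimes>\<^sub>M PiLB))"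
    using PL.nn_integral_fst[of "\<lambda>p. ennreal (w (\<lambda>i. fst p $ i + snd p i / N) * exp (- (\<Sum>i\<in>UNIV. soft_abs 1 (snd p i))))" \<nu>]
      measurable_compose[OF borel_measurable_times[OF jm sm] measurable_ennreal] by simp
  finally show ?thesis by (simp add: w_def)
qed

text \<open>\<open>S\<close> is the mass of the noise. Only finiteness and positivity matter, since
  \<open>S\<close> cancels in the final inequality.\<close>

lemma nn_integral_exp_soft_abs:
  obtains S where "0 < S"
    "(\<integral>\<^sup>+u. ennreal (exp (- (\<Sum>i\<in>(UNIV :: 'd::finite set). soft_abs 1 (u i)))) \<partial>PiLB) = ennreal S"
proof -
  interpret LB: product_sigma_finite "\<lambda>_::'d. lborel :: real measure"
    by (simp add: product_sigma_finite_def lborel.sigma_finite_measure_axioms)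
  define s where "s = (\<integral>\<^sup>+u. ennreal (exp (- soft_abs 1 u)) \<partial>lborel)"
  have "s \<le> (\<integral>\<^sup>+u. ennreal (exp (- (1 * \<bar>u\<bar>))) \<partial>lborel)"
    unfolding s_def using soft_abs_ge[of 1] by (intro nn_integral_mono ennreal_leI) auto
  also have "\<dots> = 2 * (\<integral>\<^sup>+x. ennreal (exp (- (1 * x))) \<partial>HL)"
    by (rule nn_integral_abs_fold) (rule measurable_HL, measurable)
  also have "\<dots> = 2" by (subst nn_integral_exp_HL) auto
  finally have "s < \<infinity>" by (rule le_less_trans) simp
  moreover have "0 < s"
  proof -
    have "ennreal (exp (- 2)) = (\<integral>\<^sup>+u. ennreal (exp (- 2)) * indicator {0..1::real} u \<partial>lborel)"
      by (subst nn_integral_cmult_indicator) auto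
    also have "\<dots> \<le> s"
      unfolding s_def
    proof (rule nn_integral_mono)
      fix u :: real
      have "soft_abs 1 u \<le> 2" if "u \<in> {0..1}"
      proof -
        have "u\<^sup>2 \<le> 1" using that by (simp add: power_le_one)
        then have "1 + (1 * u)\<^sup>2 \<le> 2\<^sup>2" by simp
        then show ?thesis unfolding soft_abs_def by (intro real_le_lsqrt) auto
      qed
      then show "ennreal (exp (- 2)) * indicator {0..1} u \<le> ennreal (exp (- soft_abs 1 u))"
        by (auto split: split_indicator intro!: ennreal_leI)
    qed
    finally show ?thesis by (rule less_le_trans[rotated]) simp
  qed
  ultimately obtain s' where s': "s = ennreal s'" "0 < s'"
    by (cases s) auto
  have "ennreal (exp (- (\<Sum>i\<in>(UNIV :: 'd set). soft_abs 1 (u i)))) = (\<Prod>i\<in>(UNIV :: 'd set). ennreal (exp (- soft_abs 1 (u i))))" for u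
    by (simp add: prod_ennreal exp_sum[symmetric] sum_negf)
  then have "(\<integral>\<^sup>+u. ennreal (exp (- (\<Sum>i\<in>(UNIV :: 'd set). soft_abs 1 (u i)))) \<partial>PiLB) = (\<Prod>i\<in>(UNIV :: 'd set). s)"
    using LB.product_nn_integral_prod[of UNIV "\<lambda>_ u. ennreal (exp (- soft_abs 1 u))"]
    by (simp add: s_def)
  also have "\<dots> = ennreal (s' ^ CARD('d))" using s' by (simp add: ennreal_power)
  finally show ?thesis using that[of "s' ^ CARD('d)"] s'(2) by simp
qed

text \<open>Width and exponential rate are both 1 / (n + 1), so one dominated convergence removes
  them together: for nonnegative \<phi> the integrand is at most \<open>b\<close> times the noise
  density, whose product with \<nu> has mass \<open>b * S\<close>. Continuity is demanded
  sequentially on the orthant, where the absolute values live.\<close>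

lemma tendsto_smoothed_integral:
  fixes \<nu> :: "(real ^ 'd) measure" and \<phi> :: "('d \<Rightarrow> real) \<Rightarrow> real"
  assumes sm: "\<And>n. smoothed_measure \<nu> (real (Suc n)) (1 / real (Suc n))"
    and \<phi>: "\<phi> \<in> borel_measurable (PiHL UNIV)"
    and \<phi>0: "\<And>y. (\<And>i. 0 \<le> y i) \<Longrightarrow> 0 \<le> \<phi> y" and \<phi>b: "\<And>y. (\<And>i. 0 \<le> y i) \<Longrightarrow> \<phi> y \<le> b"
    and cont: "\<And>(Y :: nat \<Rightarrow> 'd \<Rightarrow> real) y. (\<And>n i. 0 \<le> Y n i) \<Longrightarrow> (\<And>i. 0 \<le> y i) \<Longrightarrow>
       (\<And>i. (\<lambda>n. Y n i) \<longlonglongrightarrow> y i) \<Longrightarrow> (\<lambda>n. \<phi> (Y n)) \<longlonglongrightarrow> \<phi> y"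
    and S: "(\<integral>\<^sup>+u. ennreal (exp (- (\<Sum>i\<in>(UNIV :: 'd set). soft_abs 1 (u i)))) \<partial>PiLB) = ennreal S" "0 < S"
  shows "(\<lambda>n. (2 * real (Suc n)) ^ CARD('d) *
      (\<integral>y. \<phi> y * smoothed_measure.dens \<nu> (real (Suc n)) (1 / real (Suc n)) y \<partial>PiHL UNIV))
    \<longlonglongrightarrow> S * (\<integral>z. \<phi> (\<lambda>i. \<bar>z $ i\<bar>) \<partial>\<nu>)"
proof -
  interpret s0: smoothed_measure \<nu> "real (Suc 0)" "1 / real (Suc 0)" by (rule sm)
  interpret LB: product_sigma_finite "\<lambda>_::'d. lborel :: real measure"
    by (simp add: product_sigma_finite_def lborel.sigma_finite_measure_axioms)
  interpret PL: sigma_finite_measure "PiLB :: ('d \<Rightarrow> real) measure" by (rule LB.sigma_finite) simp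
  define J where "J = (\<lambda>n. (2 * real (Suc n)) ^ CARD('d) *
      (\<integral>y. \<phi> y * smoothed_measure.dens \<nu> (real (Suc n)) (1 / real (Suc n)) y \<partial>PiHL UNIV))"
  define E where "E = (\<lambda>u :: 'd \<Rightarrow> real. exp (- (\<Sum>i\<in>UNIV. soft_abs 1 (u i))))"
  define Y where "Y = (\<lambda>n (p :: (real ^ 'd) \<times> ('d \<Rightarrow> real)) i. \<bar>fst p $ i + snd p i / real (Suc n)\<bar> :: real)"
  define W where "W = (\<lambda>n (p :: (real ^ 'd) \<times> ('d \<Rightarrow> real)).
      ennreal (\<phi> (Y n p) * exp (- (1 / real (Suc n) * (\<Sum>i\<in>UNIV. Y n p i))) * E (snd p)))"
  have spn: "y \<in> space (PiHL UNIV) \<longleftrightarrow> (\<forall>i. 0 \<le> y i)" for y :: "'d \<Rightarrow> real" by (auto simp: space_PiHL)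
  have b0: "0 \<le> b" using \<phi>0[of "\<lambda>_. 0"] \<phi>b[of "\<lambda>_. 0"] by simp
  have J0: "0 \<le> J n" and JW: "ennreal (J n) = (\<integral>\<^sup>+p. W n p \<partial>(\<nu> \<Otimes>\<^sub>M PiLB))" for n
  proof -
    interpret smoothed_measure \<nu> "real (Suc n)" "1 / real (Suc n)" by (rule sm)
    have adm: "admissible UNIV (real (Suc n) + 1 / real (Suc n)) 1 (1 / real (Suc n)) dens"
      by (rule admissible_dens) auto
    have int: "integrable (PiHL UNIV) (\<lambda>y. \<phi> y * dens y)"
      by (rule admissible_integrable_mult[OF finite \<delta> adm \<phi>, of b]) (use \<phi>0 \<phi>b in \<open>auto simp: spn\<close>)
    have nn: "0 \<le> \<phi> y * dens y" if "y \<in> space (PiHL UNIV)" for y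
      using \<phi>0 that dens_pos[of y] by (auto simp: spn)
    have I0: "0 \<le> (\<integral>y. \<phi> y * dens y \<partial>PiHL UNIV)"
      by (intro integral_nonneg_AE AE_I2 nn)
    then show "0 \<le> J n"
      unfolding J_def by (intro mult_nonneg_nonneg) auto
    have "ennreal (J n) = ennreal ((2 * real (Suc n)) ^ CARD('d)) * ennreal (\<integral>y. \<phi> y * dens y \<partial>PiHL UNIV)"
      unfolding J_def by (rule ennreal_mult[OF _ I0]) simp
    also have "ennreal (\<integral>y. \<phi> y * dens y \<partial>PiHL UNIV) = (\<integral>\<^sup>+y. ennreal (\<phi> y * dens y) \<partial>PiHL UNIV)"
      by (intro nn_integral_eq_integral[symmetric] int AE_I2 nn)
    also have "ennreal ((2 * real (Suc n)) ^ CARD('d)) * \<dots> = (\<integral>\<^sup>+p. W n p \<partial>(\<nu> \<Otimes>\<^sub>M PiLB))"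
      unfolding W_def Y_def E_def by (rule nn_integral_dens[OF \<phi>]) (use \<phi>0 in \<open>auto simp: spn\<close>)
    finally show "ennreal (J n) = (\<integral>\<^sup>+p. W n p \<partial>(\<nu> \<Otimes>\<^sub>M PiLB))" .
  qed
  have fm: "(\<lambda>p. fst p $ i) \<in> borel_measurable (\<nu> \<Otimes>\<^sub>M (PiLB :: ('d \<Rightarrow> real) measure))" for i
    by (rule measurable_compose[OF measurable_fst s0.measurable_nth])
  have comp: "(\<lambda>y. y i) \<in> borel_measurable (PiLB :: ('d \<Rightarrow> real) measure)" for i
    using measurable_component_singleton[of i UNIV "\<lambda>_. lborel :: real measure"] by simp
  have sndm: "(\<lambda>p. snd p i) \<in> borel_measurable (\<nu> \<Otimes>\<^sub>M PiLB)" for i :: 'd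
    by (rule measurable_compose[OF measurable_snd comp])
  have Em: "E \<in> borel_measurable PiLB"
    unfolding E_def
    by (intro measurable_compose[OF _ borel_measurable_exp] borel_measurable_uminus borel_measurable_sum
        measurable_compose[OF comp measurable_soft_abs])
  have E2: "(\<lambda>p. E (snd p)) \<in> borel_measurable (\<nu> \<Otimes>\<^sub>M PiLB)"
    by (rule measurable_compose[OF measurable_snd Em])
  have Ym: "(\<lambda>p. Y n p i) \<in> borel_measurable (\<nu> \<Otimes>\<^sub>M PiLB)" for n and i :: 'd
    unfolding Y_def by (intro borel_measurable_abs borel_measurable_add borel_measurable_divide fm sndm borel_measurable_const)
  have \<phi>Y: "(\<lambda>p. \<phi> (Y n p)) \<in> borel_measurable (\<nu> \<Otimes>\<^sub>M PiLB)" for n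
    unfolding Y_def
    by (rule measurable_compose[OF measurable_abs_PiHL \<phi>])
       (intro borel_measurable_add borel_measurable_divide fm sndm borel_measurable_const)
  have \<phi>z: "(\<lambda>z. \<phi> (\<lambda>i. \<bar>z $ i\<bar>)) \<in> borel_measurable \<nu>"
    by (rule measurable_compose[OF measurable_abs_PiHL \<phi>]) (rule s0.measurable_nth)
  have E0: "0 \<le> E u" for u by (simp add: E_def)
  have SE: "(\<integral>\<^sup>+u. ennreal (E u) \<partial>PiLB) = ennreal S" using S(1) by (simp add: E_def)
  have "(\<lambda>n. (\<integral>\<^sup>+p. W n p \<partial>(\<nu> \<Otimes>\<^sub>M PiLB))) \<longlonglongrightarrow> (\<integral>\<^sup>+p. ennreal (\<phi> (\<lambda>i. \<bar>fst p $ i\<bar>) * E (snd p)) \<partial>(\<nu> \<Otimes>\<^sub>M PiLB))"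
  proof (rule nn_integral_dominated_convergence[where w = "\<lambda>p. ennreal b * ennreal (E (snd p))"])
    show "W n \<in> borel_measurable (\<nu> \<Otimes>\<^sub>M PiLB)" for n
      unfolding W_def
      by (intro measurable_compose[OF _ measurable_ennreal] borel_measurable_times \<phi>Y E2 measurable_compose[OF _ borel_measurable_exp]
          borel_measurable_uminus borel_measurable_sum Ym borel_measurable_const)
    show "(\<lambda>p. ennreal (\<phi> (\<lambda>i. \<bar>fst p $ i\<bar>) * E (snd p))) \<in> borel_measurable (\<nu> \<Otimes>\<^sub>M PiLB)"
      by (intro measurable_compose[OF _ measurable_ennreal] borel_measurable_times E2 measurable_compose[OF measurable_fst \<phi>z])
    have "(\<lambda>p. ennreal (E (snd p))) \<in> borel_measurable (\<nu> \<Otimes>\<^sub>M PiLB)"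
      by (rule measurable_compose[OF E2 measurable_ennreal])
    then show "(\<lambda>p. ennreal b * ennreal (E (snd p))) \<in> borel_measurable (\<nu> \<Otimes>\<^sub>M PiLB)" by measurable
    show "AE p in \<nu> \<Otimes>\<^sub>M PiLB. W n p \<le> ennreal b * ennreal (E (snd p))" for n
    proof (rule AE_I2)
      fix p :: "(real ^ 'd) \<times> ('d \<Rightarrow> real)"
      have Y0: "0 \<le> Y n p i" for i by (simp add: Y_def)
      have "\<phi> (Y n p) * exp (- (1 / real (Suc n) * (\<Sum>i\<in>UNIV. Y n p i))) \<le> b * 1"
      proof (rule mult_mono[OF \<phi>b[OF Y0] _ b0])
        have "0 \<le> 1 / real (Suc n) * (\<Sum>i\<in>UNIV. Y n p i)" by (intro mult_nonneg_nonneg sum_nonneg Y0) simp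
        then show "exp (- (1 / real (Suc n) * (\<Sum>i\<in>UNIV. Y n p i))) \<le> 1" by simp
      qed simp
      then have "\<phi> (Y n p) * exp (- (1 / real (Suc n) * (\<Sum>i\<in>UNIV. Y n p i))) * E (snd p) \<le> b * E (snd p)"
        using E0 by (intro mult_right_mono) auto
      then show "W n p \<le> ennreal b * ennreal (E (snd p))"
        unfolding W_def using b0 E0 by (simp add: ennreal_mult[symmetric] ennreal_leI)
    qed
    have "(\<integral>\<^sup>+p. ennreal b * ennreal (E (snd p)) \<partial>(\<nu> \<Otimes>\<^sub>M PiLB)) = (\<integral>\<^sup>+z. (\<integral>\<^sup>+u. ennreal b * ennreal (E u) \<partial>PiLB) \<partial>\<nu>)"
      using PL.nn_integral_fst[of "\<lambda>p. ennreal b * ennreal (E (snd p))" \<nu>] \<open>(\<lambda>p. ennreal b * ennreal (E (snd p))) \<in> _\<close> by simp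
    also have "\<dots> = ennreal b * ennreal S"
      using Em by (subst nn_integral_cmult) (auto simp: SE s0.emeasure_space_1)
    finally show "(\<integral>\<^sup>+p. ennreal b * ennreal (E (snd p)) \<partial>(\<nu> \<Otimes>\<^sub>M PiLB)) < \<infinity>"
      by (simp add: ennreal_mult_less_top)
    show "AE p in \<nu> \<Otimes>\<^sub>M PiLB. (\<lambda>n. W n p) \<longlonglongrightarrow> ennreal (\<phi> (\<lambda>i. \<bar>fst p $ i\<bar>) * E (snd p))"
    proof (rule AE_I2)
      fix p :: "(real ^ 'd) \<times> ('d \<Rightarrow> real)"
      have inv: "(\<lambda>n. 1 / real (Suc n)) \<longlonglongrightarrow> 0" using LIMSEQ_inverse_real_of_nat by (simp add: inverse_eq_divide)
      have Ylim: "(\<lambda>n. Y n p i) \<longlonglongrightarrow> \<bar>fst p $ i\<bar>" for i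
      proof -
        have "(\<lambda>n. \<bar>fst p $ i + snd p i * (1 / real (Suc n))\<bar>) \<longlonglongrightarrow> \<bar>fst p $ i + snd p i * 0\<bar>"
          by (intro tendsto_intros inv)
        then show ?thesis by (simp add: Y_def)
      qed
      have "(\<lambda>n. \<phi> (Y n p)) \<longlonglongrightarrow> \<phi> (\<lambda>i. \<bar>fst p $ i\<bar>)"
        by (rule cont) (auto simp: Ylim, simp add: Y_def)
      then have "(\<lambda>n. \<phi> (Y n p) * exp (- (1 / real (Suc n) * (\<Sum>i\<in>UNIV. Y n p i))) * E (snd p))
          \<longlonglongrightarrow> \<phi> (\<lambda>i. \<bar>fst p $ i\<bar>) * exp (- (0 * (\<Sum>i\<in>UNIV. \<bar>fst p $ i\<bar>))) * E (snd p)"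
        by (intro tendsto_mult tendsto_exp tendsto_minus tendsto_sum inv Ylim tendsto_const)
      then show "(\<lambda>n. W n p) \<longlonglongrightarrow> ennreal (\<phi> (\<lambda>i. \<bar>fst p $ i\<bar>) * E (snd p))"
        unfolding W_def by (intro tendsto_ennrealI) simp
    qed
  qed
  also have "(\<integral>\<^sup>+p. ennreal (\<phi> (\<lambda>i. \<bar>fst p $ i\<bar>) * E (snd p)) \<partial>(\<nu> \<Otimes>\<^sub>M PiLB))
      = (\<integral>\<^sup>+z. (\<integral>\<^sup>+u. ennreal (\<phi> (\<lambda>i. \<bar>z $ i\<bar>)) * ennreal (E u) \<partial>PiLB) \<partial>\<nu>)"
  proof (subst PL.nn_integral_fst[symmetric])
    show "(\<lambda>p. ennreal (\<phi> (\<lambda>i. \<bar>fst p $ i\<bar>) * E (snd p))) \<in> borel_measurable (\<nu> \<Otimes>\<^sub>M PiLB)"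
      by (intro measurable_compose[OF _ measurable_ennreal] borel_measurable_times E2 measurable_compose[OF measurable_fst \<phi>z])
  qed (simp add: ennreal_mult \<phi>0 E0)
  also have "\<dots> = (\<integral>\<^sup>+z. ennreal (S * \<phi> (\<lambda>i. \<bar>z $ i\<bar>)) \<partial>\<nu>)"
  proof (rule nn_integral_cong)
    fix z :: "real ^ 'd"
    have "(\<integral>\<^sup>+u. ennreal (\<phi> (\<lambda>i. \<bar>z $ i\<bar>)) * ennreal (E u) \<partial>PiLB) = ennreal (\<phi> (\<lambda>i. \<bar>z $ i\<bar>)) * ennreal S"
      using measurable_compose[OF Em measurable_ennreal] by (simp add: nn_integral_cmult SE)
    then show "(\<integral>\<^sup>+u. ennreal (\<phi> (\<lambda>i. \<bar>z $ i\<bar>)) * ennreal (E u) \<partial>PiLB) = ennreal (S * \<phi> (\<lambda>i. \<bar>z $ i\<bar>))"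
      using S(2) \<phi>0[of "\<lambda>i. \<bar>z $ i\<bar>"] by (simp add: ennreal_mult mult.commute)
  qed
  also have "\<dots> = ennreal (S * (\<integral>z. \<phi> (\<lambda>i. \<bar>z $ i\<bar>) \<partial>\<nu>))"
  proof -
    have "integrable \<nu> (\<lambda>z. \<phi> (\<lambda>i. \<bar>z $ i\<bar>))"
      by (rule s0.integrable_const_bound[of _ b]) (use \<phi>z \<phi>0 \<phi>b in \<open>auto\<close>)
    then show ?thesis
      using S(2) \<phi>0 by (subst nn_integral_eq_integral) (auto intro!: integrable_mult_right)
  qed
  finally have "(\<lambda>n. ennreal (J n)) \<longlonglongrightarrow> ennreal (S * (\<integral>z. \<phi> (\<lambda>i. \<bar>z $ i\<bar>) \<partial>\<nu>))" unfolding JW .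
  moreover have "0 \<le> S * (\<integral>z. \<phi> (\<lambda>i. \<bar>z $ i\<bar>) \<partial>\<nu>)"
    using S(2) \<phi>0 by (intro mult_nonneg_nonneg integral_nonneg_AE AE_I2) auto
  ultimately have "J \<longlonglongrightarrow> S * (\<integral>z. \<phi> (\<lambda>i. \<bar>z $ i\<bar>) \<partial>\<nu>)"
    using J0 by (subst (asm) tendsto_ennreal_iff) auto
  then show ?thesis unfolding J_def .
qed

text \<open>The inequality for the smoothed density depends on ratios of integrals, so it can be
  written with the rescaled integrals that converge, and the limit is taken term by term.\<close>

lemma log_laplace_unconditional:
  fixes \<nu> :: "(real ^ 'd) measure" and a :: "'d \<Rightarrow> real" and G :: "('d \<Rightarrow> real) \<Rightarrow> real"
  defines "\<psi> \<equiv> \<lambda>i x. 1 - exp (- (a i * x))"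
  assumes sm: "\<And>n. smoothed_measure \<nu> (real (Suc n)) (1 / real (Suc n))"
    and C: "0 < C" and a: "\<And>i. 0 < a i" and tc: "\<And>i. transport_cost C (\<psi> i)"
    and G: "G \<in> borel_measurable (PiHL UNIV)" and L: "0 \<le> L"
    and Gb: "\<And>y. (\<And>i. 0 \<le> y i) \<Longrightarrow> \<bar>G y\<bar> \<le> b"
    and Glip: "\<And>x y. (\<And>i. 0 \<le> x i) \<Longrightarrow> (\<And>i. 0 \<le> y i) \<Longrightarrow>
       \<bar>G y - G x\<bar> \<le> L * sqrt (\<Sum>i\<in>UNIV. (\<psi> i (y i) - \<psi> i (x i))\<^sup>2)"
  shows "ln (\<integral>z. exp (t * G (\<lambda>i. \<bar>z $ i\<bar>)) \<partial>\<nu>) \<le> t * (\<integral>z. G (\<lambda>i. \<bar>z $ i\<bar>) \<partial>\<nu>) + C / 4 * L\<^sup>2 * t\<^sup>2"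
proof -
  interpret s0: smoothed_measure \<nu> "real (Suc 0)" "1 / real (Suc 0)" by (rule sm)
  obtain S where S: "0 < S" "(\<integral>\<^sup>+u. ennreal (exp (- (\<Sum>i\<in>(UNIV :: 'd set). soft_abs 1 (u i)))) \<partial>PiLB) = ennreal S"
    by (rule nn_integral_exp_soft_abs)
  \<comment> \<open>The factor of \<open>tendsto_smoothed_integral\<close>. It cancels in the
    quotient and, after taking logarithms, from both sides.\<close>
  define k where "k = (\<lambda>n. (2 * real (Suc n)) ^ CARD('d))"
  define dens where "dens = (\<lambda>n. smoothed_measure.dens \<nu> (real (Suc n)) (1 / real (Suc n)))"
  define I where "I = (\<lambda>n \<phi>. \<integral>y. \<phi> y * dens n y \<partial>PiHL (UNIV :: 'd set))"
  have spn: "y \<in> space (PiHL UNIV) \<longleftrightarrow> (\<forall>i. 0 \<le> y i)" for y :: "'d \<Rightarrow> real" by (auto simp: space_PiHL)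
  have k0: "0 < k n" for n by (simp add: k_def)
  \<comment> \<open>\<open>Glip\<close> bounds the increment of \<open>G\<close> by a continuous
    function of the coordinates that vanishes at \<open>y\<close>.\<close>
  have Gcont: "(\<lambda>n. G (Y n)) \<longlonglongrightarrow> G y"
    if Y: "\<And>n i. 0 \<le> Y n i" and y: "\<And>i. 0 \<le> y i" and lim: "\<And>i. (\<lambda>n. Y n i) \<longlonglongrightarrow> y i" for Y y
  proof -
    have "(\<lambda>n. L * sqrt (\<Sum>i\<in>UNIV. (\<psi> i (Y n i) - \<psi> i (y i))\<^sup>2)) \<longlonglongrightarrow> L * sqrt (\<Sum>i\<in>(UNIV :: 'd set). (\<psi> i (y i) - \<psi> i (y i))\<^sup>2)"
      unfolding \<psi>_def by (intro tendsto_intros lim)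
    then have "(\<lambda>n. L * sqrt (\<Sum>i\<in>UNIV. (\<psi> i (Y n i) - \<psi> i (y i))\<^sup>2)) \<longlonglongrightarrow> 0" by simp
    then have "(\<lambda>n. G (Y n) - G y) \<longlonglongrightarrow> 0"
      by (rule Lim_null_comparison[rotated]) (use Glip[OF y Y] in \<open>auto intro!: always_eventually\<close>)
    then show ?thesis by (simp add: LIM_zero_iff)
  qed
  have lim: "(\<lambda>n. k n * I n \<phi>) \<longlonglongrightarrow> S * (\<integral>z. \<phi> (\<lambda>i. \<bar>z $ i\<bar>) \<partial>\<nu>)"
    if "\<phi> \<in> borel_measurable (PiHL UNIV)" "\<And>y. (\<And>i. 0 \<le> y i) \<Longrightarrow> 0 \<le> \<phi> y" "\<And>y. (\<And>i. 0 \<le> y i) \<Longrightarrow> \<phi> y \<le> b'"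
      "\<And>(Y :: nat \<Rightarrow> 'd \<Rightarrow> real) y. (\<And>n i. 0 \<le> Y n i) \<Longrightarrow> (\<And>i. 0 \<le> y i) \<Longrightarrow>
       (\<And>i. (\<lambda>n. Y n i) \<longlonglongrightarrow> y i) \<Longrightarrow> (\<lambda>n. \<phi> (Y n)) \<longlonglongrightarrow> \<phi> y" for \<phi> b'
    unfolding k_def I_def dens_def by (rule tendsto_smoothed_integral[OF sm that S(2,1)])
  have int: "integrable (PiHL UNIV) (\<lambda>y. \<phi> y * dens n y)"
    if "\<phi> \<in> borel_measurable (PiHL UNIV)" "\<And>y. (\<And>i. 0 \<le> y i) \<Longrightarrow> \<bar>\<phi> y\<bar> \<le> b'" for \<phi> b' n
  proof -
    interpret s: smoothed_measure \<nu> "real (Suc n)" "1 / real (Suc n)" by (rule sm)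
    have adm: "admissible UNIV (real (Suc n) + 1 / real (Suc n)) 1 (1 / real (Suc n)) s.dens"
      by (rule s.admissible_dens) auto
    show ?thesis
      unfolding dens_def by (rule admissible_integrable_mult[OF finite s.\<delta> adm that(1), of b']) (use that(2) in \<open>auto simp: spn\<close>)
  qed
  have Ipos: "0 < I n \<phi>"
    if "\<phi> \<in> borel_measurable (PiHL UNIV)" "\<And>y. (\<And>i. 0 \<le> y i) \<Longrightarrow> \<bar>\<phi> y\<bar> \<le> b'" "\<And>y. 0 < \<phi> y" for \<phi> b' n
  proof -
    interpret s: smoothed_measure \<nu> "real (Suc n)" "1 / real (Suc n)" by (rule sm)
    show ?thesis unfolding I_def
      by (rule integral_pos[OF int[OF that(1,2)] _ PiHL_nonzero[OF finite]]) (use that(3) s.dens_pos in \<open>auto simp: dens_def\<close>)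
  qed
  have em: "(\<lambda>y. exp (t * G y)) \<in> borel_measurable (PiHL UNIV)" using G by measurable
  have eb: "exp (t * G y) \<le> exp (\<bar>t\<bar> * b)" if "\<And>i. 0 \<le> y i" for y
  proof -
    have "t * G y \<le> \<bar>t * G y\<bar>" by simp
    also have "\<dots> \<le> \<bar>t\<bar> * b" unfolding abs_mult using Gb[OF that] by (intro mult_left_mono) auto
    finally show ?thesis by simp
  qed
  have one: "(\<lambda>y. 1 :: real) \<in> borel_measurable (PiHL UNIV)" by simp
  have Gbm: "(\<lambda>y. G y + b) \<in> borel_measurable (PiHL UNIV)" using G by measurable
  have P1: "0 < I n (\<lambda>_. 1)" for n by (rule Ipos[OF one, of 1]) auto
  have PE: "0 < I n (\<lambda>y. exp (t * G y))" for n by (rule Ipos[OF em, of "exp (\<bar>t\<bar> * b)"]) (use eb in auto)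
  have L1: "(\<lambda>n. k n * I n (\<lambda>_. 1)) \<longlonglongrightarrow> S"
    using lim[OF one, of 1] by (simp add: s0.prob_space)
  have LE: "(\<lambda>n. k n * I n (\<lambda>y. exp (t * G y))) \<longlonglongrightarrow> S * (\<integral>z. exp (t * G (\<lambda>i. \<bar>z $ i\<bar>)) \<partial>\<nu>)"
    by (rule lim[OF em _ eb]) (auto intro!: tendsto_exp tendsto_mult Gcont)
  \<comment> \<open>The limit lemma is for nonnegative functions, so \<open>G\<close> is raised by
    its bound \<open>b\<close>; \<open>ineq\<close> subtracts it again from the quotient.\<close>
  have LG: "(\<lambda>n. k n * I n (\<lambda>y. G y + b)) \<longlonglongrightarrow> S * (\<integral>z. G (\<lambda>i. \<bar>z $ i\<bar>) + b \<partial>\<nu>)"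
  proof (rule lim[OF Gbm, of "2 * b"])
    fix y :: "'d \<Rightarrow> real" assume "\<And>i. 0 \<le> y i"
    then have "\<bar>G y\<bar> \<le> b" by (rule Gb)
    then show "0 \<le> G y + b" "G y + b \<le> 2 * b" by auto
  qed (intro tendsto_add Gcont tendsto_const)
  have Gm: "(\<lambda>z. G (\<lambda>i. \<bar>z $ i\<bar>)) \<in> borel_measurable \<nu>"
    by (rule measurable_compose[OF measurable_abs_PiHL G]) (rule s0.measurable_nth)
  have iG: "integrable \<nu> (\<lambda>z. G (\<lambda>i. \<bar>z $ i\<bar>))"
    by (rule s0.integrable_const_bound[of _ b]) (use Gm Gb in auto)
  have E1: "0 < (\<integral>z. exp (t * G (\<lambda>i. \<bar>z $ i\<bar>)) \<partial>\<nu>)"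
  proof (rule integral_pos)
    show "integrable \<nu> (\<lambda>z. exp (t * G (\<lambda>i. \<bar>z $ i\<bar>)))"
      by (rule s0.integrable_const_bound[of _ "exp (\<bar>t\<bar> * b)"]) (use Gm eb in auto)
  qed (auto simp: s0.emeasure_space_1)
  have ineq: "ln (k n * I n (\<lambda>y. exp (t * G y)))
      \<le> ln (k n * I n (\<lambda>_. 1)) + t * ((k n * I n (\<lambda>y. G y + b)) / (k n * I n (\<lambda>_. 1)) - b) + C / 4 * L\<^sup>2 * t\<^sup>2" for n
  proof -
    interpret s: smoothed_measure \<nu> "real (Suc n)" "1 / real (Suc n)" by (rule sm)
    have "ln (\<integral>y. exp (t * G y) * s.dens y \<partial>PiHL UNIV) \<le> ln (\<integral>y. s.dens y \<partial>PiHL UNIV)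
        + (t * (\<integral>y. G y * s.dens y \<partial>PiHL UNIV)) / (\<integral>y. s.dens y \<partial>PiHL UNIV) + C / 4 * L\<^sup>2 * t\<^sup>2"
    proof (rule s.log_laplace_dens[OF C a tc[unfolded \<psi>_def] G L])
      fix x y :: "'d \<Rightarrow> real" assume "x \<in> space (PiHL UNIV)" "y \<in> space (PiHL UNIV)"
      then have xy: "\<And>i. 0 \<le> x i" "\<And>i. 0 \<le> y i" by (auto simp: spn)
      show "\<bar>G y\<bar> \<le> b" by (rule Gb[OF xy(2)])
      show "\<bar>G y - G x\<bar> \<le> L * sqrt (\<Sum>i\<in>UNIV. ((1 - exp (- (a i * y i))) - (1 - exp (- (a i * x i))))\<^sup>2)"
        by (rule Glip[OF xy, unfolded \<psi>_def])
    qed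
    then have "ln (I n (\<lambda>y. exp (t * G y))) \<le> ln (I n (\<lambda>_. 1)) + t * I n G / I n (\<lambda>_. 1) + C / 4 * L\<^sup>2 * t\<^sup>2"
      by (simp add: I_def dens_def)
    moreover have "I n (\<lambda>y. G y + b) = I n G + b * I n (\<lambda>_. 1)"
      using int[OF G Gb, of n] int[OF one, of 1 n] by (simp add: I_def distrib_right)
    then have "t * ((k n * I n (\<lambda>y. G y + b)) / (k n * I n (\<lambda>_. 1)) - b) = t * I n G / I n (\<lambda>_. 1)"
      using k0[of n] P1[of n] by (simp add: field_simps)
    ultimately show ?thesis using k0[of n] P1[of n] PE[of n] by (simp add: ln_mult)
  qed
  have "ln (S * (\<integral>z. exp (t * G (\<lambda>i. \<bar>z $ i\<bar>)) \<partial>\<nu>))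
      \<le> ln S + t * ((S * (\<integral>z. G (\<lambda>i. \<bar>z $ i\<bar>) + b \<partial>\<nu>)) / S - b) + C / 4 * L\<^sup>2 * t\<^sup>2"
  proof (rule LIMSEQ_le)
    show "(\<lambda>n. ln (k n * I n (\<lambda>y. exp (t * G y)))) \<longlonglongrightarrow> ln (S * (\<integral>z. exp (t * G (\<lambda>i. \<bar>z $ i\<bar>)) \<partial>\<nu>))"
      by (rule tendsto_ln[OF LE]) (use S(1) E1 in simp)
    show "(\<lambda>n. ln (k n * I n (\<lambda>_. 1)) + t * ((k n * I n (\<lambda>y. G y + b)) / (k n * I n (\<lambda>_. 1)) - b) + C / 4 * L\<^sup>2 * t\<^sup>2)
      \<longlonglongrightarrow> ln S + t * ((S * (\<integral>z. G (\<lambda>i. \<bar>z $ i\<bar>) + b \<partial>\<nu>)) / S - b) + C / 4 * L\<^sup>2 * t\<^sup>2"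
      by (intro tendsto_add tendsto_mult tendsto_diff tendsto_divide tendsto_const tendsto_ln L1 LG) (use S(1) in simp_all)
    show "\<exists>N. \<forall>n\<ge>N. ln (k n * I n (\<lambda>y. exp (t * G y)))
      \<le> ln (k n * I n (\<lambda>_. 1)) + t * ((k n * I n (\<lambda>y. G y + b)) / (k n * I n (\<lambda>_. 1)) - b) + C / 4 * L\<^sup>2 * t\<^sup>2"
      using ineq by blast
  qed
  also have "(S * (\<integral>z. G (\<lambda>i. \<bar>z $ i\<bar>) + b \<partial>\<nu>)) / S - b = (\<integral>z. G (\<lambda>i. \<bar>z $ i\<bar>) \<partial>\<nu>)"
    using S(1) iG by (simp add: s0.prob_space)
  finally show ?thesis using S(1) E1 by (simp add: ln_mult)
qed

section \<open>Transfer to the random vector\<close>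

lemma borel_measurable_vec_lambda:
  fixes f :: "'d::finite \<Rightarrow> 'a \<Rightarrow> real"
  assumes "\<And>i. f i \<in> borel_measurable M"
  shows "(\<lambda>x. \<chi> i. f i x) \<in> borel_measurable M"
  using assms by (subst borel_measurable_euclidean_space) (auto simp: Basis_vec_def inner_axis)

theorem theorem5p4:
  fixes C_clip :: real
    and M :: "'a measure" and X :: "'a \<Rightarrow> real ^ 'd"
    and a :: "real ^ 'd" and g :: "real ^ 'd \<Rightarrow> real" and L t :: real
  assumes "clipping_constant C_clip"
    and "prob_space M"
    and "X \<in> borel_measurable M"
    and "unconditional M X"
    and "log_concave_measure (distr M borel X)"
    and "\<forall>i. a $ i > 0"
    and "L-lipschitz_on {y. \<forall>i. y $ i \<in> {0..1}} g"
  shows "ln (\<integral>\<omega>. exp (t * (g (Psi a \<bar>X \<omega>\<bar>) - (\<integral>\<omega>'. g (Psi a \<bar>X \<omega>'\<bar>) \<partial>M))) \<partial>M)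
           \<le> (C_clip / 4) * L\<^sup>2 * t\<^sup>2"
proof -
  interpret prob_space M by fact
  note X = \<open>X \<in> borel_measurable M\<close> and lip = \<open>L-lipschitz_on {y. \<forall>i. y $ i \<in> {0..1}} g\<close>
  define \<nu> where "\<nu> = distr M borel X"
  define cube where "cube = {y :: real ^ 'd. \<forall>i. y $ i \<in> {0..1}}"
  define G where "G = (\<lambda>y. g (\<chi> i. 1 - exp (- (a $ i * y i))))"
  have L: "0 \<le> L" using lip by (rule lipschitz_on_nonneg)
  have a: "0 < a $ i" for i using assms(6) by simp
  have sm: "smoothed_measure \<nu> (real (Suc n)) (1 / real (Suc n))" for n
  proof -
    have "prob_space \<nu>" unfolding \<nu>_def by (rule prob_space_distr[OF X])
    moreover have "distr \<nu> borel (\<lambda>z. \<chi> i. e $ i * z $ i) = \<nu>" if e: "\<And>i. e $ i \<in> {-1, 1}" for e :: "real ^ 'd"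
    proof -
      have m: "(\<lambda>z :: real ^ 'd. \<chi> i. e $ i * z $ i) \<in> borel_measurable borel"
        by (intro borel_measurable_vec_lambda borel_measurable_times borel_measurable_const measurable_vec_nth)
      have "distr \<nu> borel (\<lambda>z. \<chi> i. e $ i * z $ i) = distr M borel (\<lambda>\<omega>. \<chi> i. e $ i * X \<omega> $ i)"
        unfolding \<nu>_def by (subst distr_distr[OF m X]) (simp add: comp_def)
      also have "\<dots> = \<nu>" using assms(4) e unfolding unconditional_def \<nu>_def by blast
      finally show ?thesis .
    qed
    ultimately show ?thesis
      using assms(5) unfolding smoothed_measure_def smoothed_measure_axioms_def by (auto simp: \<nu>_def)
  qed
  have cubeI: "(\<chi> i. 1 - exp (- (a $ i * y i))) \<in> cube" if "\<And>i. 0 \<le> y i" for y :: "'d \<Rightarrow> real"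
    using that a by (auto simp: cube_def less_imp_le)
  have cube_closed: "closed cube"
    unfolding cube_def by (intro closed_Collect_all closed_Collect_conj closed_Collect_le continuous_intros)
      (auto simp: atLeastAtMost_iff intro!: closed_Collect_conj closed_Collect_le continuous_intros)
  have Gm: "G \<in> borel_measurable (PiHL UNIV)"
  proof -
    \<comment> \<open>\<open>g\<close> is Lipschitz on the cube and arbitrary outside, so
      measurability is obtained for its truncation to the cube, which contains every value of the
      map inside \<open>G\<close>.\<close>
    have "(\<lambda>v. indicator cube v *\<^sub>R g v) \<in> borel_measurable borel"
      using cube_closed lipschitz_on_continuous_on[OF lip] unfolding cube_def[symmetric]
      by (intro borel_measurable_continuous_on_indicator) auto
    moreover have "(\<lambda>y. \<chi> i. 1 - exp (- (a $ i * y i))) \<in> borel_measurable (PiHL UNIV)"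
      by (intro borel_measurable_vec_lambda borel_measurable_diff borel_measurable_const measurable_compose[OF _ borel_measurable_exp]
          borel_measurable_uminus borel_measurable_times measurable_component_HL UNIV_I)
    ultimately have m: "(\<lambda>y. indicator cube (\<chi> i. 1 - exp (- (a $ i * y i))) *\<^sub>R G y) \<in> borel_measurable (PiHL UNIV)"
      unfolding G_def by (rule measurable_compose[rotated])
    have eq: "indicator cube (\<chi> i. 1 - exp (- (a $ i * y i))) *\<^sub>R G y = G y" if "y \<in> space (PiHL UNIV)" for y
    proof -
      have "(\<chi> i. 1 - exp (- (a $ i * y i))) \<in> cube" using that by (intro cubeI) (auto simp: space_PiHL)
      then show ?thesis by simp
    qed
    show ?thesis by (rule measurable_cong[THEN iffD1, OF eq m])
  qed
  have Glip: "\<bar>G y - G x\<bar> \<le> L * sqrt (\<Sum>i\<in>UNIV. ((1 - exp (- (a $ i * y i))) - (1 - exp (- (a $ i * x i))))\<^sup>2)"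
    if "\<And>i. 0 \<le> x i" "\<And>i. 0 \<le> y i" for x y :: "'d \<Rightarrow> real"
  proof -
    have "\<bar>G y - G x\<bar> \<le> L * norm ((\<chi> i. 1 - exp (- (a $ i * y i))) - (\<chi> i. 1 - exp (- (a $ i * x i))))"
      using lipschitz_onD[OF lip[folded cube_def] cubeI[OF that(2)] cubeI[OF that(1)]] by (simp add: G_def dist_norm)
    then show ?thesis by (simp add: norm_vec_def L2_set_def)
  qed
  \<comment> \<open>Compactness of the cube makes \<open>g\<close> bounded there; \<open>b\<close>
    controls integrability and disappears from the bound.\<close>
  obtain b where Gb: "\<bar>G y\<bar> \<le> b" if "\<And>i. 0 \<le> y i" for y
  proof -
    have "compact cube"
      unfolding compact_eq_bounded_closed bounded_iff
    proof (intro conjI exI ballI cube_closed)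
      fix v assume "v \<in> cube"
      then have "(\<Sum>i\<in>UNIV. \<bar>v $ i\<bar>) \<le> (\<Sum>i\<in>(UNIV :: 'd set). 1)" by (intro sum_mono) (auto simp: cube_def)
      then show "norm v \<le> (\<Sum>i\<in>(UNIV :: 'd set). 1)" using norm_le_l1_cart[of v] by linarith
    qed
    then have "bounded (g ` cube)"
      using lipschitz_on_continuous_on[OF lip] by (intro compact_imp_bounded compact_continuous_image) (simp_all add: cube_def)
    then obtain b where b: "\<And>v. v \<in> cube \<Longrightarrow> \<bar>g v\<bar> \<le> b" unfolding bounded_iff by auto
    show ?thesis by (rule that[of b]) (unfold G_def, rule b[OF cubeI])
  qed
  interpret \<nu>: smoothed_measure \<nu> "real (Suc 0)" "1 / real (Suc 0)" by (rule sm)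
  have GX: "G (\<lambda>i. \<bar>X \<omega> $ i\<bar>) = g (Psi a \<bar>X \<omega>\<bar>)" for \<omega> by (simp add: G_def Psi_def abs_vec_def)
  have G\<nu>: "(\<lambda>z. G (\<lambda>i. \<bar>z $ i\<bar>)) \<in> borel_measurable borel"
    by (rule measurable_compose[OF measurable_abs_PiHL Gm]) (rule measurable_vec_nth)
  have e1: "(\<integral>z. G (\<lambda>i. \<bar>z $ i\<bar>) \<partial>\<nu>) = (\<integral>\<omega>. g (Psi a \<bar>X \<omega>\<bar>) \<partial>M)"
    unfolding \<nu>_def by (subst integral_distr[OF X G\<nu>]) (simp add: GX)
  have e2: "(\<integral>z. exp (t * G (\<lambda>i. \<bar>z $ i\<bar>)) \<partial>\<nu>) = (\<integral>\<omega>. exp (t * g (Psi a \<bar>X \<omega>\<bar>)) \<partial>M)"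
    unfolding \<nu>_def by (subst integral_distr[OF X]) (use G\<nu> in \<open>auto simp: GX\<close>)
  let ?m = "\<integral>\<omega>. g (Psi a \<bar>X \<omega>\<bar>) \<partial>M" and ?E = "\<integral>\<omega>. exp (t * g (Psi a \<bar>X \<omega>\<bar>)) \<partial>M"
  have Epos: "0 < ?E"
  proof (rule integral_pos)
    have gm: "(\<lambda>\<omega>. g (Psi a \<bar>X \<omega>\<bar>)) \<in> borel_measurable M"
      using measurable_compose[OF X G\<nu>] by (simp add: GX)
    show "integrable M (\<lambda>\<omega>. exp (t * g (Psi a \<bar>X \<omega>\<bar>)))"
    proof (rule integrable_const_bound[of _ "exp (\<bar>t\<bar> * b)"])
      show "AE \<omega> in M. norm (exp (t * g (Psi a \<bar>X \<omega>\<bar>))) \<le> exp (\<bar>t\<bar> * b)"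
      proof (rule AE_I2)
        fix \<omega>
        have "t * G (\<lambda>i. \<bar>X \<omega> $ i\<bar>) \<le> \<bar>t\<bar> * \<bar>G (\<lambda>i. \<bar>X \<omega> $ i\<bar>)\<bar>" unfolding abs_mult[symmetric] by simp
        also have "\<dots> \<le> \<bar>t\<bar> * b" by (intro mult_left_mono Gb) auto
        finally show "norm (exp (t * g (Psi a \<bar>X \<omega>\<bar>))) \<le> exp (\<bar>t\<bar> * b)" by (simp add: GX)
      qed
    qed (use gm in measurable)
  qed (auto simp: emeasure_space_1)
  \<comment> \<open>Any constant strictly above \<open>C_clip\<close> is positive and still
    admissible. The bound is continuous in the constant, so the limit from the right gives it at
    \<open>C_clip\<close> itself, also when this is 0.\<close>
  have main: "ln ?E \<le> t * ?m + C / 4 * L\<^sup>2 * t\<^sup>2" if "C_clip < C" for C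
    unfolding e1[symmetric] e2[symmetric]
  proof (rule log_laplace_unconditional[OF sm _ a _ Gm L Gb Glip])
    show "0 < C" using assms(1) that by (simp add: clipping_constant_def)
    show "transport_cost C (\<lambda>x. 1 - exp (- (a $ i * x)))" for i
      using a assms(1) that by (intro transport_cost_exp clipping_constant_mono[OF assms(1)]) auto
  qed
  have "((\<lambda>C. t * ?m + C / 4 * L\<^sup>2 * t\<^sup>2) \<longlongrightarrow> t * ?m + C_clip / 4 * L\<^sup>2 * t\<^sup>2) (at_right C_clip)"
    by (intro tendsto_intros) simp
  then have "ln ?E \<le> t * ?m + C_clip / 4 * L\<^sup>2 * t\<^sup>2"
  proof (rule tendsto_lowerbound)
    show "\<forall>\<^sub>F C in at_right C_clip. ln ?E \<le> t * ?m + C / 4 * L\<^sup>2 * t\<^sup>2"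
      unfolding eventually_at_right_field by (intro exI[of _ "C_clip + 1"] conjI allI impI main) simp_all
  qed simp
  moreover have e: "exp (t * (x - m)) = exp (- (t * m)) * exp (t * x)" for x m :: real
    by (simp add: exp_add[symmetric] right_diff_distrib)
  have "(\<integral>\<omega>. exp (t * (g (Psi a \<bar>X \<omega>\<bar>) - ?m)) \<partial>M) = exp (- (t * ?m)) * ?E"
    unfolding e by (rule integral_mult_right_zero)
  then have "ln (\<integral>\<omega>. exp (t * (g (Psi a \<bar>X \<omega>\<bar>) - ?m)) \<partial>M) = ln ?E - t * ?m"
    using Epos by (simp only: ln_mult_pos[OF exp_gt_zero Epos] ln_exp)
  ultimately show ?thesis by linarith
qed

end
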